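(* The following pairs of functors are adjoint pairs: $(F_{\uparrow},F_{\downarrow})$ and $(F_{\downarrow},F_{-}\circ F_{\uparrow})$.
   Context: Let $\mathbf{k}$ be a commutative ring and $R=\mathbf{k}\langle x_1,x_2\rangle/(x_1x_2+x_2x_1)$, graded with $\deg x_1=\deg x_2=2$. Let $s$ be the $\mathbf{k}$-algebra automorphism of $R$ with $s(x_1)=-x_2$, $s(x_2)=-x_1$. The odd Demazure operator is the $\mathbf{k}$-linear map $\partial:R\to R$ with $\partial(1)=0$, $\partial(x_1)=\partial(x_2)=1$ and $\partial(fg)=\partial(f)g+s(f)\partial(g)$ for $f,g\in R$. Let $R^s=\ker\partial=\mathrm{im}\,\partial\subset R$; it is a graded subring, stable under $s$, generated by $x_1-x_2$ and $x_1x_2$. The transposition bimodule $\underline{R}$ is the graded $R$-bimodule that is free of rank one as a left and as a right $R$-module on a generator $\underline{1}$ of degree $0$, with $f\,\underline{1}=\underline{1}\,s(f)$ for $f\in R$. For a graded ring $A$, $A\text{-gmod}$ denotes the category of graded (left) $A$-modules and degree-zero maps. Functors: $F_{\uparrow}:R^s\text{-gmod}\to R\text{-gmod}$ is the induction functor of tensoring with the graded bimodule ${}_RR_{R^s}$, $F_\uparrow(M)=R\otimes_{R^s}M$; $F_{\downarrow}:R\text{-gmod}\to R^s\text{-gmod}$ is the restriction functor (isomorphic to tensoring with ${}_{R^s}R_R$); $F_-:R\text{-gmod}\to R\text{-gmod}$ is tensoring with $\underline{R}$, $F_-(M)=\underline{R}\otimes_R M$. In an adjoint pair $(F,G)$,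 the functor $F$ is left adjoint to $G$.
   Formalization: The second pair is proved with a grading shift: restriction is left adjoint to F_-∘F_↑ followed by the shift M⟨2⟩_i = M_{i+2}; without the shift, with degree-zero maps, it fails for k ≠ 0 (M = R, N = k in degree 2), since the odd Demazure operator has degree −2. *)

theory Defs
  imports "HOL-Algebra.QuotRing" "HOL-Algebra.Module" "HOL-Algebra.Generated_Groups" "HOL-Algebra.Free_Abelian_Groups"
begin

section \<open>Graded rings and graded modules\<close>

record 'a graded_ring = "'a ring" +
  rgrade :: "int \<Rightarrow> 'a set"

text \<open>As for the library's \<^type>\<open>module\<close> record, the fields \<^const>\<open>monoid.mult\<close> and
  \<^const>\<open>one\<close> inherited from rings carry no meaning for a module.\<close>

record ('a, 'b) graded_module = "('a, 'b) module" +
  mgrade :: "int \<Rightarrow> 'b set"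

record ('a, 'c, 'b) graded_bimodule = "('a, 'b) graded_module" +
  rsmult :: "'b \<Rightarrow> 'c \<Rightarrow> 'b"

text \<open>The abelian group is the internal direct sum of the subgroups \<open>\<gamma> i\<close>, \<open>i \<in> \<int>\<close>.\<close>

definition is_grading :: "('b, 'z) ring_scheme \<Rightarrow> (int \<Rightarrow> 'b set) \<Rightarrow> bool" where
  "is_grading M \<gamma> \<longleftrightarrow>
     (\<forall>i. additive_subgroup (\<gamma> i) M) \<and>
     (\<forall>x\<in>carrier M. \<exists>!c. (\<forall>i. c i \<in> \<gamma> i) \<and> finite {i. c i \<noteq> \<zero>\<^bsub>M\<^esub>} \<and>
        x = finsum M c {i. c i \<noteq> \<zero>\<^bsub>M\<^esub>})"

locale graded_ring = ring A for A :: "('a, 'z) graded_ring_scheme" (structure) +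
  assumes rgrade_grading: "is_grading A (rgrade A)"
    and rgrade_one: "\<one> \<in> rgrade A 0"
    and rgrade_mult: "\<lbrakk>a \<in> rgrade A i; b \<in> rgrade A j\<rbrakk> \<Longrightarrow> a \<otimes> b \<in> rgrade A (i + j)"

locale graded_left_module = A?: graded_ring A + M?: abelian_group M
  for A :: "'a graded_ring" (structure) and M :: "('a, 'b) graded_module" (structure) +
  assumes act_closed: "\<lbrakk>a \<in> carrier A; x \<in> carrier M\<rbrakk> \<Longrightarrow> a \<odot>\<^bsub>M\<^esub> x \<in> carrier M"
    and act_l_distr: "\<lbrakk>a \<in> carrier A; b \<in> carrier A; x \<in> carrier M\<rbrakk>
      \<Longrightarrow> (a \<oplus>\<^bsub>A\<^esub> b) \<odot>\<^bsub>M\<^esub> x = a \<odot>\<^bsub>M\<^esub> x \<oplus>\<^bsub>M\<^esub> b \<odot>\<^bsub>M\<^esub> x"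
    and act_r_distr: "\<lbrakk>a \<in> carrier A; x \<in> carrier M; y \<in> carrier M\<rbrakk>
      \<Longrightarrow> a \<odot>\<^bsub>M\<^esub> (x \<oplus>\<^bsub>M\<^esub> y) = a \<odot>\<^bsub>M\<^esub> x \<oplus>\<^bsub>M\<^esub> a \<odot>\<^bsub>M\<^esub> y"
    and act_assoc: "\<lbrakk>a \<in> carrier A; b \<in> carrier A; x \<in> carrier M\<rbrakk>
      \<Longrightarrow> (a \<otimes>\<^bsub>A\<^esub> b) \<odot>\<^bsub>M\<^esub> x = a \<odot>\<^bsub>M\<^esub> (b \<odot>\<^bsub>M\<^esub> x)"
    and act_one: "x \<in> carrier M \<Longrightarrow> \<one>\<^bsub>A\<^esub> \<odot>\<^bsub>M\<^esub> x = x"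
    and mgrade_grading: "is_grading M (mgrade M)"
    and mgrade_act: "\<lbrakk>a \<in> rgrade A i; x \<in> mgrade M j\<rbrakk> \<Longrightarrow> a \<odot>\<^bsub>M\<^esub> x \<in> mgrade M (i + j)"

section \<open>The category of graded modules, functors and adjoint pairs\<close>

text \<open>
  The objects of the category of graded \<open>A\<close>-modules are the graded left modules whose carrier
  lies in a given type; that type is a free type variable and plays the role of the universe.
  Maps have degree zero and are extensional functions on the carrier, composed by
  \<^const>\<open>compose\<close>.
\<close>

definition gmod :: "'a graded_ring \<Rightarrow> ('a, 'm) graded_module set" where
  "gmod A = {M. graded_left_module A M}"

definition gmod_hom ::
    "'a graded_ring \<Rightarrow> ('a, 'm) graded_module \<Rightarrow> ('a, 'n) graded_module \<Rightarrow> ('m \<Rightarrow> 'n) set" where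
  "gmod_hom A M N = {f \<in> carrier M \<rightarrow>\<^sub>E carrier N.
     (\<forall>x\<in>carrier M. \<forall>y\<in>carrier M. f (x \<oplus>\<^bsub>M\<^esub> y) = f x \<oplus>\<^bsub>N\<^esub> f y) \<and>
     (\<forall>a\<in>carrier A. \<forall>x\<in>carrier M. f (a \<odot>\<^bsub>M\<^esub> x) = a \<odot>\<^bsub>N\<^esub> f x) \<and>
     (\<forall>i. \<forall>x\<in>mgrade M i. f x \<in> mgrade N i)}"

definition gmod_id :: "('a, 'm) graded_module \<Rightarrow> 'm \<Rightarrow> 'm" where
  "gmod_id M = (\<lambda>x\<in>carrier M. x)"

text \<open>The action on maps takes the source and the target of the map as its first two arguments.\<close>

record ('a, 'm, 'b, 'n) gfunctor =
  fobj :: "('a, 'm) graded_module \<Rightarrow> ('b, 'n) graded_module"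
  fmap :: "('a, 'm) graded_module \<Rightarrow> ('a, 'm) graded_module \<Rightarrow> ('m \<Rightarrow> 'm) \<Rightarrow> ('n \<Rightarrow> 'n)"

definition is_functor ::
    "'a graded_ring \<Rightarrow> 'b graded_ring \<Rightarrow> ('a, 'm, 'b, 'n) gfunctor \<Rightarrow> bool" where
  "is_functor A B F \<longleftrightarrow>
     (\<forall>M\<in>gmod A. fobj F M \<in> gmod B) \<and>
     (\<forall>M\<in>gmod A. \<forall>N\<in>gmod A. \<forall>f\<in>gmod_hom A M N.
        fmap F M N f \<in> gmod_hom B (fobj F M) (fobj F N)) \<and>
     (\<forall>M\<in>gmod A. fmap F M M (gmod_id M) = gmod_id (fobj F M)) \<and>
     (\<forall>L\<in>gmod A. \<forall>M\<in>gmod A. \<forall>N\<in>gmod A. \<forall>f\<in>gmod_hom A L M. \<forall>g\<in>gmod_hom A M N.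
        fmap F L N (compose (carrier L) g f) =
        compose (carrier (fobj F L)) (fmap F M N g) (fmap F L M f))"

definition fcomp ::
    "('b, 'n, 'c, 'p) gfunctor \<Rightarrow> ('a, 'm, 'b, 'n) gfunctor \<Rightarrow> ('a, 'm, 'c, 'p) gfunctor"
    (infixr \<open>\<circ>\<^sub>F\<close> 55) where
  "G \<circ>\<^sub>F F = \<lparr>fobj = \<lambda>M. fobj G (fobj F M),
     fmap = \<lambda>M N f. fmap G (fobj F M) (fobj F N) (fmap F M N f)\<rparr>"

text \<open>
  \<open>F\<close> is left adjoint to \<open>G\<close>: there are bijections
  \<open>Hom\<^sub>B(F M, N) \<cong> Hom\<^sub>A(M, G N)\<close>, natural in \<open>M\<close> and \<open>N\<close>. Since a tensor product
  has a carrier type different from that of its factors, the modules \<open>M\<close> and \<open>N\<close> and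
  their images under \<open>F\<close> and \<open>G\<close> are allowed to live in four different types.
\<close>

definition adjoint_pair ::
    "'a graded_ring \<Rightarrow> 'b graded_ring \<Rightarrow> ('a, 'm, 'b, 'fm) gfunctor \<Rightarrow> ('b, 'n, 'a, 'gn) gfunctor
      \<Rightarrow> bool" where
  "adjoint_pair A B F G \<longleftrightarrow> is_functor A B F \<and> is_functor B A G \<and>
     (\<exists>\<Phi>. (\<forall>M\<in>gmod A. \<forall>N\<in>gmod B.
              bij_betw (\<Phi> M N) (gmod_hom B (fobj F M) N) (gmod_hom A M (fobj G N))) \<and>
          (\<forall>M\<in>gmod A. \<forall>M'\<in>gmod A. \<forall>N\<in>gmod B. \<forall>N'\<in>gmod B.
           \<forall>f\<in>gmod_hom A M' M. \<forall>g\<in>gmod_hom B N N'. \<forall>h\<in>gmod_hom B (fobj F M) N.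
              \<Phi> M' N' (compose (carrier (fobj F M')) g
                         (compose (carrier (fobj F M')) h (fmap F M' M f))) =
              compose (carrier M') (fmap G N N' g) (compose (carrier M') (\<Phi> M N h) f)))"

text \<open>The grading shift \<open>M \<mapsto> M\<langle>d\<rangle>\<close> with \<open>M\<langle>d\<rangle>\<^sub>i = M\<^bsub>i+d\<^esub>\<close>. The odd Demazure operator,
  which provides the counit of the second adjunction, has degree \<open>-2\<close>; with maps of degree
  zero that adjunction therefore involves a shift by \<open>2\<close>, and fails without it.\<close>

definition shift_functor :: "int \<Rightarrow> ('a, 'm, 'a, 'm) gfunctor" where
  "shift_functor d = \<lparr>fobj = \<lambda>M. M\<lparr>mgrade := \<lambda>i. mgrade M (i + d)\<rparr>, fmap = \<lambda>M N f. f\<rparr>"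

section \<open>Tensor products with a graded bimodule\<close>

text \<open>
  The tensor product of a graded bimodule \<open>B\<close> (with left action of some ring and right action
  of \<open>A\<close>) and a left \<open>A\<close>-module \<open>M\<close> is the quotient of the free abelian group on
  \<open>carrier B \<times> carrier M\<close> by the usual relations.
\<close>

definition tensor_rels ::
    "'a graded_ring \<Rightarrow> ('c, 'a, 'b) graded_bimodule \<Rightarrow> ('a, 'm) graded_module
      \<Rightarrow> (('b \<times> 'm) \<Rightarrow>\<^sub>0 int) set" where
  "tensor_rels A B M = generate (free_Abelian_group (carrier B \<times> carrier M))
     ({frag_of (b \<oplus>\<^bsub>B\<^esub> b', m) - frag_of (b, m) - frag_of (b', m) | b b' m.
         b \<in> carrier B \<and> b' \<in> carrier B \<and> m \<in> carrier M} \<union>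
      {frag_of (b, m \<oplus>\<^bsub>M\<^esub> m') - frag_of (b, m) - frag_of (b, m') | b m m'.
         b \<in> carrier B \<and> m \<in> carrier M \<and> m' \<in> carrier M} \<union>
      {frag_of (rsmult B b a, m) - frag_of (b, a \<odot>\<^bsub>M\<^esub> m) | b a m.
         b \<in> carrier B \<and> a \<in> carrier A \<and> m \<in> carrier M})"

definition tensor_class ::
    "'a graded_ring \<Rightarrow> ('c, 'a, 'b) graded_bimodule \<Rightarrow> ('a, 'm) graded_module
      \<Rightarrow> (('b \<times> 'm) \<Rightarrow>\<^sub>0 int) \<Rightarrow> (('b \<times> 'm) \<Rightarrow>\<^sub>0 int) set" where
  "tensor_class A B M z =
     tensor_rels A B M #>\<^bsub>free_Abelian_group (carrier B \<times> carrier M)\<^esub> z"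

definition pure_tensor ::
    "'a graded_ring \<Rightarrow> ('c, 'a, 'b) graded_bimodule \<Rightarrow> ('a, 'm) graded_module
      \<Rightarrow> 'b \<Rightarrow> 'm \<Rightarrow> (('b \<times> 'm) \<Rightarrow>\<^sub>0 int) set" where
  "pure_tensor A B M b m = tensor_class A B M (frag_of (b, m))"

text \<open>The left action is \<open>c (b \<otimes> m) = (c b) \<otimes> m\<close>, computed on a representative; the part
  of degree \<open>n\<close> is generated by the \<open>b \<otimes> m\<close> with \<open>b\<close> and \<open>m\<close> homogeneous of degrees
  adding up to \<open>n\<close>.\<close>

definition tensor ::
    "'a graded_ring \<Rightarrow> ('c, 'a, 'b) graded_bimodule \<Rightarrow> ('a, 'm) graded_module
      \<Rightarrow> ('c, (('b \<times> 'm) \<Rightarrow>\<^sub>0 int) set) graded_module" where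
  "tensor A B M =
    (let T = free_Abelian_group (carrier B \<times> carrier M) Mod tensor_rels A B M in
     \<lparr>carrier = carrier T, monoid.mult = undefined, one = undefined,
      ring.zero = \<one>\<^bsub>T\<^esub>, ring.add = monoid.mult T,
      smult = \<lambda>c X. tensor_class A B M
                (frag_extend (\<lambda>(b, m). frag_of (c \<odot>\<^bsub>B\<^esub> b, m)) (SOME z. z \<in> X)),
      mgrade = \<lambda>n. generate T {pure_tensor A B M b m | b m i j.
                b \<in> mgrade B i \<and> m \<in> mgrade M j \<and> i + j = n}\<rparr>)"

definition tensor_functor ::
    "'a graded_ring \<Rightarrow> ('c, 'a, 'b) graded_bimodule
      \<Rightarrow> ('a, 'm, 'c, (('b \<times> 'm) \<Rightarrow>\<^sub>0 int) set) gfunctor" where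
  "tensor_functor A B = \<lparr>fobj = tensor A B,
     fmap = \<lambda>M N f. \<lambda>X\<in>carrier (tensor A B M). tensor_class A B N
              (frag_extend (\<lambda>(b, m). frag_of (b, f m)) (SOME z. z \<in> X))\<rparr>"

section \<open>The ring of odd polynomials in two variables\<close>

datatype var = V1 | V2

text \<open>The free algebra on two noncommuting variables: finitely supported functions on words,
  with the convolution product for concatenation.\<close>

definition free_alg :: "('k, 'z) ring_scheme \<Rightarrow> (var list \<Rightarrow> 'k) ring" where
  "free_alg K =
    \<lparr>carrier = {f. (\<forall>w. f w \<in> carrier K) \<and> finite {w. f w \<noteq> \<zero>\<^bsub>K\<^esub>}},
     monoid.mult = \<lambda>f g w. \<Oplus>\<^bsub>K\<^esub>i\<in>{..length w}. f (take i w) \<otimes>\<^bsub>K\<^esub> g (drop i w),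
     one = \<lambda>w. if w = [] then \<one>\<^bsub>K\<^esub> else \<zero>\<^bsub>K\<^esub>,
     ring.zero = \<lambda>w. \<zero>\<^bsub>K\<^esub>,
     ring.add = \<lambda>f g w. f w \<oplus>\<^bsub>K\<^esub> g w\<rparr>"

definition free_const :: "('k, 'z) ring_scheme \<Rightarrow> 'k \<Rightarrow> var list \<Rightarrow> 'k" where
  "free_const K a = (\<lambda>w. if w = [] then a else \<zero>\<^bsub>K\<^esub>)"

definition free_var :: "('k, 'z) ring_scheme \<Rightarrow> var \<Rightarrow> var list \<Rightarrow> 'k" where
  "free_var K v = (\<lambda>w. if w = [v] then \<one>\<^bsub>K\<^esub> else \<zero>\<^bsub>K\<^esub>)"

definition free_grade :: "('k, 'z) ring_scheme \<Rightarrow> int \<Rightarrow> (var list \<Rightarrow> 'k) set" where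
  "free_grade K n =
     {f \<in> carrier (free_alg K). \<forall>w. f w \<noteq> \<zero>\<^bsub>K\<^esub> \<longrightarrow> 2 * int (length w) = n}"

definition odd_ideal :: "('k, 'z) ring_scheme \<Rightarrow> (var list \<Rightarrow> 'k) set" where
  "odd_ideal K = Idl\<^bsub>free_alg K\<^esub>
     {free_var K V1 \<otimes>\<^bsub>free_alg K\<^esub> free_var K V2
        \<oplus>\<^bsub>free_alg K\<^esub> free_var K V2 \<otimes>\<^bsub>free_alg K\<^esub> free_var K V1}"

definition odd_class :: "('k, 'z) ring_scheme \<Rightarrow> (var list \<Rightarrow> 'k) \<Rightarrow> (var list \<Rightarrow> 'k) set" where
  "odd_class K f = odd_ideal K +>\<^bsub>free_alg K\<^esub> f"

definition odd_ring :: "('k, 'z) ring_scheme \<Rightarrow> (var list \<Rightarrow> 'k) set graded_ring" where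
  "odd_ring K = ring.extend (free_alg K Quot odd_ideal K)
     \<lparr>rgrade = \<lambda>n. odd_class K ` free_grade K n\<rparr>"

definition odd_const :: "('k, 'z) ring_scheme \<Rightarrow> 'k \<Rightarrow> (var list \<Rightarrow> 'k) set" where
  "odd_const K a = odd_class K (free_const K a)"

definition odd_var :: "('k, 'z) ring_scheme \<Rightarrow> var \<Rightarrow> (var list \<Rightarrow> 'k) set" where
  "odd_var K v = odd_class K (free_var K v)"

text \<open>A map fixing the constants is linear over \<open>K\<close> as soon as it is a ring homomorphism.\<close>

definition is_odd_swap ::
    "('k, 'z) ring_scheme \<Rightarrow> ((var list \<Rightarrow> 'k) set \<Rightarrow> (var list \<Rightarrow> 'k) set) \<Rightarrow> bool" where
  "is_odd_swap K s \<longleftrightarrow> s \<in> ring_iso (odd_ring K) (odd_ring K) \<and>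
     (\<forall>a\<in>carrier K. s (odd_const K a) = odd_const K a) \<and>
     s (odd_var K V1) = \<ominus>\<^bsub>odd_ring K\<^esub> odd_var K V2 \<and>
     s (odd_var K V2) = \<ominus>\<^bsub>odd_ring K\<^esub> odd_var K V1"

definition is_odd_demazure ::
    "('k, 'z) ring_scheme \<Rightarrow> ((var list \<Rightarrow> 'k) set \<Rightarrow> (var list \<Rightarrow> 'k) set)
      \<Rightarrow> ((var list \<Rightarrow> 'k) set \<Rightarrow> (var list \<Rightarrow> 'k) set) \<Rightarrow> bool" where
  "is_odd_demazure K s D \<longleftrightarrow> (let R = odd_ring K in
     D \<in> carrier R \<rightarrow> carrier R \<and>
     (\<forall>f\<in>carrier R. \<forall>g\<in>carrier R. D (f \<oplus>\<^bsub>R\<^esub> g) = D f \<oplus>\<^bsub>R\<^esub> D g) \<and>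
     (\<forall>a\<in>carrier K. \<forall>f\<in>carrier R. D (odd_const K a \<otimes>\<^bsub>R\<^esub> f) = odd_const K a \<otimes>\<^bsub>R\<^esub> D f) \<and>
     D \<one>\<^bsub>R\<^esub> = \<zero>\<^bsub>R\<^esub> \<and> D (odd_var K V1) = \<one>\<^bsub>R\<^esub> \<and> D (odd_var K V2) = \<one>\<^bsub>R\<^esub> \<and>
     (\<forall>f\<in>carrier R. \<forall>g\<in>carrier R.
        D (f \<otimes>\<^bsub>R\<^esub> g) = D f \<otimes>\<^bsub>R\<^esub> g \<oplus>\<^bsub>R\<^esub> s f \<otimes>\<^bsub>R\<^esub> D g))"

text \<open>The subring \<open>R\<^sup>s\<close>, i.e. the kernel of the odd Demazure operator \<open>D\<close>.\<close>

definition odd_invariants ::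
    "('k, 'z) ring_scheme \<Rightarrow> ((var list \<Rightarrow> 'k) set \<Rightarrow> (var list \<Rightarrow> 'k) set)
      \<Rightarrow> (var list \<Rightarrow> 'k) set graded_ring" where
  "odd_invariants K D = (let R = odd_ring K; S = a_kernel R R D in
     R\<lparr>carrier := S, rgrade := \<lambda>n. rgrade R n \<inter> S\<rparr>)"

section \<open>The functors\<close>

text \<open>\<open>R\<close> with left and right multiplication; depending on the ring over which the tensor
  product is taken this is \<open>R\<close> as an \<open>(R, R)\<close>- or as an \<open>(R, R\<^sup>s)\<close>-bimodule.\<close>

definition regular_bimodule :: "'a graded_ring \<Rightarrow> ('a, 'a, 'a) graded_bimodule" where
  "regular_bimodule R = \<lparr>carrier = carrier R, monoid.mult = monoid.mult R, one = one R, ring.zero = ring.zero R,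
     ring.add = ring.add R, smult = monoid.mult R, mgrade = rgrade R, rsmult = monoid.mult R\<rparr>"

text \<open>The transposition bimodule: the element \<open>r\<close> of \<open>R\<close> stands for \<open>u r\<close>, where \<open>u\<close>
  is the generator, so that \<open>f (u r) = u (s(f) r)\<close>.\<close>

definition transposition_bimodule ::
    "'a graded_ring \<Rightarrow> ('a \<Rightarrow> 'a) \<Rightarrow> ('a, 'a, 'a) graded_bimodule" where
  "transposition_bimodule R s =
     (regular_bimodule R)\<lparr>smult := \<lambda>f r. s f \<otimes>\<^bsub>R\<^esub> r\<rparr>"

definition F_up ::
    "('k, 'z) ring_scheme \<Rightarrow> ((var list \<Rightarrow> 'k) set \<Rightarrow> (var list \<Rightarrow> 'k) set)
      \<Rightarrow> ((var list \<Rightarrow> 'k) set, 'm, (var list \<Rightarrow> 'k) set,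
          (((var list \<Rightarrow> 'k) set \<times> 'm) \<Rightarrow>\<^sub>0 int) set) gfunctor" where
  "F_up K D = tensor_functor (odd_invariants K D) (regular_bimodule (odd_ring K))"

text \<open>Restriction along \<open>R\<^sup>s \<subseteq> R\<close>: the two rings have elements of the same type, and a
  module record does not mention its ring, so nothing changes in the record.\<close>

definition F_down :: "('a, 'm, 'a, 'm) gfunctor" where
  "F_down = \<lparr>fobj = \<lambda>M. M, fmap = \<lambda>M N f. f\<rparr>"

definition F_minus ::
    "('k, 'z) ring_scheme \<Rightarrow> ((var list \<Rightarrow> 'k) set \<Rightarrow> (var list \<Rightarrow> 'k) set)
      \<Rightarrow> ((var list \<Rightarrow> 'k) set, 'm, (var list \<Rightarrow> 'k) set,
          (((var list \<Rightarrow> 'k) set \<times> 'm) \<Rightarrow>\<^sub>0 int) set) gfunctor" where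
  "F_minus K s = tensor_functor (odd_ring K) (transposition_bimodule (odd_ring K) s)"

end

theory Submission
  imports Defs
begin

text \<open>Write \<open>S = R\<^sup>s = ker D\<close>, where \<open>D\<close> is the odd Demazure operator, and \<open>u\<close> for the generator of the
  transposition bimodule, so that \<open>f u = u s(f)\<close>.

  The first adjunction is the tensor-hom adjunction along \<open>S \<subseteq> R\<close>. Since \<open>r \<otimes> m = r (1 \<otimes> m)\<close>, an
  \<open>R\<close>-linear map on \<open>R \<otimes>\<^sub>S M\<close> is determined by its restriction to the elements \<open>1 \<otimes> m\<close>, and every
  \<open>S\<close>-linear \<open>f\<close> extends by \<open>r \<otimes> m \<mapsto> r f(m)\<close>.

  The second one says that \<open>R\<close> is a Frobenius extension of \<open>S\<close>, twisted by \<open>s\<close>, with trace \<open>D\<close>. The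
  Leibniz rule for \<open>x\<^sub>1 f\<close> can be read as \<open>f = D(x\<^sub>1 f) + x\<^sub>2 D(f)\<close>, and both coefficients lie
  in \<open>S\<close> because \<open>D D = 0\<close>. Hence every element of \<open>R \<otimes>\<^sub>S N\<close> has the form
  \<open>1 \<otimes> \<alpha> + x\<^sub>2 \<otimes> \<beta>\<close>. The counit is \<open>u \<otimes> r \<otimes> n \<mapsto> D(r) n\<close>; it is compatible with the tensor
  product over \<open>S\<close> because \<open>D(r a) = D(r) a\<close>, and it is \<open>S\<close>-linear because moving \<open>a\<close> past \<open>u\<close>
  turns it into \<open>s(a)\<close> while \<open>D(s(a) r) = a D(r)\<close>. On \<open>u \<otimes> (1 \<otimes> \<alpha> + x\<^sub>2 \<otimes> \<beta>)\<close> it returns \<open>\<beta>\<close>, and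
  after acting with \<open>x\<^sub>2\<close>, which \<open>u\<close> turns into \<open>- x\<^sub>1\<close>, it returns \<open>- \<alpha>\<close>. An \<open>R\<close>-linear \<open>g\<close> into
  the tensor product is therefore recovered from its composite \<open>h\<close> with the counit by
  \<open>g(m) = u \<otimes> (x\<^sub>2 \<otimes> h(m) - 1 \<otimes> h(x\<^sub>2 m))\<close>, and the
  Leibniz rule shows conversely that this formula gives an \<open>R\<close>-linear map for every
  \<open>S\<close>-linear \<open>h\<close>. The factor \<open>x\<^sub>2\<close>, of degree two, accounts for the grading shift. These arguments
  are \<open>induction_restriction_adjoint\<close> and \<open>restriction_coinduction_adjoint\<close>; they take place in an
  arbitrary graded ring with operators \<open>s\<close> and \<open>D\<close> that satisfy the identities used above.

  Two foundations are needed. One is that the tensor product of graded modules is graded, which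
  requires the sum of the homogeneous parts to be direct: the projections onto them are constructed
  from the universal property (\<open>tensor_grading\<close>). The other is that odd polynomials have the structure
  assumed above: the defining ideal is homogeneous (\<open>trunc_ideal\<close>), and the identities
  \<open>s s = 1\<close>, \<open>D D = 0\<close>, \<open>D s = - s D\<close> and the behaviour of \<open>s\<close> and \<open>D\<close> on degrees follow by
  induction along left multiplication by scalars and variables (\<open>odd_ring_induct\<close>).\<close>

section \<open>Gradings\<close>

lemma (in abelian_group) additive_subgroup_closedI:
  assumes "H \<subseteq> carrier G" "\<zero> \<in> H"
    and "\<And>x. x \<in> H \<Longrightarrow> \<ominus> x \<in> H" "\<And>x y. \<lbrakk>x \<in> H; y \<in> H\<rbrakk> \<Longrightarrow> x \<oplus> y \<in> H"
  shows "additive_subgroup H G"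
  by (intro additive_subgroupI add.subgroupI) (use assms in \<open>auto simp: a_inv_def\<close>)

lemma subgroup_cong:
  assumes "carrier G = carrier H" "monoid.mult G = monoid.mult H" "\<one>\<^bsub>G\<^esub> = \<one>\<^bsub>H\<^esub>"
  shows "subgroup S G \<longleftrightarrow> subgroup S H"
  by (simp add: subgroup_def m_inv_def assms)

lemma abelian_group_hom_additiveI:
  assumes "abelian_group G" "abelian_group H"
    and "\<And>x. x \<in> carrier G \<Longrightarrow> h x \<in> carrier H"
    and "\<And>x y. x \<in> carrier G \<Longrightarrow> y \<in> carrier G \<Longrightarrow> h (x \<oplus>\<^bsub>G\<^esub> y) = h x \<oplus>\<^bsub>H\<^esub> h y"
  shows "abelian_group_hom G H h"
proof -
  interpret G: abelian_group G by fact
  interpret H: abelian_group H by fact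
  show ?thesis
    by (intro abelian_group_homI assms(1,2) group_hom.intro group_hom_axioms.intro
        G.add.is_group H.add.is_group) (auto simp: hom_def assms)
qed

lemma (in abelian_group_hom) hom_finsum:
  "f \<in> A \<rightarrow> carrier G \<Longrightarrow> h (finsum G f A) = finsum H (\<lambda>i. h (f i)) A"
proof (induction A rule: infinite_finite_induct)
  case (insert a A)
  then have "f \<in> A \<rightarrow> carrier G" "f a \<in> carrier G" by auto
  moreover from this have "(\<lambda>i. h (f i)) \<in> A \<rightarrow> carrier H" "h (f a) \<in> carrier H" by (auto simp: Pi_iff)
  ultimately show ?case using insert by simp
qed auto

lemma (in abelian_monoid) finsum_support:
  assumes "finite I" "\<And>i. i \<notin> I \<Longrightarrow> f i = \<zero>" "\<And>i. f i \<in> carrier G"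
  shows "finsum G f {i. f i \<noteq> \<zero>} = finsum G f I"
  by (rule add.finprod_mono_neutral_cong_left) (use assms in auto)

lemma (in abelian_monoid) finsum_Kronecker:
  assumes "finite A" "a \<in> carrier G"
  shows "finsum G (\<lambda>i. if i = j then a else \<zero>) A = (if j \<in> A then a else \<zero>)"
proof (cases "j \<in> A")
  case True
  then show ?thesis
    using add.finprod_singleton_swap[of j A "\<lambda>_. a"] assms by simp
next
  case False
  then show ?thesis by (auto intro!: add.finprod_one_eqI)
qed

lemma abelian_group_cong:
  assumes "abelian_group G"
    and "carrier H = carrier G" "add H = add G" "\<zero>\<^bsub>H\<^esub> = \<zero>\<^bsub>G\<^esub>"
  shows "abelian_group H"
proof -
  interpret G: abelian_group G by fact
  show ?thesis
    by (rule abelian_groupI) (auto simp: assms(2-) G.a_ac intro: G.l_neg)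
qed

lemma is_grading_cong:
  assumes "carrier H = carrier G" "add H = add G" "\<zero>\<^bsub>H\<^esub> = \<zero>\<^bsub>G\<^esub>"
  shows "is_grading H \<gamma> \<longleftrightarrow> is_grading G \<gamma>"
proof -
  have "additive_subgroup S H \<longleftrightarrow> additive_subgroup S G" for S
    unfolding additive_subgroup_def by (rule subgroup_cong) (simp_all add: assms)
  moreover have "finsum H f I = finsum G f I" for f :: "int \<Rightarrow> _" and I
    by (simp add: finsum_def finprod_def assms)
  ultimately show ?thesis by (simp add: is_grading_def assms)
qed

text \<open>Directness of a sum is certified by additive projections \<open>p i\<close> onto the pieces: applying \<open>p j\<close> to any
  decomposition of \<open>x\<close> returns its \<open>j\<close>-th term. That the pieces generate is expressed as an induction
  principle, so that no generating set has to be named.\<close>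

lemma is_gradingI:
  fixes M (structure)
  assumes M: "abelian_group M"
    and sub: "\<And>i. additive_subgroup (\<gamma> i) M"
    and p: "\<And>i. abelian_group_hom M M (p i)"
    and p_homog: "\<And>i j x. x \<in> \<gamma> j \<Longrightarrow> p i x = (if i = j then x else \<zero>)"
    and induct: "\<And>x Q. \<lbrakk>x \<in> carrier M; \<And>i y. y \<in> \<gamma> i \<Longrightarrow> Q y;
      \<And>y z. \<lbrakk>y \<in> carrier M; z \<in> carrier M; Q y; Q z\<rbrakk> \<Longrightarrow> Q (y \<oplus> z)\<rbrakk> \<Longrightarrow> Q x"
  shows "is_grading M \<gamma>"
  unfolding is_grading_def
proof (intro conjI allI ballI sub)
  interpret M: abelian_group M by fact
  interpret p: abelian_group_hom M M "p i" for i by (rule p)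
  have \<gamma>_carrier: "y \<in> carrier M" if "y \<in> \<gamma> i" for i y
    using additive_subgroup.a_subset[OF sub] that by auto
  have \<gamma>_zero: "\<zero> \<in> \<gamma> i" for i
    using additive_subgroup.zero_closed[OF sub] .
  fix x assume x: "x \<in> carrier M"
  let ?c = "\<lambda>i. p i x"
  have "(\<forall>i. p i x \<in> \<gamma> i) \<and>
    (\<exists>I. finite I \<and> (\<forall>i. i \<notin> I \<longrightarrow> p i x = \<zero>) \<and> x = finsum M (\<lambda>i. p i x) I)"
    using x
  proof (induct rule: induct[consumes 1, case_names homogeneous add])
    case (homogeneous j y)
    note 1 = homogeneous
    have "finsum M (\<lambda>i. p i y) {j} = y"
      using \<gamma>_carrier[OF 1] p_homog[OF 1] by (simp add: M.finsum_insert)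
    then show ?case
      using p_homog[OF 1] \<gamma>_carrier[OF 1] 1 \<gamma>_zero by (intro conjI exI[of _ "{j}"]) auto
  next
    case (add y z)
    note 2 = add
    from 2(3) obtain I where I: "finite I" "\<And>i. i \<notin> I \<Longrightarrow> p i y = \<zero>"
      "y = finsum M (\<lambda>i. p i y) I" by blast
    from 2(4) obtain J where J: "finite J" "\<And>i. i \<notin> J \<Longrightarrow> p i z = \<zero>"
      "z = finsum M (\<lambda>i. p i z) J" by blast
    have "finsum M (\<lambda>i. p i y) I = finsum M (\<lambda>i. p i y) (I \<union> J)"
      by (rule M.add.finprod_mono_neutral_cong_left) (use I J 2 in auto)
    moreover have "finsum M (\<lambda>i. p i z) J = finsum M (\<lambda>i. p i z) (I \<union> J)"
      by (rule M.add.finprod_mono_neutral_cong_left) (use I J 2 in auto)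
    moreover have "finsum M (\<lambda>i. p i (y \<oplus> z)) (I \<union> J) =
        finsum M (\<lambda>i. p i y) (I \<union> J) \<oplus> finsum M (\<lambda>i. p i z) (I \<union> J)"
      using 2 by (simp add: M.finsum_addf)
    ultimately have "y \<oplus> z = finsum M (\<lambda>i. p i (y \<oplus> z)) (I \<union> J)"
      using I(3) J(3) by simp
    moreover have "p i (y \<oplus> z) \<in> \<gamma> i" for i
      using 2 additive_subgroup.a_closed[OF sub] by simp
    moreover have "p i (y \<oplus> z) = \<zero>" if "i \<notin> I \<union> J" for i
      using that 2(1,2) I(2) J(2) by simp
    ultimately show ?case
      using I(1) J(1) by (metis finite_UnI)
  qed
  then obtain I where px: "\<And>i. p i x \<in> \<gamma> i"
    and I: "finite I" "\<And>i. i \<notin> I \<Longrightarrow> p i x = \<zero>" "x = finsum M (\<lambda>i. p i x) I" by blast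
  show "\<exists>!c. (\<forall>i. c i \<in> \<gamma> i) \<and> finite {i. c i \<noteq> \<zero>} \<and> x = finsum M c {i. c i \<noteq> \<zero>}"
  proof (rule ex1I[of _ ?c], intro conjI allI)
    show "p i x \<in> \<gamma> i" for i by (rule px)
    show "finite {i. p i x \<noteq> \<zero>}"
      by (rule finite_subset[OF _ I(1)]) (use I(2) in auto)
    show "x = finsum M (\<lambda>i. p i x) {i. p i x \<noteq> \<zero>}"
      using M.finsum_support[OF I(1), of "\<lambda>i. p i x"] I(2,3) x by simp
  next
    fix c assume c: "(\<forall>i. c i \<in> \<gamma> i) \<and> finite {i. c i \<noteq> \<zero>} \<and> x = finsum M c {i. c i \<noteq> \<zero>}"
    show "c = ?c"
    proof
      fix j
      have cc: "c i \<in> carrier M" for i using c \<gamma>_carrier by blast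
      have "p j x = finsum M (\<lambda>i. p j (c i)) {i. c i \<noteq> \<zero>}"
        by (subst conjunct2[OF conjunct2[OF c]]) (rule p.hom_finsum, use cc in auto)
      also have "\<dots> = finsum M (\<lambda>i. if i = j then c j else \<zero>) {i. c i \<noteq> \<zero>}"
      proof (rule M.finsum_cong')
        show "p j (c i) = (if i = j then c j else \<zero>)" for i
          using p_homog[of "c i" i j] c by auto
      qed (use cc in auto)
      also have "\<dots> = c j"
        by (subst M.finsum_Kronecker) (use c cc in auto)
      finally show "c j = p j x" by simp
    qed
  qed
qed

definition homog_part ::
    "('b, 'z) ring_scheme \<Rightarrow> (int \<Rightarrow> 'b set) \<Rightarrow> int \<Rightarrow> 'b \<Rightarrow> 'b" where
  "homog_part M \<gamma> i x = (THE c. (\<forall>i. c i \<in> \<gamma> i) \<and> finite {i. c i \<noteq> \<zero>\<^bsub>M\<^esub>} \<and>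
        x = finsum M c {i. c i \<noteq> \<zero>\<^bsub>M\<^esub>}) i"

locale graded_group = abelian_group M for M (structure) +
  fixes \<gamma> :: "int \<Rightarrow> 'a set"
  assumes grading: "is_grading M \<gamma>"
begin

lemma additive_subgroup_grade: "additive_subgroup (\<gamma> i) M"
  using grading by (simp add: is_grading_def)

lemma grade_carrier: "x \<in> \<gamma> i \<Longrightarrow> x \<in> carrier M"
  using additive_subgroup.a_subset[OF additive_subgroup_grade] by blast

lemma grade_zero [simp]: "\<zero> \<in> \<gamma> i"
  using additive_subgroup.zero_closed[OF additive_subgroup_grade] .

lemma grade_add: "\<lbrakk>x \<in> \<gamma> i; y \<in> \<gamma> i\<rbrakk> \<Longrightarrow> x \<oplus> y \<in> \<gamma> i"
  using additive_subgroup.a_closed[OF additive_subgroup_grade] .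

lemma grade_neg: "x \<in> \<gamma> i \<Longrightarrow> \<ominus> x \<in> \<gamma> i"
  using additive_subgroup.a_inv_closed[OF additive_subgroup_grade] .

lemma homog_part_ex1:
  "x \<in> carrier M \<Longrightarrow> \<exists>!c. (\<forall>i. c i \<in> \<gamma> i) \<and> finite {i. c i \<noteq> \<zero>} \<and>
        x = finsum M c {i. c i \<noteq> \<zero>}"
  using grading by (simp add: is_grading_def)

lemma homog_part_props:
  assumes "x \<in> carrier M"
  shows homog_part_grade: "homog_part M \<gamma> i x \<in> \<gamma> i"
    and finite_homog_support: "finite {i. homog_part M \<gamma> i x \<noteq> \<zero>}"
    and sum_homog_parts: "finsum M (\<lambda>i. homog_part M \<gamma> i x) {i. homog_part M \<gamma> i x \<noteq> \<zero>} = x"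
proof -
  let ?c = "\<lambda>i. homog_part M \<gamma> i x"
  have c: "(THE c. (\<forall>i. c i \<in> \<gamma> i) \<and> finite {i. c i \<noteq> \<zero>} \<and>
        x = finsum M c {i. c i \<noteq> \<zero>}) = ?c"
    by (simp add: homog_part_def)
  show "?c i \<in> \<gamma> i" "finite {i. ?c i \<noteq> \<zero>}" "finsum M ?c {i. ?c i \<noteq> \<zero>} = x"
    using theI'[OF homog_part_ex1[OF assms], unfolded c] by auto
qed

lemma homog_part_closed [simp]: "x \<in> carrier M \<Longrightarrow> homog_part M \<gamma> i x \<in> carrier M"
  using homog_part_grade grade_carrier by blast

lemma homog_part_unique:
  assumes "\<And>i. c i \<in> \<gamma> i" "finite I" "\<And>i. i \<notin> I \<Longrightarrow> c i = \<zero>" "x = finsum M c I"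
  shows "homog_part M \<gamma> i x = c i"
proof -
  have c: "c i \<in> carrier M" for i using assms(1) grade_carrier by blast
  have x: "x \<in> carrier M" unfolding assms(4) using c by (intro finsum_closed) auto
  have "finite {i. c i \<noteq> \<zero>}" by (rule finite_subset[OF _ assms(2)]) (use assms(3) in auto)
  moreover have "x = finsum M c {i. c i \<noteq> \<zero>}"
    using finsum_support[of I c] assms c by simp
  ultimately show ?thesis
    unfolding homog_part_def using the1_equality[OF homog_part_ex1[OF x], of c] assms(1) by simp
qed

lemma homog_part_homog:
  assumes "x \<in> \<gamma> j" shows "homog_part M \<gamma> i x = (if i = j then x else \<zero>)"
  by (rule homog_part_unique[of "\<lambda>i. if i = j then x else \<zero>" "{j}"])
    (use assms grade_carrier in \<open>auto simp: finsum_insert\<close>)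

lemma homog_part_add:
  assumes x: "x \<in> carrier M" and y: "y \<in> carrier M"
  shows "homog_part M \<gamma> i (x \<oplus> y) = homog_part M \<gamma> i x \<oplus> homog_part M \<gamma> i y"
proof -
  let ?I = "{i. homog_part M \<gamma> i x \<noteq> \<zero>}" and ?J = "{i. homog_part M \<gamma> i y \<noteq> \<zero>}"
  have fin: "finite (?I \<union> ?J)" using finite_homog_support x y by simp
  have "finsum M (\<lambda>i. homog_part M \<gamma> i x) ?I = finsum M (\<lambda>i. homog_part M \<gamma> i x) (?I \<union> ?J)"
    by (rule finsum_support[OF fin]) (use x in auto)
  moreover have "finsum M (\<lambda>i. homog_part M \<gamma> i y) ?J = finsum M (\<lambda>i. homog_part M \<gamma> i y) (?I \<union> ?J)"
    by (rule finsum_support[OF fin]) (use y in auto)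
  ultimately have "x \<oplus> y =
      finsum M (\<lambda>i. homog_part M \<gamma> i x \<oplus> homog_part M \<gamma> i y) (?I \<union> ?J)"
    using sum_homog_parts[OF x] sum_homog_parts[OF y] x y by (simp add: finsum_addf)
  then show ?thesis
    by (intro homog_part_unique[OF _ fin]) (auto intro: grade_add homog_part_grade x y)
qed

lemma homog_part_hom: "abelian_group_hom M M (homog_part M \<gamma> i)"
  by (rule abelian_group_hom_additiveI) (auto simp: homog_part_add abelian_group_axioms)

lemma homog_part_zero: "homog_part M \<gamma> i \<zero> = \<zero>"
  by (rule abelian_group_hom.hom_zero[OF homog_part_hom])

lemma graded_induct [consumes 1, case_names homogeneous add]:
  assumes x: "x \<in> carrier M"
    and homog: "\<And>i y. y \<in> \<gamma> i \<Longrightarrow> Q y"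
    and add: "\<And>y z. \<lbrakk>y \<in> carrier M; z \<in> carrier M; Q y; Q z\<rbrakk> \<Longrightarrow> Q (y \<oplus> z)"
  shows "Q x"
proof -
  have "Q (finsum M (\<lambda>i. homog_part M \<gamma> i x) I)" if "finite I" for I
    using that
  proof (induction I)
    case empty
    then show ?case using homog[OF grade_zero] by simp
  next
    case (insert j I)
    then show ?case
      using x by (simp add: finsum_insert Pi_def homog[OF homog_part_grade[OF x]] add)
  qed
  then show ?thesis
    using sum_homog_parts[OF x] finite_homog_support[OF x] by metis
qed

end

lemma graded_groupI: "abelian_group M \<Longrightarrow> is_grading M \<gamma> \<Longrightarrow> graded_group M \<gamma>"
  by (simp add: graded_group_def graded_group_axioms_def)

text \<open>Both sides are additive in \<open>x\<close>, so homogeneous \<open>x\<close> suffice.\<close>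

lemma homog_part_map:
  assumes "graded_group M \<gamma>" "graded_group N \<delta>" "abelian_group_hom M N h"
    and deg: "\<And>i x. x \<in> \<gamma> i \<Longrightarrow> h x \<in> \<delta> (i + d)"
    and x: "x \<in> carrier M"
  shows "h (homog_part M \<gamma> i x) = homog_part N \<delta> (i + d) (h x)"
proof -
  interpret M: graded_group M \<gamma> by fact
  interpret N: graded_group N \<delta> by fact
  interpret h: abelian_group_hom M N h by fact
  show ?thesis using x
  proof (induction rule: M.graded_induct)
    case (homogeneous j y)
    then show ?case by (simp add: M.homog_part_homog N.homog_part_homog[OF deg])
  next
    case (add y z)
    then show ?case by (simp add: M.homog_part_add N.homog_part_add)
  qed
qed

sublocale graded_ring \<subseteq> gr: graded_group A "rgrade A"
  by (intro graded_groupI rgrade_grading abelian_group_axioms)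

sublocale graded_left_module \<subseteq> gr: graded_group M "mgrade M"
  by (intro graded_groupI mgrade_grading M.abelian_group_axioms)

lemma (in graded_ring) homog_part_mult_left:
  assumes a: "a \<in> rgrade A d" and f: "f \<in> carrier A"
  shows "homog_part A (rgrade A) i (a \<otimes> f) = a \<otimes> homog_part A (rgrade A) (i - d) f"
proof -
  have ac: "a \<in> carrier A" by (rule gr.grade_carrier[OF a])
  have hom: "abelian_group_hom A A ((\<otimes>) a)"
    by (rule abelian_group_hom_additiveI) (simp_all add: ac r_distr abelian_group_axioms)
  have deg: "a \<otimes> g \<in> rgrade A (j + d)" if "g \<in> rgrade A j" for g j
    using rgrade_mult[OF a that] by (simp add: add.commute)
  show ?thesis
    using homog_part_map[OF gr.graded_group_axioms gr.graded_group_axioms hom deg f, of "i - d"] by simp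
qed

lemma (in graded_left_module) act_hom_right: "a \<in> carrier A \<Longrightarrow> abelian_group_hom M M (\<lambda>x. a \<odot>\<^bsub>M\<^esub> x)"
  by (rule abelian_group_hom_additiveI) (simp_all add: M.abelian_group_axioms act_closed act_r_distr)

lemma (in graded_left_module) act_hom_left: "x \<in> carrier M \<Longrightarrow> abelian_group_hom A M (\<lambda>a. a \<odot>\<^bsub>M\<^esub> x)"
  by (rule abelian_group_hom_additiveI) (simp_all add: M.abelian_group_axioms A.abelian_group_axioms act_closed act_l_distr)

lemma (in graded_left_module) act_neg_right:
  "\<lbrakk>a \<in> carrier A; x \<in> carrier M\<rbrakk> \<Longrightarrow> a \<odot>\<^bsub>M\<^esub> (\<ominus>\<^bsub>M\<^esub> x) = \<ominus>\<^bsub>M\<^esub> (a \<odot>\<^bsub>M\<^esub> x)"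
  using abelian_group_hom.hom_a_inv[OF act_hom_right] .

lemma (in graded_left_module) act_neg_left:
  "\<lbrakk>a \<in> carrier A; x \<in> carrier M\<rbrakk> \<Longrightarrow> (\<ominus>\<^bsub>A\<^esub> a) \<odot>\<^bsub>M\<^esub> x = \<ominus>\<^bsub>M\<^esub> (a \<odot>\<^bsub>M\<^esub> x)"
  using abelian_group_hom.hom_a_inv[OF act_hom_left] .

lemma (in graded_left_module) act_zero_left: "x \<in> carrier M \<Longrightarrow> \<zero>\<^bsub>A\<^esub> \<odot>\<^bsub>M\<^esub> x = \<zero>\<^bsub>M\<^esub>"
  using abelian_group_hom.hom_zero[OF act_hom_left] .

section \<open>Tensor products of graded modules\<close>

locale graded_bimod = C: graded_ring C + A: graded_ring A + B: abelian_group B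
  for C :: "'c graded_ring" and A :: "'a graded_ring" and B :: "('c, 'a, 'b) graded_bimodule" +
  assumes lact_closed: "\<lbrakk>c \<in> carrier C; b \<in> carrier B\<rbrakk> \<Longrightarrow> c \<odot>\<^bsub>B\<^esub> b \<in> carrier B"
    and lact_l_distr: "\<lbrakk>c \<in> carrier C; c' \<in> carrier C; b \<in> carrier B\<rbrakk>
      \<Longrightarrow> (c \<oplus>\<^bsub>C\<^esub> c') \<odot>\<^bsub>B\<^esub> b = c \<odot>\<^bsub>B\<^esub> b \<oplus>\<^bsub>B\<^esub> c' \<odot>\<^bsub>B\<^esub> b"
    and lact_r_distr: "\<lbrakk>c \<in> carrier C; b \<in> carrier B; b' \<in> carrier B\<rbrakk>
      \<Longrightarrow> c \<odot>\<^bsub>B\<^esub> (b \<oplus>\<^bsub>B\<^esub> b') = c \<odot>\<^bsub>B\<^esub> b \<oplus>\<^bsub>B\<^esub> c \<odot>\<^bsub>B\<^esub> b'"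
    and lact_assoc: "\<lbrakk>c \<in> carrier C; c' \<in> carrier C; b \<in> carrier B\<rbrakk>
      \<Longrightarrow> (c \<otimes>\<^bsub>C\<^esub> c') \<odot>\<^bsub>B\<^esub> b = c \<odot>\<^bsub>B\<^esub> (c' \<odot>\<^bsub>B\<^esub> b)"
    and lact_one: "b \<in> carrier B \<Longrightarrow> \<one>\<^bsub>C\<^esub> \<odot>\<^bsub>B\<^esub> b = b"
    and ract_closed: "\<lbrakk>b \<in> carrier B; a \<in> carrier A\<rbrakk> \<Longrightarrow> rsmult B b a \<in> carrier B"
    and ract_l_distr: "\<lbrakk>b \<in> carrier B; b' \<in> carrier B; a \<in> carrier A\<rbrakk>
      \<Longrightarrow> rsmult B (b \<oplus>\<^bsub>B\<^esub> b') a = rsmult B b a \<oplus>\<^bsub>B\<^esub> rsmult B b' a"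
    and ract_r_distr: "\<lbrakk>b \<in> carrier B; a \<in> carrier A; a' \<in> carrier A\<rbrakk>
      \<Longrightarrow> rsmult B b (a \<oplus>\<^bsub>A\<^esub> a') = rsmult B b a \<oplus>\<^bsub>B\<^esub> rsmult B b a'"
    and ract_assoc: "\<lbrakk>b \<in> carrier B; a \<in> carrier A; a' \<in> carrier A\<rbrakk>
      \<Longrightarrow> rsmult B b (a \<otimes>\<^bsub>A\<^esub> a') = rsmult B (rsmult B b a) a'"
    and ract_one: "b \<in> carrier B \<Longrightarrow> rsmult B b \<one>\<^bsub>A\<^esub> = b"
    and lact_ract: "\<lbrakk>c \<in> carrier C; b \<in> carrier B; a \<in> carrier A\<rbrakk>
      \<Longrightarrow> rsmult B (c \<odot>\<^bsub>B\<^esub> b) a = c \<odot>\<^bsub>B\<^esub> rsmult B b a"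
    and bgrade_grading: "is_grading B (mgrade B)"
    and bgrade_lact: "\<lbrakk>c \<in> rgrade C i; b \<in> mgrade B j\<rbrakk> \<Longrightarrow> c \<odot>\<^bsub>B\<^esub> b \<in> mgrade B (i + j)"
    and bgrade_ract: "\<lbrakk>b \<in> mgrade B i; a \<in> rgrade A j\<rbrakk> \<Longrightarrow> rsmult B b a \<in> mgrade B (i + j)"

sublocale graded_bimod \<subseteq> B.gr: graded_group B "mgrade B"
  by (intro graded_groupI bgrade_grading B.abelian_group_axioms)

locale tensor_product = graded_bimod C A B + M: graded_left_module A M
  for C :: "'c graded_ring" and A :: "'a graded_ring"
    and B :: "('c, 'a, 'b) graded_bimodule" and M :: "('a, 'm) graded_module"

definition balanced ::
    "'a graded_ring \<Rightarrow> ('c, 'a, 'b) graded_bimodule \<Rightarrow> ('a, 'm) graded_module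
      \<Rightarrow> ('g, 'z) ring_scheme \<Rightarrow> ('b \<Rightarrow> 'm \<Rightarrow> 'g) \<Rightarrow> bool" where
  "balanced A B M G \<beta> \<longleftrightarrow>
     (\<forall>b\<in>carrier B. \<forall>m\<in>carrier M. \<beta> b m \<in> carrier G) \<and>
     (\<forall>b\<in>carrier B. \<forall>b'\<in>carrier B. \<forall>m\<in>carrier M. \<beta> (b \<oplus>\<^bsub>B\<^esub> b') m = \<beta> b m \<oplus>\<^bsub>G\<^esub> \<beta> b' m) \<and>
     (\<forall>b\<in>carrier B. \<forall>m\<in>carrier M. \<forall>m'\<in>carrier M. \<beta> b (m \<oplus>\<^bsub>M\<^esub> m') = \<beta> b m \<oplus>\<^bsub>G\<^esub> \<beta> b m') \<and>
     (\<forall>b\<in>carrier B. \<forall>a\<in>carrier A. \<forall>m\<in>carrier M. \<beta> (rsmult B b a) m = \<beta> b (a \<odot>\<^bsub>M\<^esub> m))"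

lemma keys_diff2:
  "Poly_Mapping.keys (frag_of x - frag_of y) \<subseteq> {x, y}" "Poly_Mapping.keys (frag_of x - frag_of y - frag_of z) \<subseteq> {x, y, z}"
proof -
  show *: "Poly_Mapping.keys (frag_of x - frag_of y) \<subseteq> {x, y}" for x y :: 'a
    using keys_diff[of "frag_of x" "frag_of y"] by auto
  show "Poly_Mapping.keys (frag_of x - frag_of y - frag_of z) \<subseteq> {x, y, z}"
    using keys_diff[of "frag_of x - frag_of y" "frag_of z"] *[of x y] by auto
qed

context tensor_product
begin

abbreviation "F \<equiv> free_Abelian_group (carrier B \<times> carrier M)"
abbreviation "rels \<equiv> tensor_rels A B M"
abbreviation "cls \<equiv> tensor_class A B M"
abbreviation "pure \<equiv> pure_tensor A B M"
abbreviation "T \<equiv> tensor A B M"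

sublocale F: comm_group F by (rule abelian_free_Abelian_group)

lemma rels_subgroup: "subgroup rels F"
  unfolding tensor_rels_def
  by (rule F.generate_is_subgroup)
    (auto dest!: subsetD[OF keys_diff2(1)] subsetD[OF keys_diff2(2)]
      simp: lact_closed ract_closed M.act_closed)

lemma rels_normal: "rels \<lhd> F"
  using rels_subgroup by (simp add: F.normal_iff_subgroup)

lemma rels_sub: "z \<in> rels \<Longrightarrow> Poly_Mapping.keys z \<subseteq> carrier B \<times> carrier M"
  using subgroup.subset[OF rels_subgroup] by (auto simp del: carrier_free_Abelian_group_iff simp: free_Abelian_group_def)

lemma cls_eqI:
  assumes "z - w \<in> rels" "Poly_Mapping.keys w \<subseteq> carrier B \<times> carrier M"
  shows "cls z = cls w"
proof -
  have "z \<in> rels #>\<^bsub>F\<^esub> w" unfolding r_coset_def using assms(1) by force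
  then show ?thesis
    unfolding tensor_class_def
    using F.repr_independence[OF _ _ rels_subgroup, of z w] assms(2) by simp
qed

lemma carrier_tensor: "carrier T = cls ` {z. Poly_Mapping.keys z \<subseteq> carrier B \<times> carrier M}"
  by (auto simp: tensor_def Let_def carrier_FactGroup tensor_class_def)

lemma cls_closed: "Poly_Mapping.keys z \<subseteq> carrier B \<times> carrier M \<Longrightarrow> cls z \<in> carrier T"
  by (simp add: carrier_tensor)

lemma cls_add:
  assumes "Poly_Mapping.keys z \<subseteq> carrier B \<times> carrier M" "Poly_Mapping.keys w \<subseteq> carrier B \<times> carrier M"
  shows "cls z \<oplus>\<^bsub>T\<^esub> cls w = cls (z + w)"
  using normal.rcos_sum[OF rels_normal, of z w] assms
  by (simp add: tensor_def Let_def tensor_class_def)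

lemma zero_tensor: "\<zero>\<^bsub>T\<^esub> = cls 0"
  using F.coset_mult_one[OF subgroup.subset[OF rels_subgroup]]
  by (simp add: tensor_def Let_def tensor_class_def)

lemma tensor_abelian_group: "abelian_group T"
proof (rule abelian_groupI)
  note keys_add[THEN subset_trans, simp]
  show "\<zero>\<^bsub>T\<^esub> \<in> carrier T" by (simp add: zero_tensor cls_closed)
  fix X assume "X \<in> carrier T"
  then obtain z where z: "Poly_Mapping.keys z \<subseteq> carrier B \<times> carrier M" "X = cls z" by (auto simp: carrier_tensor)
  show "\<zero>\<^bsub>T\<^esub> \<oplus>\<^bsub>T\<^esub> X = X" using z by (simp add: zero_tensor cls_add)
  have "cls (- z) \<oplus>\<^bsub>T\<^esub> X = \<zero>\<^bsub>T\<^esub>" using z by (simp add: zero_tensor cls_add keys_minus)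
  then show "\<exists>Y\<in>carrier T. Y \<oplus>\<^bsub>T\<^esub> X = \<zero>\<^bsub>T\<^esub>"
    by (rule bexI) (use z in \<open>simp add: cls_closed keys_minus\<close>)
  fix Y assume "Y \<in> carrier T"
  then obtain w where w: "Poly_Mapping.keys w \<subseteq> carrier B \<times> carrier M" "Y = cls w" by (auto simp: carrier_tensor)
  show "X \<oplus>\<^bsub>T\<^esub> Y \<in> carrier T" using z w by (simp add: cls_add cls_closed)
  show "X \<oplus>\<^bsub>T\<^esub> Y = Y \<oplus>\<^bsub>T\<^esub> X" using z w by (simp add: cls_add add.commute)
  fix W assume "W \<in> carrier T"
  then obtain u where u: "Poly_Mapping.keys u \<subseteq> carrier B \<times> carrier M" "W = cls u" by (auto simp: carrier_tensor)
  show "X \<oplus>\<^bsub>T\<^esub> Y \<oplus>\<^bsub>T\<^esub> W = X \<oplus>\<^bsub>T\<^esub> (Y \<oplus>\<^bsub>T\<^esub> W)" using z w u by (simp add: cls_add add.assoc)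
qed

sublocale T: abelian_group T by (rule tensor_abelian_group)

lemma pure_closed [simp]: "\<lbrakk>b \<in> carrier B; m \<in> carrier M\<rbrakk> \<Longrightarrow> pure b m \<in> carrier T"
  by (simp add: pure_tensor_def cls_closed)

lemma pure_balanced: "balanced A B M T pure"
  unfolding balanced_def
proof (intro conjI ballI)
  fix b m assume bm: "b \<in> carrier B" "m \<in> carrier M"
  show "pure b m \<in> carrier T" using bm by simp
  show "pure (b \<oplus>\<^bsub>B\<^esub> b') m = pure b m \<oplus>\<^bsub>T\<^esub> pure b' m" if "b' \<in> carrier B" for b'
  proof -
    have "frag_of (b \<oplus>\<^bsub>B\<^esub> b', m) - (frag_of (b, m) + frag_of (b', m)) \<in> rels"
      unfolding tensor_rels_def diff_diff_eq[symmetric]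
      by (rule generate.incl) (use bm that in blast)
    moreover have "Poly_Mapping.keys (frag_of (b, m) + frag_of (b', m)) \<subseteq> carrier B \<times> carrier M"
      using keys_add[of "frag_of (b, m)" "frag_of (b', m)"] bm that by auto
    ultimately show ?thesis
      using bm that by (simp add: pure_tensor_def cls_add cls_eqI)
  qed
  show "pure b (m \<oplus>\<^bsub>M\<^esub> m') = pure b m \<oplus>\<^bsub>T\<^esub> pure b m'" if "m' \<in> carrier M" for m'
  proof -
    have "frag_of (b, m \<oplus>\<^bsub>M\<^esub> m') - (frag_of (b, m) + frag_of (b, m')) \<in> rels"
      unfolding tensor_rels_def diff_diff_eq[symmetric]
      by (rule generate.incl) (use bm that in blast)
    moreover have "Poly_Mapping.keys (frag_of (b, m) + frag_of (b, m')) \<subseteq> carrier B \<times> carrier M"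
      using keys_add[of "frag_of (b, m)" "frag_of (b, m')"] bm that by auto
    ultimately show ?thesis
      using bm that by (simp add: pure_tensor_def cls_add cls_eqI)
  qed
next
  fix b a m assume bam: "b \<in> carrier B" "a \<in> carrier A" "m \<in> carrier M"
  have "frag_of (rsmult B b a, m) - frag_of (b, a \<odot>\<^bsub>M\<^esub> m) \<in> rels"
    unfolding tensor_rels_def by (rule generate.incl) (use bam in blast)
  then show "pure (rsmult B b a) m = pure b (a \<odot>\<^bsub>M\<^esub> m)"
    using bam by (simp add: pure_tensor_def cls_eqI M.act_closed)
qed

lemma pure_add_left: "\<lbrakk>b \<in> carrier B; b' \<in> carrier B; m \<in> carrier M\<rbrakk>
    \<Longrightarrow> pure (b \<oplus>\<^bsub>B\<^esub> b') m = pure b m \<oplus>\<^bsub>T\<^esub> pure b' m"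
  and pure_add_right: "\<lbrakk>b \<in> carrier B; m \<in> carrier M; m' \<in> carrier M\<rbrakk>
    \<Longrightarrow> pure b (m \<oplus>\<^bsub>M\<^esub> m') = pure b m \<oplus>\<^bsub>T\<^esub> pure b m'"
  and pure_act: "\<lbrakk>b \<in> carrier B; a \<in> carrier A; m \<in> carrier M\<rbrakk>
    \<Longrightarrow> pure (rsmult B b a) m = pure b (a \<odot>\<^bsub>M\<^esub> m)"
  using pure_balanced by (auto simp: balanced_def)

lemma pure_hom_left: "m \<in> carrier M \<Longrightarrow> abelian_group_hom B T (\<lambda>b. pure b m)"
  by (rule abelian_group_hom_additiveI) (auto simp: pure_add_left B.abelian_group_axioms T.abelian_group_axioms)

lemma pure_hom_right: "b \<in> carrier B \<Longrightarrow> abelian_group_hom M T (pure b)"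
  by (rule abelian_group_hom_additiveI) (auto simp: pure_add_right M.M.abelian_group_axioms T.abelian_group_axioms)

lemma pure_zero_left [simp]: "m \<in> carrier M \<Longrightarrow> pure \<zero>\<^bsub>B\<^esub> m = \<zero>\<^bsub>T\<^esub>"
  using abelian_group_hom.hom_zero[OF pure_hom_left] .

lemma pure_neg_left: "\<lbrakk>b \<in> carrier B; m \<in> carrier M\<rbrakk> \<Longrightarrow> pure (\<ominus>\<^bsub>B\<^esub> b) m = \<ominus>\<^bsub>T\<^esub> pure b m"
  using abelian_group_hom.hom_a_inv[OF pure_hom_left] .

lemma pure_zero_right [simp]: "b \<in> carrier B \<Longrightarrow> pure b \<zero>\<^bsub>M\<^esub> = \<zero>\<^bsub>T\<^esub>"
  using abelian_group_hom.hom_zero[OF pure_hom_right] .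

lemma tensor_induct [consumes 1, case_names pure add]:
  assumes X: "X \<in> carrier T"
    and pure: "\<And>b m. \<lbrakk>b \<in> carrier B; m \<in> carrier M\<rbrakk> \<Longrightarrow> Q (pure b m)"
    and add: "\<And>X Y. \<lbrakk>X \<in> carrier T; Y \<in> carrier T; Q X; Q Y\<rbrakk> \<Longrightarrow> Q (X \<oplus>\<^bsub>T\<^esub> Y)"
  shows "Q X"
proof -
  have neg: "\<ominus>\<^bsub>T\<^esub> cls z = cls (- z)" if "Poly_Mapping.keys z \<subseteq> carrier B \<times> carrier M" for z
    using that by (intro T.minus_equality) (auto simp: cls_add zero_tensor cls_closed keys_minus)
  from X obtain z where z: "Poly_Mapping.keys z \<subseteq> carrier B \<times> carrier M" "X = cls z" by (auto simp: carrier_tensor)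
  have "Q (cls z) \<and> Q (\<ominus>\<^bsub>T\<^esub> cls z)" using z(1)
  proof (induction z rule: free_Abelian_group_induct[consumes 1, case_names zero diff single])
    case zero
    have "Q \<zero>\<^bsub>T\<^esub>" using pure[of "\<zero>\<^bsub>B\<^esub>" "\<zero>\<^bsub>M\<^esub>"] by simp
    then show ?case using T.add.inv_one by (simp add: a_inv_def flip: zero_tensor)
  next
    case (diff x y)
    note 2 = diff
    have "cls (x - y) = cls x \<oplus>\<^bsub>T\<^esub> \<ominus>\<^bsub>T\<^esub> cls y"
      using 2 by (simp add: neg cls_add keys_minus)
    moreover have "\<ominus>\<^bsub>T\<^esub> cls (x - y) = cls y \<oplus>\<^bsub>T\<^esub> \<ominus>\<^bsub>T\<^esub> cls x"
      using 2 keys_diff[of x y] by (subst neg) (auto simp: neg cls_add keys_minus)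
    ultimately show ?case using 2 by (simp add: add cls_closed)
  next
    case (single p)
    then show ?case
      using pure[of "fst p" "snd p"] pure[of "\<ominus>\<^bsub>B\<^esub> fst p" "snd p"] pure_neg_left[of "fst p" "snd p"]
      by (auto simp: pure_tensor_def)
  qed
  then show ?thesis using z by simp
qed

lemma tensor_hom_eqI:
  assumes "abelian_group_hom T G h" "abelian_group_hom T G k"
    and "\<And>b m. \<lbrakk>b \<in> carrier B; m \<in> carrier M\<rbrakk> \<Longrightarrow> h (pure b m) = k (pure b m)"
    and "X \<in> carrier T"
  shows "h X = k X"
proof -
  interpret h: abelian_group_hom T G h by fact
  interpret k: abelian_group_hom T G k by fact
  show ?thesis using assms(4) by (induction rule: tensor_induct) (auto simp: assms(3))
qed

text \<open>The action and the functoriality of a tensor product are defined by choosing a representative of a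
  coset. The choice is harmless for every homomorphism on the free group that is balanced on
  generators, as such a homomorphism kills the defining relations.\<close>

lemma hom_on_representative:
  assumes G: "abelian_group G" and h: "h \<in> hom F (add_monoid G)"
    and bal: "balanced A B M G (\<lambda>b m. h (frag_of (b, m)))"
    and z: "Poly_Mapping.keys z \<subseteq> carrier B \<times> carrier M"
  shows "h (SOME w. w \<in> cls z) = h z"
proof -
  interpret G: abelian_group G by fact
  interpret h: group_hom F "add_monoid G" h
    by (intro group_hom.intro group_hom_axioms.intro h G.add.is_group F.is_group)
  have h_add: "h (x + y) = h x \<oplus>\<^bsub>G\<^esub> h y"
    if "Poly_Mapping.keys x \<subseteq> carrier B \<times> carrier M" "Poly_Mapping.keys y \<subseteq> carrier B \<times> carrier M" for x y
    using h.hom_mult[of x y] that by simp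
  have h_diff: "h (x - y) = h x \<ominus>\<^bsub>G\<^esub> h y"
    if "Poly_Mapping.keys x \<subseteq> carrier B \<times> carrier M" "Poly_Mapping.keys y \<subseteq> carrier B \<times> carrier M" for x y
    using h_add[of x "- y"] h.hom_inv[of y] that by (simp add: keys_minus a_minus_def a_inv_def)
  have hc: "h x \<in> carrier G" if "Poly_Mapping.keys x \<subseteq> carrier B \<times> carrier M" for x
    using h.hom_closed[of x] that by simp
  have kd: "Poly_Mapping.keys (frag_of x - frag_of y) \<subseteq> carrier B \<times> carrier M"
    if "x \<in> carrier B \<times> carrier M" "y \<in> carrier B \<times> carrier M" for x y
    using keys_diff2(1)[of x y] that by auto
  have "rels \<subseteq> kernel F (add_monoid G) h"
    unfolding tensor_rels_def
  proof (rule F.generate_subgroup_incl[OF _ h.subgroup_kernel], safe)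
    fix b b' m assume *: "b \<in> carrier B" "b' \<in> carrier B" "m \<in> carrier M"
    let ?f = "frag_of (b \<oplus>\<^bsub>B\<^esub> b', m) - frag_of (b, m) - frag_of (b', m)"
    have "h ?f = \<zero>\<^bsub>G\<^esub>"
      using * bal hc[of "frag_of (b, m)"] hc[of "frag_of (b', m)"]
      by (simp add: h_diff kd balanced_def G.minus_eq G.a_assoc G.minus_add)
        (metis G.a_ac(2) G.a_assoc G.a_inv_closed G.r_neg G.r_zero hc)
    then show "?f \<in> kernel F (add_monoid G) h"
      using * keys_diff2(2)[of "(b \<oplus>\<^bsub>B\<^esub> b', m)" "(b, m)" "(b', m)"] by (auto simp: kernel_def)
  next
    fix b m m' assume *: "b \<in> carrier B" "m \<in> carrier M" "m' \<in> carrier M"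
    let ?f = "frag_of (b, m \<oplus>\<^bsub>M\<^esub> m') - frag_of (b, m) - frag_of (b, m')"
    have "h ?f = \<zero>\<^bsub>G\<^esub>"
      using * bal hc[of "frag_of (b, m)"] hc[of "frag_of (b, m')"]
      by (simp add: h_diff kd balanced_def G.minus_eq G.a_assoc G.minus_add)
        (metis G.a_ac(2) G.a_assoc G.a_inv_closed G.r_neg G.r_zero hc)
    then show "?f \<in> kernel F (add_monoid G) h"
      using * keys_diff2(2)[of "(b, m \<oplus>\<^bsub>M\<^esub> m')" "(b, m)" "(b, m')"] by (auto simp: kernel_def)
  next
    fix b a m assume *: "b \<in> carrier B" "a \<in> carrier A" "m \<in> carrier M"
    let ?f = "frag_of (rsmult B b a, m) - frag_of (b, a \<odot>\<^bsub>M\<^esub> m)"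
    have "h ?f = \<zero>\<^bsub>G\<^esub>"
      using * bal hc[of "frag_of (b, a \<odot>\<^bsub>M\<^esub> m)"]
      by (simp add: h_diff balanced_def ract_closed M.act_closed G.minus_eq G.r_neg)
    then show "?f \<in> kernel F (add_monoid G) h"
      using * kd[of "(rsmult B b a, m)" "(b, a \<odot>\<^bsub>M\<^esub> m)"]
      by (simp add: kernel_def ract_closed M.act_closed)
  qed
  then have rels0: "h x = \<zero>\<^bsub>G\<^esub>" if "x \<in> rels" for x using that by (auto simp: kernel_def)
  have "z \<in> cls z"
    using F.rcos_self[OF _ rels_subgroup, of z] z by (simp add: tensor_class_def)
  then have "(SOME w. w \<in> cls z) \<in> cls z" by (rule someI)
  then obtain n where "n \<in> rels" "(SOME w. w \<in> cls z) = n + z"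
    by (auto simp: tensor_class_def r_coset_def)
  then show ?thesis using h_add[of n z] rels0 z rels_sub hc by simp
qed

text \<open>The universal property of the tensor product: extend \<open>\<beta>\<close> to the free abelian group and descend to the
  quotient.\<close>

lemma tensor_lift_ex:
  assumes G: "abelian_group G" and bal: "balanced A B M G \<beta>"
  shows "\<exists>h. abelian_group_hom T G h \<and> (\<forall>b\<in>carrier B. \<forall>m\<in>carrier M. h (pure b m) = \<beta> b m)"
proof -
  interpret G: abelian_group G by fact
  have "(\<lambda>(b, m). \<beta> b m) ` (carrier B \<times> carrier M) \<subseteq> carrier (add_monoid G)"
    using bal by (auto simp: balanced_def)
  then obtain h where h: "h \<in> hom F (add_monoid G)"
    and hf: "\<And>x. x \<in> carrier B \<times> carrier M \<Longrightarrow> h (frag_of x) = (\<lambda>(b, m). \<beta> b m) x"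
    by (rule comm_group.free_Abelian_group_universal[OF G.a_comm_group, of _ "carrier B \<times> carrier M"]) auto
  have hf': "h (frag_of (b, m)) = \<beta> b m" if "b \<in> carrier B" "m \<in> carrier M" for b m
    using hf[of "(b, m)"] that by simp
  have bal': "balanced A B M G (\<lambda>b m. h (frag_of (b, m)))"
    using bal by (auto simp: balanced_def hf' ract_closed M.act_closed)
  note rep = hom_on_representative[OF G h bal']
  have hc: "h x \<in> carrier G" if "Poly_Mapping.keys x \<subseteq> carrier B \<times> carrier M" for x
    using hom_in_carrier[OF h, of x] that by simp
  have "abelian_group_hom T G (\<lambda>X. h (SOME z. z \<in> X))"
  proof (rule abelian_group_hom_additiveI[OF T.abelian_group_axioms G])
    fix X assume "X \<in> carrier T"
    then obtain z where z: "Poly_Mapping.keys z \<subseteq> carrier B \<times> carrier M" "X = cls z" by (auto simp: carrier_tensor)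
    then show "h (SOME z. z \<in> X) \<in> carrier G" by (simp add: rep hc)
    fix Y assume "Y \<in> carrier T"
    then obtain w where w: "Poly_Mapping.keys w \<subseteq> carrier B \<times> carrier M" "Y = cls w" by (auto simp: carrier_tensor)
    have "Poly_Mapping.keys (z + w) \<subseteq> carrier B \<times> carrier M" using keys_add[of z w] z w by auto
    then show "h (SOME z. z \<in> X \<oplus>\<^bsub>T\<^esub> Y) = h (SOME z. z \<in> X) \<oplus>\<^bsub>G\<^esub> h (SOME z. z \<in> Y)"
      using hom_mult[OF h, of z w] z w by (simp add: cls_add rep)
  qed
  moreover have "\<forall>b\<in>carrier B. \<forall>m\<in>carrier M. h (SOME z. z \<in> pure b m) = \<beta> b m"
    by (simp add: pure_tensor_def rep hf')
  ultimately show ?thesis by blast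
qed

end

definition tensor_lift ::
    "'a graded_ring \<Rightarrow> ('c, 'a, 'b) graded_bimodule \<Rightarrow> ('a, 'm) graded_module
      \<Rightarrow> ('g, 'z) ring_scheme \<Rightarrow> ('b \<Rightarrow> 'm \<Rightarrow> 'g) \<Rightarrow> (('b \<times> 'm) \<Rightarrow>\<^sub>0 int) set \<Rightarrow> 'g" where
  "tensor_lift A B M G \<beta> = (SOME h. abelian_group_hom (tensor A B M) G h \<and>
     (\<forall>b\<in>carrier B. \<forall>m\<in>carrier M. h (pure_tensor A B M b m) = \<beta> b m))"

lemma (in tensor_product)
  assumes "abelian_group G" "balanced A B M G \<beta>"
  shows tensor_lift_hom: "abelian_group_hom T G (tensor_lift A B M G \<beta>)"
    and tensor_lift_pure: "\<lbrakk>b \<in> carrier B; m \<in> carrier M\<rbrakk> \<Longrightarrow> tensor_lift A B M G \<beta> (pure b m) = \<beta> b m"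
  using someI_ex[OF tensor_lift_ex[OF assms], folded tensor_lift_def] by auto

text \<open>The map \<open>\<phi> \<otimes> \<psi>\<close>. It covers both the action of a scalar \<open>c\<close>, where \<open>\<phi>\<close> is multiplication by \<open>c\<close>, and
  the functor on a map \<open>f\<close>, where \<open>\<psi> = f\<close>.\<close>

definition tensor_map ::
    "'a graded_ring \<Rightarrow> ('c, 'a, 'b) graded_bimodule \<Rightarrow> ('a, 'n) graded_module
      \<Rightarrow> ('b \<Rightarrow> 'b) \<Rightarrow> ('m \<Rightarrow> 'n) \<Rightarrow> (('b \<times> 'm) \<Rightarrow>\<^sub>0 int) set \<Rightarrow> (('b \<times> 'n) \<Rightarrow>\<^sub>0 int) set" where
  "tensor_map A B N \<phi> \<psi> X = tensor_class A B N
     (frag_extend (\<lambda>(b, m). frag_of (\<phi> b, \<psi> m)) (SOME z. z \<in> X))"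

lemma
  assumes M: "tensor_product C A B M" and N: "tensor_product C A B N"
    and \<phi>: "abelian_group_hom B B \<phi>" "\<And>b a. \<lbrakk>b \<in> carrier B; a \<in> carrier A\<rbrakk> \<Longrightarrow> \<phi> (rsmult B b a) = rsmult B (\<phi> b) a"
    and \<psi>: "abelian_group_hom M N \<psi>" "\<And>a m. \<lbrakk>a \<in> carrier A; m \<in> carrier M\<rbrakk> \<Longrightarrow> \<psi> (a \<odot>\<^bsub>M\<^esub> m) = a \<odot>\<^bsub>N\<^esub> \<psi> m"
  shows tensor_map_hom: "abelian_group_hom (tensor A B M) (tensor A B N) (tensor_map A B N \<phi> \<psi>)"
    and tensor_map_pure: "\<And>b m. \<lbrakk>b \<in> carrier B; m \<in> carrier M\<rbrakk>
      \<Longrightarrow> tensor_map A B N \<phi> \<psi> (pure_tensor A B M b m) = pure_tensor A B N (\<phi> b) (\<psi> m)"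
proof -
  interpret M: tensor_product C A B M by fact
  interpret N: tensor_product C A B N by fact
  interpret \<phi>: abelian_group_hom B B \<phi> by fact
  interpret \<psi>: abelian_group_hom M N \<psi> by fact
  let ?e = "frag_extend (\<lambda>(b, m). frag_of (\<phi> b, \<psi> m))"
  let ?h = "\<lambda>z. tensor_class A B N (?e z)"
  have keys_e: "Poly_Mapping.keys (?e z) \<subseteq> carrier B \<times> carrier N" if "Poly_Mapping.keys z \<subseteq> carrier B \<times> carrier M" for z
    by (rule order_trans[OF keys_frag_extend]) (use that in auto)
  have h: "?h \<in> hom M.F (add_monoid N.T)"
    unfolding hom_def by (auto simp: frag_extend_add N.cls_add keys_e N.cls_closed)
  have bal: "balanced A B M N.T (\<lambda>b m. ?h (frag_of (b, m)))"
    unfolding balanced_def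
    by (simp add: \<phi>(2) \<psi>(2) N.pure_add_left N.pure_add_right N.pure_act flip: pure_tensor_def)
  note rep = M.hom_on_representative[OF N.T.abelian_group_axioms h bal]
  show "abelian_group_hom (tensor A B M) (tensor A B N) (tensor_map A B N \<phi> \<psi>)"
  proof (rule abelian_group_hom_additiveI[OF M.T.abelian_group_axioms N.T.abelian_group_axioms])
    fix X assume "X \<in> carrier M.T"
    then obtain z where z: "Poly_Mapping.keys z \<subseteq> carrier B \<times> carrier M" "X = M.cls z" by (auto simp: M.carrier_tensor)
    then show "tensor_map A B N \<phi> \<psi> X \<in> carrier N.T"
      by (simp add: tensor_map_def rep N.cls_closed keys_e)
    fix Y assume "Y \<in> carrier M.T"
    then obtain w where w: "Poly_Mapping.keys w \<subseteq> carrier B \<times> carrier M" "Y = M.cls w" by (auto simp: M.carrier_tensor)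
    have "Poly_Mapping.keys (z + w) \<subseteq> carrier B \<times> carrier M" using keys_add[of z w] z w by auto
    then show "tensor_map A B N \<phi> \<psi> (X \<oplus>\<^bsub>M.T\<^esub> Y)
        = tensor_map A B N \<phi> \<psi> X \<oplus>\<^bsub>N.T\<^esub> tensor_map A B N \<phi> \<psi> Y"
      using z w by (simp add: tensor_map_def M.cls_add rep frag_extend_add N.cls_add keys_e)
  qed
  show "tensor_map A B N \<phi> \<psi> (pure_tensor A B M b m) = pure_tensor A B N (\<phi> b) (\<psi> m)"
    if "b \<in> carrier B" "m \<in> carrier M" for b m
    using that by (simp add: tensor_map_def pure_tensor_def rep)
qed

context tensor_product
begin

lemma mgrade_tensor: "mgrade T n = generate (F Mod rels) {pure b m | b m i j.
    b \<in> mgrade B i \<and> m \<in> mgrade M j \<and> i + j = n}"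
  by (simp add: tensor_def Let_def)

lemma quotient_eq: "carrier (F Mod rels) = carrier T" "monoid.mult (F Mod rels) = add T" "\<one>\<^bsub>F Mod rels\<^esub> = \<zero>\<^bsub>T\<^esub>"
  by (simp_all add: tensor_def Let_def)

lemma tensor_grade_subgroup: "additive_subgroup (mgrade T n) T"
proof -
  interpret Q: group "F Mod rels" by (rule normal.factorgroup_is_group[OF rels_normal])
  have "subgroup (mgrade T n) (F Mod rels)"
    unfolding mgrade_tensor
    by (rule Q.generate_is_subgroup) (auto simp: quotient_eq B.gr.grade_carrier M.gr.grade_carrier)
  moreover have "subgroup (mgrade T n) (F Mod rels) \<longleftrightarrow> subgroup (mgrade T n) (add_monoid T)"
    by (rule subgroup_cong) (simp_all add: quotient_eq del: one_FactGroup mult_FactGroup)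
  ultimately show ?thesis by (intro additive_subgroupI) simp
qed

lemma pure_grade:
  "\<lbrakk>b \<in> mgrade B i; m \<in> mgrade M j\<rbrakk> \<Longrightarrow> pure b m \<in> mgrade T (i + j)"
  unfolding mgrade_tensor by (rule generate.incl) blast

text \<open>Pure tensors of degree \<open>n\<close> generate the piece even as a monoid, since \<open>- (b \<otimes> m) = (- b) \<otimes> m\<close>.\<close>

lemma tensor_grade_induct [consumes 1, case_names pure add]:
  assumes X: "X \<in> mgrade T n"
    and pure: "\<And>b m i j. \<lbrakk>b \<in> mgrade B i; m \<in> mgrade M j; i + j = n\<rbrakk> \<Longrightarrow> Q (pure b m)"
    and add: "\<And>X Y. \<lbrakk>X \<in> mgrade T n; Y \<in> mgrade T n; Q X; Q Y\<rbrakk> \<Longrightarrow> Q (X \<oplus>\<^bsub>T\<^esub> Y)"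
  shows "Q X"
  using X unfolding mgrade_tensor
proof (induction rule: generate.induct)
  case one
  show ?case using pure[of "\<zero>\<^bsub>B\<^esub>" 0 "\<zero>\<^bsub>M\<^esub>" n] by (simp add: quotient_eq(3) del: one_FactGroup)
next
  case (incl h)
  then show ?case using pure by blast
next
  case (inv h)
  then obtain b m i j where h: "h = pure b m" "b \<in> mgrade B i" "m \<in> mgrade M j" "i + j = n" by blast
  have "inv\<^bsub>F Mod rels\<^esub> h = \<ominus>\<^bsub>T\<^esub> h"
    by (simp add: a_inv_def m_inv_def quotient_eq del: one_FactGroup mult_FactGroup)
  also have "\<dots> = pure (\<ominus>\<^bsub>B\<^esub> b) m"
    using h by (simp add: pure_neg_left B.gr.grade_carrier M.gr.grade_carrier)
  finally show ?case using pure[OF B.gr.grade_neg[OF h(2)] h(3,4)] by simp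
next
  case (eng x y)
  then show ?case using add[unfolded mgrade_tensor]
    by (simp add: quotient_eq(2) del: mult_FactGroup)
qed

lemma smult_tensor: "c \<odot>\<^bsub>T\<^esub> X = tensor_map A B M (\<lambda>b. c \<odot>\<^bsub>B\<^esub> b) (\<lambda>m. m) X"
  by (simp add: tensor_def Let_def tensor_map_def)

lemma lact_hom: "c \<in> carrier C \<Longrightarrow> abelian_group_hom B B (\<lambda>b. c \<odot>\<^bsub>B\<^esub> b)"
  by (rule abelian_group_hom_additiveI) (simp_all add: lact_closed lact_r_distr B.abelian_group_axioms)

lemma id_hom: "abelian_group_hom M M (\<lambda>m. m)"
  by (rule abelian_group_hom_additiveI) (simp_all add: M.M.abelian_group_axioms)

lemma smult_tensor_hom: "c \<in> carrier C \<Longrightarrow> abelian_group_hom T T (\<lambda>X. c \<odot>\<^bsub>T\<^esub> X)"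
  unfolding smult_tensor using tensor_product_axioms
  by (auto intro!: tensor_map_hom lact_hom id_hom simp: lact_ract)

lemma smult_pure: "\<lbrakk>c \<in> carrier C; b \<in> carrier B; m \<in> carrier M\<rbrakk>
    \<Longrightarrow> c \<odot>\<^bsub>T\<^esub> pure b m = pure (c \<odot>\<^bsub>B\<^esub> b) m"
  unfolding smult_tensor
  by (rule tensor_map_pure[OF tensor_product_axioms tensor_product_axioms lact_hom _ id_hom])
    (simp_all add: lact_ract)

text \<open>The bilinear map \<open>(b, m) \<mapsto> \<Sum>\<^sub>i b\<^sub>i \<otimes> m\<^bsub>n-i\<^esub>\<close>, which induces the projection of the tensor product
  onto its part of degree \<open>n\<close>.\<close>

definition degree_pairing :: "int \<Rightarrow> 'b \<Rightarrow> 'm \<Rightarrow> (('b \<times> 'm) \<Rightarrow>\<^sub>0 int) set" where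
  "degree_pairing n b m = finsum T
     (\<lambda>i. pure (homog_part B (mgrade B) i b) (homog_part M (mgrade M) (n - i) m))
     {i. homog_part B (mgrade B) i b \<noteq> \<zero>\<^bsub>B\<^esub>}"

lemma degree_pairing_superset:
  assumes "finite I" "\<And>i. i \<notin> I \<Longrightarrow> homog_part B (mgrade B) i b = \<zero>\<^bsub>B\<^esub>"
    and "b \<in> carrier B" "m \<in> carrier M"
  shows "degree_pairing n b m = finsum T
     (\<lambda>i. pure (homog_part B (mgrade B) i b) (homog_part M (mgrade M) (n - i) m)) I"
  unfolding degree_pairing_def
  by (rule T.add.finprod_mono_neutral_cong_left) (use assms in auto)

lemma degree_pairing_add_right:
  assumes "b \<in> carrier B" "m \<in> carrier M" "m' \<in> carrier M"
  shows "degree_pairing n b (m \<oplus>\<^bsub>M\<^esub> m') = degree_pairing n b m \<oplus>\<^bsub>T\<^esub> degree_pairing n b m'"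
  unfolding degree_pairing_def using assms
  by (simp add: M.gr.homog_part_add pure_add_right T.finsum_addf)

lemma degree_pairing_add_left:
  assumes "b \<in> carrier B" "b' \<in> carrier B" "m \<in> carrier M"
  shows "degree_pairing n (b \<oplus>\<^bsub>B\<^esub> b') m = degree_pairing n b m \<oplus>\<^bsub>T\<^esub> degree_pairing n b' m"
proof -
  let ?I = "{i. homog_part B (mgrade B) i b \<noteq> \<zero>\<^bsub>B\<^esub>} \<union> {i. homog_part B (mgrade B) i b' \<noteq> \<zero>\<^bsub>B\<^esub>}"
  have fin: "finite ?I" using assms by (simp add: B.gr.finite_homog_support)
  note sup = degree_pairing_superset[OF fin, where n = n]
  show ?thesis
    using assms
    by (subst (1 2 3) sup)
      (simp_all add: B.gr.homog_part_add pure_add_left T.finsum_addf)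
qed

lemma degree_pairing_closed:
  "\<lbrakk>b \<in> carrier B; m \<in> carrier M\<rbrakk> \<Longrightarrow> degree_pairing n b m \<in> carrier T"
  unfolding degree_pairing_def by (rule T.finsum_closed) auto

lemma degree_pairing_homog:
  assumes "b \<in> mgrade B i" "m \<in> mgrade M j"
  shows "degree_pairing n b m = (if n = i + j then pure b m else \<zero>\<^bsub>T\<^esub>)"
proof -
  have c: "b \<in> carrier B" "m \<in> carrier M"
    using assms by (simp_all add: B.gr.grade_carrier M.gr.grade_carrier)
  have "degree_pairing n b m = finsum T
     (\<lambda>k. pure (homog_part B (mgrade B) k b) (homog_part M (mgrade M) (n - k) m)) {i}"
    by (rule degree_pairing_superset) (simp_all add: c B.gr.homog_part_homog[OF assms(1)])
  also have "\<dots> = pure b (homog_part M (mgrade M) (n - i) m)"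
    using c by (simp add: T.finsum_insert B.gr.homog_part_homog[OF assms(1)])
  finally show ?thesis using c by (auto simp: M.gr.homog_part_homog[OF assms(2)])
qed

text \<open>Both sides of the condition \<open>\<beta>(b a, m) = \<beta>(b, a m)\<close> are additive in \<open>b\<close>, \<open>a\<close> and \<open>m\<close>. For homogeneous
  arguments both are \<open>b a \<otimes> m\<close> or zero, according to the same total degree.\<close>

lemma degree_pairing_balanced: "balanced A B M T (degree_pairing n)"
  unfolding balanced_def
proof (intro conjI ballI)
  fix b a m assume "b \<in> carrier B" and a: "a \<in> carrier A" and m: "m \<in> carrier M"
  then show "degree_pairing n (rsmult B b a) m = degree_pairing n b (a \<odot>\<^bsub>M\<^esub> m)"
  proof (induction b rule: B.gr.graded_induct)
    case (homogeneous i b)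
    note b = homogeneous(1) B.gr.grade_carrier[OF homogeneous(1)]
    show ?case using a
    proof (induction a rule: A.gr.graded_induct)
      case (homogeneous j a)
      note a = homogeneous(1) A.gr.grade_carrier[OF homogeneous(1)]
      show ?case using m
      proof (induction m rule: M.gr.graded_induct)
        case (homogeneous k m)
        note m = homogeneous(1) M.gr.grade_carrier[OF homogeneous(1)]
        show ?case
          using degree_pairing_homog[OF bgrade_ract[OF b(1) a(1)] m(1)]
            degree_pairing_homog[OF b(1) M.mgrade_act[OF a(1) m(1)]] a b m
          by (simp add: pure_act add.assoc)
      next
        case (add m m')
        then show ?case
          using a b by (simp add: ract_closed M.act_closed M.act_r_distr degree_pairing_add_right)
      qed
    next
      case (add a a')
      then show ?case
        using b m by (simp add: ract_closed M.act_closed ract_r_distr M.act_l_distr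
            degree_pairing_add_right degree_pairing_add_left)
    qed
  next
    case (add b b')
    then show ?case
      using a m by (simp add: ract_closed M.act_closed ract_l_distr degree_pairing_add_left)
  qed
qed (simp_all add: degree_pairing_closed degree_pairing_add_left degree_pairing_add_right)

lemma tensor_grading: "is_grading T (mgrade T)"
proof (rule is_gradingI[where p = "\<lambda>n. tensor_lift A B M T (degree_pairing n)"])
  note lift_hom = tensor_lift_hom[OF T.abelian_group_axioms degree_pairing_balanced]
    and lift_pure = tensor_lift_pure[OF T.abelian_group_axioms degree_pairing_balanced]
  show "abelian_group T" by (rule T.abelian_group_axioms)
  show "additive_subgroup (mgrade T n) T" for n by (rule tensor_grade_subgroup)
  show "abelian_group_hom T T (tensor_lift A B M T (degree_pairing n))" for n by (rule lift_hom)
  show "tensor_lift A B M T (degree_pairing n) X = (if n = k then X else \<zero>\<^bsub>T\<^esub>)"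
    if "X \<in> mgrade T k" for n k X
    using that
  proof (induction rule: tensor_grade_induct)
    case (pure b m i j)
    then show ?case
      by (simp add: lift_pure degree_pairing_homog B.gr.grade_carrier M.gr.grade_carrier)
  next
    case (add X Y)
    then have "X \<in> carrier T" "Y \<in> carrier T"
      using additive_subgroup.a_subset[OF tensor_grade_subgroup] by blast+
    then show ?case
      using add abelian_group_hom.hom_add[OF lift_hom] by simp
  qed
  fix X Q assume X: "X \<in> carrier T" and homog: "\<And>n Y. Y \<in> mgrade T n \<Longrightarrow> Q Y"
    and Q_add: "\<And>Y Z. \<lbrakk>Y \<in> carrier T; Z \<in> carrier T; Q Y; Q Z\<rbrakk> \<Longrightarrow> Q (Y \<oplus>\<^bsub>T\<^esub> Z)"
  show "Q X" using X
  proof (induction rule: tensor_induct)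
    case (pure b m)
    show ?case using pure(1)
    proof (induction b rule: B.gr.graded_induct)
      case (homogeneous i b)
      note b = homogeneous B.gr.grade_carrier[OF homogeneous]
      show ?case using pure(2)
      proof (induction m rule: M.gr.graded_induct)
        case (homogeneous j m)
        then show ?case using homog pure_grade[OF b(1)] by blast
      next
        case (add m m')
        then show ?case using b Q_add
          by (simp add: pure_add_right)
      qed
    next
      case (add b b')
      then show ?case using pure(2) Q_add
        by (simp add: pure_add_left)
    qed
  qed (rule Q_add)
qed

lemma tensor_graded_left_module: "graded_left_module C T"
proof (intro graded_left_module.intro graded_left_module_axioms.intro)
  show "graded_ring C" "abelian_group T" by unfold_locales
  show closed: "c \<odot>\<^bsub>T\<^esub> X \<in> carrier T" if "c \<in> carrier C" "X \<in> carrier T" for c X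
    using abelian_group_hom.hom_closed[OF smult_tensor_hom] that by blast
  show smult_add: "c \<odot>\<^bsub>T\<^esub> (X \<oplus>\<^bsub>T\<^esub> Y) = c \<odot>\<^bsub>T\<^esub> X \<oplus>\<^bsub>T\<^esub> c \<odot>\<^bsub>T\<^esub> Y"
    if "c \<in> carrier C" "X \<in> carrier T" "Y \<in> carrier T" for c X Y
    using abelian_group_hom.hom_add[OF smult_tensor_hom] that by blast
  show "(c \<oplus>\<^bsub>C\<^esub> c') \<odot>\<^bsub>T\<^esub> X = c \<odot>\<^bsub>T\<^esub> X \<oplus>\<^bsub>T\<^esub> c' \<odot>\<^bsub>T\<^esub> X"
    if c: "c \<in> carrier C" "c' \<in> carrier C" and "X \<in> carrier T" for c c' X
    using that(3)
  proof (induction rule: tensor_induct)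
    case (pure b m)
    then show ?case using c by (simp add: smult_pure lact_l_distr lact_closed pure_add_left)
  next
    case (add X Y)
    then show ?case using c by (simp add: smult_add closed T.a_ac)
  qed
  show "(c \<otimes>\<^bsub>C\<^esub> c') \<odot>\<^bsub>T\<^esub> X = c \<odot>\<^bsub>T\<^esub> (c' \<odot>\<^bsub>T\<^esub> X)"
    if c: "c \<in> carrier C" "c' \<in> carrier C" and "X \<in> carrier T" for c c' X
    using that(3)
  proof (induction rule: tensor_induct)
    case (pure b m)
    then show ?case using c by (simp add: smult_pure lact_assoc lact_closed)
  next
    case (add X Y)
    then show ?case using c by (simp add: smult_add closed)
  qed
  show "\<one>\<^bsub>C\<^esub> \<odot>\<^bsub>T\<^esub> X = X" if "X \<in> carrier T" for X
    using that
  proof (induction rule: tensor_induct)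
    case (pure b m)
    then show ?case by (simp add: smult_pure lact_one)
  next
    case (add X Y)
    then show ?case by (simp add: smult_add)
  qed
  show "is_grading T (mgrade T)" by (rule tensor_grading)
  show "c \<odot>\<^bsub>T\<^esub> X \<in> mgrade T (i + j)" if c: "c \<in> rgrade C i" and "X \<in> mgrade T j" for c X i j
    using that(2)
  proof (induction rule: tensor_grade_induct)
    case (pure b m k l)
    then show ?case using pure_grade[OF bgrade_lact[OF c pure(1)] pure(2)] c
      by (simp add: smult_pure C.gr.grade_carrier B.gr.grade_carrier M.gr.grade_carrier
          add.assoc)
  next
    case (add X Y)
    then have "X \<in> carrier T" "Y \<in> carrier T"
      using additive_subgroup.a_subset[OF tensor_grade_subgroup] by blast+
    then show ?case using add c
      by (simp add: smult_add C.gr.grade_carrier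
          additive_subgroup.a_closed[OF tensor_grade_subgroup])
  qed
qed

sublocale T: graded_left_module C T by (rule tensor_graded_left_module)

end

section \<open>Tensoring with a graded bimodule as a functor\<close>

lemma gmod_homD:
  assumes "f \<in> gmod_hom A M N"
  shows "x \<in> carrier M \<Longrightarrow> f x \<in> carrier N"
    and "\<lbrakk>x \<in> carrier M; y \<in> carrier M\<rbrakk> \<Longrightarrow> f (x \<oplus>\<^bsub>M\<^esub> y) = f x \<oplus>\<^bsub>N\<^esub> f y"
    and "\<lbrakk>a \<in> carrier A; x \<in> carrier M\<rbrakk> \<Longrightarrow> f (a \<odot>\<^bsub>M\<^esub> x) = a \<odot>\<^bsub>N\<^esub> f x"
    and "x \<in> mgrade M i \<Longrightarrow> f x \<in> mgrade N i"
    and "f \<in> extensional (carrier M)"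
  using assms by (auto simp: gmod_hom_def PiE_def)

lemma gmod_hom_additive:
  assumes "f \<in> gmod_hom A M N" "graded_left_module A' M" "graded_left_module A'' N"
  shows "abelian_group_hom M N f"
proof -
  interpret M: graded_left_module A' M by fact
  interpret N: graded_left_module A'' N by fact
  show ?thesis
    by (rule abelian_group_hom_additiveI)
      (simp_all add: gmod_homD[OF assms(1)] M.M.abelian_group_axioms N.M.abelian_group_axioms)
qed

text \<open>The ring \<open>A'\<close> that makes \<open>M\<close> a module may be larger than the ring \<open>A\<close> of scalars over which
  the map is linear.\<close>

lemma gmod_homI:
  assumes M: "graded_left_module A' M" and f: "abelian_group_hom M N f"
    and act: "\<And>a x. \<lbrakk>a \<in> carrier A; x \<in> carrier M\<rbrakk> \<Longrightarrow> a \<odot>\<^bsub>M\<^esub> x \<in> carrier M"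
      "\<And>a x. \<lbrakk>a \<in> carrier A; x \<in> carrier M\<rbrakk> \<Longrightarrow> f (a \<odot>\<^bsub>M\<^esub> x) = a \<odot>\<^bsub>N\<^esub> f x"
    and deg: "\<And>i x. x \<in> mgrade M i \<Longrightarrow> f x \<in> mgrade N i"
  shows "restrict f (carrier M) \<in> gmod_hom A M N"
proof -
  interpret M: graded_left_module A' M by fact
  interpret f: abelian_group_hom M N f by fact
  show ?thesis
    unfolding gmod_hom_def using act deg M.gr.grade_carrier by auto
qed

lemma gmod_hom_eqI:
  assumes "f \<in> gmod_hom A M N" "g \<in> gmod_hom A' M N'" "\<And>x. x \<in> carrier M \<Longrightarrow> f x = g x"
  shows "f = g"
  using gmod_homD(5)[OF assms(1)] gmod_homD(5)[OF assms(2)] assms(3) by (rule extensionalityI)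

lemma gmod_hom_compose:
  assumes "graded_left_module A' L"
    and "\<And>a x. \<lbrakk>a \<in> carrier A; x \<in> carrier L\<rbrakk> \<Longrightarrow> a \<odot>\<^bsub>L\<^esub> x \<in> carrier L"
    and "f \<in> gmod_hom A L M" "g \<in> gmod_hom A M N"
  shows "compose (carrier L) g f \<in> gmod_hom A L N"
proof -
  interpret L: graded_left_module A' L by fact
  have "\<And>a x. \<lbrakk>a \<in> carrier A; x \<in> carrier L\<rbrakk> \<Longrightarrow> a \<odot>\<^bsub>L\<^esub> x \<in> carrier L" by (rule assms(2))
  then show ?thesis
    using gmod_homD(1-4)[OF assms(3)] gmod_homD(1-4)[OF assms(4)] L.gr.grade_carrier
    by (auto simp: gmod_hom_def compose_def)
qed

lemma (in graded_bimod) tensor_productI: "M \<in> gmod A \<Longrightarrow> tensor_product C A B M"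
  by (simp add: gmod_def tensor_product_def graded_bimod_axioms)

lemma fmap_tensor_functor: "fmap (tensor_functor A B) M N f =
    restrict (tensor_map A B N (\<lambda>b. b) f) (carrier (tensor A B M))"
  by (rule ext) (simp add: tensor_functor_def tensor_map_def restrict_def)

context graded_bimod
begin

lemma
  assumes M: "M \<in> gmod A" and N: "N \<in> gmod A" and f: "f \<in> gmod_hom A M N"
  shows fmap_tensor: "fmap (tensor_functor A B) M N f \<in> gmod_hom C (tensor A B M) (tensor A B N)"
    and fmap_tensor_pure: "\<lbrakk>b \<in> carrier B; m \<in> carrier M\<rbrakk> \<Longrightarrow>
      fmap (tensor_functor A B) M N f (pure_tensor A B M b m) = pure_tensor A B N b (f m)"
proof -
  interpret M: tensor_product C A B M by (rule tensor_productI[OF M])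
  interpret N: tensor_product C A B N by (rule tensor_productI[OF N])
  have idB: "abelian_group_hom B B (\<lambda>b. b)"
    by (rule abelian_group_hom_additiveI) (simp_all add: B.abelian_group_axioms)
  have fh: "abelian_group_hom M N f"
    by (rule gmod_hom_additive[OF f]) unfold_locales
  let ?t = "tensor_map A B N (\<lambda>b. b) f"
  have t: "abelian_group_hom M.T N.T ?t"
    by (rule tensor_map_hom[OF M.tensor_product_axioms N.tensor_product_axioms idB _ fh])
      (simp_all add: gmod_homD[OF f])
  have tp: "?t (M.pure b m) = N.pure b (f m)" if "b \<in> carrier B" "m \<in> carrier M" for b m
    by (rule tensor_map_pure[OF M.tensor_product_axioms N.tensor_product_axioms idB _ fh])
      (simp_all add: gmod_homD[OF f] that)
  interpret t: abelian_group_hom M.T N.T ?t by (rule t)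
  show "fmap (tensor_functor A B) M N f (M.pure b m) = N.pure b (f m)"
    if "b \<in> carrier B" "m \<in> carrier M" using that by (simp add: fmap_tensor_functor tp)
  show "fmap (tensor_functor A B) M N f \<in> gmod_hom C M.T N.T"
    unfolding fmap_tensor_functor
  proof (rule gmod_homI[OF M.tensor_graded_left_module t])
    show "c \<odot>\<^bsub>M.T\<^esub> X \<in> carrier M.T" if "c \<in> carrier C" "X \<in> carrier M.T" for c X
      using that by (rule M.T.act_closed)
    show "?t (c \<odot>\<^bsub>M.T\<^esub> X) = c \<odot>\<^bsub>N.T\<^esub> ?t X" if c: "c \<in> carrier C" and "X \<in> carrier M.T" for c X
      using that(2)
    proof (induction rule: M.tensor_induct)
      case (pure b m)
      then show ?case using c
        by (simp add: M.smult_pure N.smult_pure tp lact_closed gmod_homD[OF f])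
    next
      case (add X Y)
      then show ?case using c by (simp add: M.T.act_r_distr N.T.act_r_distr M.T.act_closed)
    qed
    show "?t X \<in> mgrade N.T n" if "X \<in> mgrade M.T n" for X n
      using that
    proof (induction rule: M.tensor_grade_induct)
      case (pure b m i j)
      then show ?case using N.pure_grade[OF pure(1) gmod_homD(4)[OF f pure(2)]]
        by (simp add: tp B.gr.grade_carrier M.M.gr.grade_carrier)
    next
      case (add X Y)
      then show ?case by (simp add: M.T.gr.grade_carrier N.T.gr.grade_add)
    qed
  qed
qed

theorem tensor_functor_is_functor: "is_functor A C (tensor_functor A B :: ('a, 'm, 'c, _) gfunctor)"
  unfolding is_functor_def
proof (intro conjI ballI)
  have fobj: "fobj (tensor_functor A B) M = tensor A B M" for M :: "('a, 'm) graded_module"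
    by (simp add: tensor_functor_def)
  fix L :: "('a, 'm) graded_module" assume L: "L \<in> gmod A"
  interpret L: tensor_product C A B L by (rule tensor_productI[OF L])
  show "fobj (tensor_functor A B) L \<in> gmod C"
    using L.tensor_graded_left_module by (simp add: fobj gmod_def)
  have id: "gmod_id L \<in> gmod_hom A L L" "gmod_id L.T \<in> gmod_hom C L.T L.T"
    using L.M.gr.grade_carrier L.T.gr.grade_carrier L.M.act_closed L.T.act_closed
    by (auto simp: gmod_id_def gmod_hom_def)
  have "fmap (tensor_functor A B) L L (gmod_id L) = gmod_id L.T"
  proof (rule gmod_hom_eqI[OF fmap_tensor[OF L L id(1)] id(2)])
    fix X assume X: "X \<in> carrier L.T"
    show "fmap (tensor_functor A B) L L (gmod_id L) X = gmod_id L.T X"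
      by (rule L.tensor_hom_eqI[OF gmod_hom_additive[OF fmap_tensor[OF L L id(1)]]
            gmod_hom_additive[OF id(2)] _ X])
        (use L.tensor_graded_left_module in \<open>simp_all add: fmap_tensor_pure[OF L L id(1), unfolded gmod_id_def] gmod_id_def\<close>)
  qed
  then show "fmap (tensor_functor A B) L L (gmod_id L) = gmod_id (fobj (tensor_functor A B) L)"
    by (simp add: fobj)
  fix M :: "('a, 'm) graded_module" assume M: "M \<in> gmod A"
  interpret M: tensor_product C A B M by (rule tensor_productI[OF M])
  show "fmap (tensor_functor A B) L M f \<in>
      gmod_hom C (fobj (tensor_functor A B) L) (fobj (tensor_functor A B) M)"
    if "f \<in> gmod_hom A L M" for f
    using fmap_tensor[OF L M that] by (simp add: fobj)
  fix N :: "('a, 'm) graded_module" and f g assume N: "N \<in> gmod A" and f: "f \<in> gmod_hom A L M" and g: "g \<in> gmod_hom A M N"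
  interpret N: tensor_product C A B N by (rule tensor_productI[OF N])
  have gf: "compose (carrier L) g f \<in> gmod_hom A L N"
    by (rule gmod_hom_compose[OF L.M.graded_left_module_axioms L.M.act_closed f g])
  have tgf: "compose (carrier L.T) (fmap (tensor_functor A B) M N g) (fmap (tensor_functor A B) L M f)
      \<in> gmod_hom C L.T N.T"
    by (rule gmod_hom_compose[OF L.tensor_graded_left_module L.T.act_closed
          fmap_tensor[OF L M f] fmap_tensor[OF M N g]])
  have "fmap (tensor_functor A B) L N (compose (carrier L) g f) =
      compose (carrier L.T) (fmap (tensor_functor A B) M N g) (fmap (tensor_functor A B) L M f)"
  proof (rule gmod_hom_eqI[OF fmap_tensor[OF L N gf] tgf])
    fix X assume X: "X \<in> carrier L.T"
    show "fmap (tensor_functor A B) L N (compose (carrier L) g f) X =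
        compose (carrier L.T) (fmap (tensor_functor A B) M N g) (fmap (tensor_functor A B) L M f) X"
      by (rule L.tensor_hom_eqI[OF gmod_hom_additive[OF fmap_tensor[OF L N gf]]
            gmod_hom_additive[OF tgf] _ X])
        (use L.tensor_graded_left_module N.tensor_graded_left_module gmod_homD(1)[OF f] in
          \<open>simp_all add: fmap_tensor_pure[OF L N gf] fmap_tensor_pure[OF L M f]
            fmap_tensor_pure[OF M N g] compose_eq\<close>)
  qed
  then show "fmap (tensor_functor A B) L N (compose (carrier L) g f) =
      compose (carrier (fobj (tensor_functor A B) L)) (fmap (tensor_functor A B) M N g)
        (fmap (tensor_functor A B) L M f)"
    by (simp add: fobj)
qed

end

lemma is_functor_fcomp:
  assumes F: "is_functor A B F" and G: "is_functor B C G"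
  shows "is_functor A C (G \<circ>\<^sub>F F)"
  using F G unfolding is_functor_def fcomp_def by simp

lemma shift_graded_left_module:
  assumes "graded_left_module A M"
  shows "graded_left_module A (M\<lparr>mgrade := \<lambda>i. mgrade M (i + d)\<rparr>)"
proof -
  interpret M: graded_left_module A M by fact
  let ?M = "M\<lparr>mgrade := \<lambda>i. mgrade M (i + d)\<rparr>"
  have grading: "is_grading M (\<lambda>i. mgrade M (i + d))"
  proof (rule is_gradingI[where p = "\<lambda>i. homog_part M (mgrade M) (i + d)"])
    fix x Q assume x: "x \<in> carrier M" and homog: "\<And>i y. y \<in> mgrade M (i + d) \<Longrightarrow> Q y"
      and add: "\<And>y z. \<lbrakk>y \<in> carrier M; z \<in> carrier M; Q y; Q z\<rbrakk> \<Longrightarrow> Q (y \<oplus>\<^bsub>M\<^esub> z)"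
    show "Q x" using x
    proof (induction rule: M.gr.graded_induct)
      case (homogeneous i y)
      then show ?case using homog[of y "i - d"] by simp
    qed (rule add)
  qed (auto simp: M.M.abelian_group_axioms M.gr.additive_subgroup_grade M.gr.homog_part_hom
      M.gr.homog_part_homog)
  show ?thesis
  proof (intro graded_left_module.intro graded_left_module_axioms.intro)
    show "graded_ring A" by unfold_locales
    show "abelian_group ?M"
      by (rule abelian_group_cong[OF M.M.abelian_group_axioms]) simp_all
    show "is_grading ?M (mgrade ?M)"
      using grading is_grading_cong[of ?M M] by simp
    show "a \<odot>\<^bsub>?M\<^esub> x \<in> mgrade ?M (i + j)" if "a \<in> rgrade A i" "x \<in> mgrade ?M j" for a x i j
      using M.mgrade_act[of a i x "j + d"] that by (simp add: add.assoc)
  qed (simp_all add: M.act_closed M.act_l_distr M.act_r_distr M.act_assoc M.act_one)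
qed

lemma shift_functor_is_functor: "is_functor A A (shift_functor d)"
  unfolding is_functor_def
  by (auto simp: shift_functor_def gmod_def shift_graded_left_module gmod_hom_def gmod_id_def)

section \<open>Induction is left adjoint to restriction\<close>

lemma regular_bimodule_simps [simp]:
  "carrier (regular_bimodule R) = carrier R" "add (regular_bimodule R) = add R"
  "\<zero>\<^bsub>regular_bimodule R\<^esub> = \<zero>\<^bsub>R\<^esub>" "mgrade (regular_bimodule R) = rgrade R"
  "smult (regular_bimodule R) = monoid.mult R" "rsmult (regular_bimodule R) = monoid.mult R"
  by (simp_all add: regular_bimodule_def)

locale graded_subring = R: graded_ring R + A: graded_ring A
  for R A :: "'a graded_ring" +
  assumes subring_carrier: "carrier A \<subseteq> carrier R"
    and subring_ops: "monoid.mult A = monoid.mult R" "add A = add R" "\<one>\<^bsub>A\<^esub> = \<one>\<^bsub>R\<^esub>"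
    and subring_grade: "rgrade A i \<subseteq> rgrade R i"
begin

lemma subringD: "a \<in> carrier A \<Longrightarrow> a \<in> carrier R"
  using subring_carrier by blast

text \<open>For the identity \<open>t\<close> this is the bimodule of the induction functor, for \<open>t = s\<close> and \<open>A = R\<close> it is the
  transposition bimodule.\<close>

lemma twisted_bimod:
  assumes t: "t \<in> ring_hom R R" and t_grade: "\<And>i f. f \<in> rgrade R i \<Longrightarrow> t f \<in> rgrade R i"
  shows "graded_bimod R A ((regular_bimodule R)\<lparr>smult := \<lambda>f r. t f \<otimes>\<^bsub>R\<^esub> r\<rparr>)" (is "graded_bimod R A ?B")
proof (intro graded_bimod.intro graded_bimod_axioms.intro)
  note [simp] = subring_ops subringD ring_hom_closed[OF t] ring_hom_add[OF t]
    ring_hom_mult[OF t] ring_hom_one[OF t] R.l_distr R.r_distr R.m_assoc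
  show "graded_ring R" "graded_ring A" by unfold_locales
  show "abelian_group ?B" by (rule abelian_group_cong[OF R.abelian_group_axioms]) simp_all
  show "is_grading ?B (mgrade ?B)"
    using is_grading_cong[of ?B R] by (simp add: R.rgrade_grading)
  show "c \<odot>\<^bsub>?B\<^esub> b \<in> mgrade ?B (i + j)" if "c \<in> rgrade R i" "b \<in> mgrade ?B j" for b c i j
    using R.rgrade_mult[OF t_grade] that by simp
  show "rsmult ?B b a \<in> mgrade ?B (i + j)" if "b \<in> mgrade ?B i" "a \<in> rgrade A j" for a b i j
    using R.rgrade_mult[of b i a j] subring_grade that by auto
qed (simp_all add: subring_ops subringD ring_hom_closed[OF t] ring_hom_add[OF t]
    ring_hom_mult[OF t] ring_hom_one[OF t] R.l_distr R.r_distr R.m_assoc)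

lemma regular_bimod: "graded_bimod R A (regular_bimodule R)"
proof -
  have "graded_bimod R A ((regular_bimodule R)\<lparr>smult := monoid.mult R\<rparr>)"
    using twisted_bimod[of "\<lambda>f. f"] by (simp add: ring_hom_def)
  moreover have "(regular_bimodule R)\<lparr>smult := monoid.mult R\<rparr> = regular_bimodule R"
    by (simp add: regular_bimodule_def)
  ultimately show ?thesis by (simp only:)
qed

lemma restrict_module: "M \<in> gmod R \<Longrightarrow> M \<in> gmod A"
proof -
  assume "M \<in> gmod R"
  then interpret M: graded_left_module R M by (simp add: gmod_def)
  have "graded_left_module A M"
    by (intro graded_left_module.intro graded_left_module_axioms.intro)
      (auto simp: M.M.abelian_group_axioms A.graded_ring_axioms M.act_closed M.act_l_distr
        M.act_r_distr M.act_assoc M.act_one M.mgrade_grading subring_ops subringD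
        intro!: M.mgrade_act subsetD[OF subring_grade])
  then show ?thesis by (simp add: gmod_def)
qed

lemma restrict_hom: "f \<in> gmod_hom R M N \<Longrightarrow> f \<in> gmod_hom A M N"
  by (auto simp: gmod_hom_def subringD)

lemma restriction_is_functor: "is_functor R A F_down"
  unfolding is_functor_def by (simp add: F_down_def restrict_module restrict_hom)

lemma induction_is_functor: "is_functor A R (tensor_functor A (regular_bimodule R))"
  by (rule graded_bimod.tensor_functor_is_functor[OF regular_bimod])

lemma induction_restrict:
  fixes M :: "('a, 'm) graded_module" and N :: "('a, 'n) graded_module"
  assumes M: "M \<in> gmod A" and N: "N \<in> gmod R"
    and h: "h \<in> gmod_hom R (tensor A (regular_bimodule R) M) N"
  shows "(\<lambda>m\<in>carrier M. h (pure_tensor A (regular_bimodule R) M \<one>\<^bsub>R\<^esub> m)) \<in> gmod_hom A M N"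
proof -
  interpret B: graded_bimod R A "regular_bimodule R" by (rule regular_bimod)
  interpret M: tensor_product R A "regular_bimodule R" M by (rule B.tensor_productI[OF M])
  interpret N: graded_left_module R N using N by (simp add: gmod_def)
  let ?f = "\<lambda>m. h (M.pure \<one>\<^bsub>R\<^esub> m)"
  show ?thesis
  proof (rule gmod_homI)
    show "graded_left_module A M" by unfold_locales
    show "abelian_group_hom M N ?f"
      by (rule abelian_group_hom_additiveI)
        (simp_all add: M.M.M.abelian_group_axioms N.M.abelian_group_axioms M.pure_add_right gmod_homD[OF h])
    show "a \<odot>\<^bsub>M\<^esub> m \<in> carrier M" if "a \<in> carrier A" "m \<in> carrier M" for a m
      using that by (rule M.M.act_closed)
    show "?f (a \<odot>\<^bsub>M\<^esub> m) = a \<odot>\<^bsub>N\<^esub> ?f m" if am: "a \<in> carrier A" "m \<in> carrier M" for a m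
    proof -
      have "M.pure \<one>\<^bsub>R\<^esub> (a \<odot>\<^bsub>M\<^esub> m) = a \<odot>\<^bsub>M.T\<^esub> M.pure \<one>\<^bsub>R\<^esub> m"
        using M.pure_act[of "\<one>\<^bsub>R\<^esub>" a m] M.smult_pure[of a "\<one>\<^bsub>R\<^esub>" m] am by (simp add: subringD)
      then show ?thesis using am by (simp add: gmod_homD(3)[OF h] subringD)
    qed
    show "?f m \<in> mgrade N i" if m: "m \<in> mgrade M i" for m i
      using M.pure_grade[of "\<one>\<^bsub>R\<^esub>" 0 m i] m by (simp add: R.rgrade_one gmod_homD(4)[OF h])
  qed
qed

lemma induction_extend:
  fixes M :: "('a, 'm) graded_module" and N :: "('a, 'n) graded_module"
  assumes M: "M \<in> gmod A" and N: "N \<in> gmod R" and f: "f \<in> gmod_hom A M N"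
  shows "\<exists>h\<in>gmod_hom R (tensor A (regular_bimodule R) M) N.
    \<forall>r\<in>carrier R. \<forall>m\<in>carrier M. h (pure_tensor A (regular_bimodule R) M r m) = r \<odot>\<^bsub>N\<^esub> f m"
proof -
  interpret B: graded_bimod R A "regular_bimodule R" by (rule regular_bimod)
  interpret M: tensor_product R A "regular_bimodule R" M by (rule B.tensor_productI[OF M])
  interpret N: graded_left_module R N using N by (simp add: gmod_def)
  have bal: "balanced A (regular_bimodule R) M N (\<lambda>r m. r \<odot>\<^bsub>N\<^esub> f m)"
    unfolding balanced_def
    by (simp add: gmod_homD[OF f] N.act_closed N.act_l_distr N.act_r_distr N.act_assoc subringD)
  let ?h = "tensor_lift A (regular_bimodule R) M N (\<lambda>r m. r \<odot>\<^bsub>N\<^esub> f m)"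
  note lp = M.tensor_lift_pure[OF N.M.abelian_group_axioms bal, simplified]
  interpret h: abelian_group_hom M.T N ?h
    by (rule M.tensor_lift_hom[OF N.M.abelian_group_axioms bal])
  have "restrict ?h (carrier M.T) \<in> gmod_hom R M.T N"
  proof (rule gmod_homI[OF M.tensor_graded_left_module h.abelian_group_hom_axioms M.T.act_closed])
    show "?h (c \<odot>\<^bsub>M.T\<^esub> X) = c \<odot>\<^bsub>N\<^esub> ?h X" if c: "c \<in> carrier R" and "X \<in> carrier M.T" for c X
      using that(2)
    proof (induction rule: M.tensor_induct)
      case (pure b m)
      then show ?case using c
        by (simp add: M.smult_pure lp N.act_assoc gmod_homD[OF f])
    next
      case (add X Y)
      then show ?case using c by (simp add: M.T.act_r_distr N.act_r_distr M.T.act_closed)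
    qed
    show "?h X \<in> mgrade N n" if "X \<in> mgrade M.T n" for X n
      using that
    proof (induction rule: M.tensor_grade_induct)
      case (pure b m i j)
      then show ?case using N.mgrade_act[of b i "f m" j] gmod_homD(4)[OF f pure(2)]
        by (simp add: lp R.gr.grade_carrier M.M.gr.grade_carrier)
    next
      case (add X Y)
      then show ?case by (simp add: M.T.gr.grade_carrier N.gr.grade_add)
    qed
  qed
  then show ?thesis by (rule bexI[rotated]) (simp add: lp)
qed

theorem induction_restriction_adjoint:
  "adjoint_pair A R (tensor_functor A (regular_bimodule R) :: ('a, 'm, 'a, _) gfunctor)
     (F_down :: ('a, 'n, 'a, 'n) gfunctor)"
proof -
  interpret B: graded_bimod R A "regular_bimodule R" by (rule regular_bimod)
  let ?T = "tensor A (regular_bimodule R)"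
  let ?p = "pure_tensor A (regular_bimodule R)"
  let ?\<Phi> = "\<lambda>(M :: ('a, 'm) graded_module) (N :: ('a, 'n) graded_module) h. \<lambda>m\<in>carrier M. h (?p M \<one>\<^bsub>R\<^esub> m)"
  have fobj: "fobj (tensor_functor A (regular_bimodule R)) M = ?T M" for M :: "('a, 'm) graded_module"
    by (simp add: tensor_functor_def)
  have carrier_B: "carrier (regular_bimodule R) = carrier R"
    by (simp add: regular_bimodule_def)
  have bij: "bij_betw (?\<Phi> M N) (gmod_hom R (?T M) N) (gmod_hom A M N)"
    if M: "M \<in> gmod A" and N: "N \<in> gmod R"
    for M :: "('a, 'm) graded_module" and N :: "('a, 'n) graded_module"
  proof (rule bij_betwI')
    interpret M: tensor_product R A "regular_bimodule R" M by (rule B.tensor_productI[OF M])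
    interpret N: graded_left_module R N using N by (simp add: gmod_def)
    fix h k assume h: "h \<in> gmod_hom R (?T M) N" and k: "k \<in> gmod_hom R (?T M) N"
    show "?\<Phi> M N h \<in> gmod_hom A M N" by (rule induction_restrict[OF M N h])
    have val: "h (M.pure r m) = r \<odot>\<^bsub>N\<^esub> ?\<Phi> M N h m"
      if "r \<in> carrier R" "m \<in> carrier M" "h \<in> gmod_hom R (?T M) N" for r m h
      using gmod_homD(3)[OF that(3), of r "M.pure \<one>\<^bsub>R\<^esub> m"] M.smult_pure[of r "\<one>\<^bsub>R\<^esub>" m] that
      by simp
    show "?\<Phi> M N h = ?\<Phi> M N k \<longleftrightarrow> h = k"
    proof
      assume eq: "?\<Phi> M N h = ?\<Phi> M N k"
      show "h = k"
      proof (rule gmod_hom_eqI[OF h k])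
        fix X assume X: "X \<in> carrier M.T"
        show "h X = k X"
          by (rule M.tensor_hom_eqI[OF gmod_hom_additive[OF h M.tensor_graded_left_module
                  N.graded_left_module_axioms] gmod_hom_additive[OF k M.tensor_graded_left_module
                  N.graded_left_module_axioms] _ X])
            (simp only: val[OF _ _ h] val[OF _ _ k] carrier_B eq)
      qed
    qed simp
  next
    fix f assume f: "f \<in> gmod_hom A M N"
    interpret N: graded_left_module R N using N by (simp add: gmod_def)
    obtain h where h: "h \<in> gmod_hom R (?T M) N"
      and hp: "\<And>r m. \<lbrakk>r \<in> carrier R; m \<in> carrier M\<rbrakk> \<Longrightarrow> h (?p M r m) = r \<odot>\<^bsub>N\<^esub> f m"
      using induction_extend[OF M N f] by blast
    have "f = ?\<Phi> M N h"
      by (rule gmod_hom_eqI[OF f induction_restrict[OF M N h]])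
        (simp add: hp N.act_one gmod_homD[OF f])
    then show "\<exists>h\<in>gmod_hom R (?T M) N. f = ?\<Phi> M N h" using h by blast
  qed
  have nat: "?\<Phi> M' N' (compose (carrier (?T M')) g (compose (carrier (?T M')) h
        (fmap (tensor_functor A (regular_bimodule R)) M' M f))) =
      compose (carrier M') g (compose (carrier M') (?\<Phi> M N h) f)"
    if M: "M \<in> gmod A" and M': "M' \<in> gmod A" and f: "f \<in> gmod_hom A M' M"
    for M M' :: "('a, 'm) graded_module" and N N' :: "('a, 'n) graded_module" and f g h
  proof -
    interpret M': tensor_product R A "regular_bimodule R" M' by (rule B.tensor_productI[OF M'])
    show ?thesis
      by (rule ext)
        (simp add: compose_def restrict_def B.fmap_tensor_pure[OF M' M f] carrier_B gmod_homD[OF f])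
  qed
  show ?thesis
    unfolding adjoint_pair_def
    using induction_is_functor restriction_is_functor bij nat
    by (intro conjI exI[of _ ?\<Phi>]) (auto simp: fobj F_down_def)
qed

end

section \<open>Rings with an odd Demazure operator\<close>

text \<open>What the second adjunction uses about odd polynomials, without reference to their construction.\<close>

locale demazure_ring = R: graded_ring R
  for R :: "'a graded_ring" (structure) +
  fixes s D :: "'a \<Rightarrow> 'a" and x1 x2 :: 'a
  assumes s_hom: "s \<in> ring_hom R R"
    and s_s: "f \<in> carrier R \<Longrightarrow> s (s f) = f"
    and s_grade: "f \<in> rgrade R i \<Longrightarrow> s f \<in> rgrade R i"
    and D_closed [simp]: "f \<in> carrier R \<Longrightarrow> D f \<in> carrier R"
    and D_add: "\<lbrakk>f \<in> carrier R; g \<in> carrier R\<rbrakk> \<Longrightarrow> D (f \<oplus> g) = D f \<oplus> D g"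
    and D_mult: "\<lbrakk>f \<in> carrier R; g \<in> carrier R\<rbrakk> \<Longrightarrow> D (f \<otimes> g) = D f \<otimes> g \<oplus> s f \<otimes> D g"
    and D_one: "D \<one> = \<zero>"
    and D_D: "f \<in> carrier R \<Longrightarrow> D (D f) = \<zero>"
    and D_s: "f \<in> carrier R \<Longrightarrow> D (s f) = \<ominus> s (D f)"
    and D_grade: "f \<in> rgrade R i \<Longrightarrow> D f \<in> rgrade R (i - 2)"
    and x1_grade: "x1 \<in> rgrade R 2" and x2_grade: "x2 \<in> rgrade R 2"
    and s_x1: "s x1 = \<ominus> x2"
    and D_x1: "D x1 = \<one>" and D_x2: "D x2 = \<one>"
begin

sublocale s: ring_hom_ring R R s
  by (rule ring_hom_ringI2[OF R.ring_axioms R.ring_axioms s_hom])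

sublocale D: abelian_group_hom R R D
  by (rule abelian_group_hom_additiveI) (simp_all add: D_add R.abelian_group_axioms)

lemma x1_closed [simp]: "x1 \<in> carrier R" and x2_closed [simp]: "x2 \<in> carrier R"
  using x1_grade x2_grade by (simp_all add: R.gr.grade_carrier)

lemma s_x2: "s x2 = \<ominus> x1"
proof -
  have "x1 = s (\<ominus> x2)" using s_s[of x1] by (simp add: s_x1)
  then show ?thesis by simp
qed

definition invariants :: "'a graded_ring" where
  "invariants = R\<lparr>carrier := a_kernel R R D, rgrade := \<lambda>n. rgrade R n \<inter> a_kernel R R D\<rparr>"

lemma mem_kernel_D: "a \<in> a_kernel R R D \<longleftrightarrow> a \<in> carrier R \<and> D a = \<zero>"
  unfolding a_kernel_def' by (rule mem_Collect_eq)

lemma invariants_simps [simp]: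
  "a \<in> carrier invariants \<longleftrightarrow> a \<in> carrier R \<and> D a = \<zero>"
  "monoid.mult invariants = monoid.mult R" "add invariants = add R"
  "\<one>\<^bsub>invariants\<^esub> = \<one>" "\<zero>\<^bsub>invariants\<^esub> = \<zero>"
  "a \<in> rgrade invariants i \<longleftrightarrow> a \<in> rgrade R i \<and> D a = \<zero>"
  unfolding invariants_def using R.gr.grade_carrier[of a i] by (auto simp: mem_kernel_D)

lemma homog_part_D:
  assumes f: "f \<in> carrier R"
  shows "D (homog_part R (rgrade R) i f) = homog_part R (rgrade R) (i - 2) (D f)"
proof -
  have deg: "D g \<in> rgrade R (i + - 2)" if "g \<in> rgrade R i" for i g
    using D_grade[OF that] by simp
  have "D (homog_part R (rgrade R) i f) = homog_part R (rgrade R) (i + - 2) (D f)"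
    by (rule homog_part_map[OF R.gr.graded_group_axioms R.gr.graded_group_axioms
          D.abelian_group_hom_axioms deg f])
  then show ?thesis by simp
qed

lemma invariants_ring: "ring invariants"
proof (rule ringI)
  show "abelian_group invariants"
  proof (rule abelian_groupI)
    fix a assume "a \<in> carrier invariants"
    then show "\<exists>b\<in>carrier invariants. b \<oplus>\<^bsub>invariants\<^esub> a = \<zero>\<^bsub>invariants\<^esub>"
      by (intro bexI[of _ "\<ominus> a"]) (auto simp: R.l_neg)
  qed (auto simp: R.a_ac)
  show "monoid invariants"
    by (rule monoidI) (auto simp: D_mult D_one R.m_assoc)
qed (auto simp: R.l_distr R.r_distr)

lemma invariants_abelian: "abelian_group invariants"
  using invariants_ring by (simp add: ring_def)

text \<open>Since \<open>D\<close> is homogeneous, the parts of an invariant are invariant, so the projections of \<open>R\<close>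
  restrict to the invariants.\<close>

lemma invariants_graded_ring: "graded_ring invariants"
proof (intro graded_ring.intro graded_ring_axioms.intro invariants_ring)
  interpret S: abelian_group invariants by (rule invariants_abelian)
  have part: "homog_part R (rgrade R) i f \<in> carrier invariants" if "f \<in> carrier invariants" for i f
    using that homog_part_D[of f i] R.gr.homog_part_zero by simp
  show "is_grading invariants (rgrade invariants)"
  proof (rule is_gradingI[where p = "homog_part R (rgrade R)"])
    show "abelian_group_hom invariants invariants (homog_part R (rgrade R) i)" for i
    proof (rule abelian_group_hom_additiveI[OF invariants_abelian invariants_abelian])
      show "homog_part R (rgrade R) i (f \<oplus>\<^bsub>invariants\<^esub> g) =
          homog_part R (rgrade R) i f \<oplus>\<^bsub>invariants\<^esub> homog_part R (rgrade R) i g"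
        if "f \<in> carrier invariants" "g \<in> carrier invariants" for f g
        using that by (simp add: R.gr.homog_part_add)
    qed (rule part)
    show "homog_part R (rgrade R) i f = (if i = j then f else \<zero>\<^bsub>invariants\<^esub>)"
      if "f \<in> rgrade invariants j" for i j f
      using that R.gr.homog_part_homog[of f j i] by simp
    have neg: "\<ominus>\<^bsub>invariants\<^esub> f = \<ominus> f" if "f \<in> carrier invariants" for f
      using that by (intro S.minus_equality) (auto simp: R.l_neg)
    show "additive_subgroup (rgrade invariants i) invariants" for i
    proof (rule S.additive_subgroup_closedI)
      show "rgrade invariants i \<subseteq> carrier invariants"
        using R.gr.grade_carrier[of _ i] by auto
      show "\<ominus>\<^bsub>invariants\<^esub> f \<in> rgrade invariants i" if "f \<in> rgrade invariants i" for f
        using that R.gr.grade_carrier[of f i] R.gr.grade_neg[of f i] by (simp add: neg)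
      show "f \<oplus>\<^bsub>invariants\<^esub> g \<in> rgrade invariants i"
        if "f \<in> rgrade invariants i" "g \<in> rgrade invariants i" for f g
        using that R.gr.grade_carrier[of _ i] R.gr.grade_add[of f i g] by simp
    qed simp
    fix f Q assume f: "f \<in> carrier invariants"
      and homog: "\<And>i g. g \<in> rgrade invariants i \<Longrightarrow> Q g"
      and add: "\<And>g h. \<lbrakk>g \<in> carrier invariants; h \<in> carrier invariants; Q g; Q h\<rbrakk>
        \<Longrightarrow> Q (g \<oplus>\<^bsub>invariants\<^esub> h)"
    have fR: "f \<in> carrier R" using f by simp
    let ?sum = "\<lambda>I. finsum R (\<lambda>i. homog_part R (rgrade R) i f) I"
    have "?sum I \<in> carrier invariants \<and> Q (?sum I)" if "finite I" for I
      using that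
    proof (induction I)
      case empty
      then show ?case using homog[of \<zero> 0] by simp
    next
      case (insert j I)
      have "Q (homog_part R (rgrade R) j f)"
        using homog[of "homog_part R (rgrade R) j f" j] part[OF f, of j] R.gr.homog_part_grade[OF fR] by simp
      then show ?case
        using insert part[OF f, of j] add[of "homog_part R (rgrade R) j f" "?sum I"] fR
        by (simp add: R.finsum_insert Pi_def)
    qed
    then show "Q f"
      using R.gr.sum_homog_parts[OF fR] R.gr.finite_homog_support[OF fR] by metis
  qed (rule invariants_abelian)
  show "f \<otimes>\<^bsub>invariants\<^esub> g \<in> rgrade invariants (i + j)"
    if "f \<in> rgrade invariants i" "g \<in> rgrade invariants j" for f g i j
    using that R.gr.grade_carrier[of f i] R.gr.grade_carrier[of g j] R.rgrade_mult[of f i g j]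
    by (simp add: D_mult)
qed (simp add: R.rgrade_one D_one)

sublocale S: graded_ring invariants by (rule invariants_graded_ring)

sublocale Sub: graded_subring R invariants
  by unfold_locales auto

sublocale Whole: graded_subring R R
  by unfold_locales auto

lemma transposition_bimodule_simps [simp]:
  "carrier (transposition_bimodule R s) = carrier R" "add (transposition_bimodule R s) = add R"
  "\<zero>\<^bsub>transposition_bimodule R s\<^esub> = \<zero>" "mgrade (transposition_bimodule R s) = rgrade R"
  "f \<odot>\<^bsub>transposition_bimodule R s\<^esub> g = s f \<otimes> g" "rsmult (transposition_bimodule R s) = monoid.mult R"
  by (simp_all add: transposition_bimodule_def)

sublocale up: graded_bimod R invariants "regular_bimodule R"
  by (rule Sub.regular_bimod)

sublocale minus: graded_bimod R R "transposition_bimodule R s"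
  unfolding transposition_bimodule_def by (rule Whole.twisted_bimod[OF s_hom s_grade])

text \<open>This is the Leibniz rule for \<open>D (x1 \<otimes> f)\<close>, solved for \<open>f\<close>. Both \<open>D (x1 \<otimes> f)\<close> and \<open>D f\<close> are
  invariant, so \<open>1\<close> and \<open>x2\<close> generate the ring as a right module over the invariants.\<close>

lemma demazure_basis: "f \<in> carrier R \<Longrightarrow> f = D (x1 \<otimes> f) \<oplus> x2 \<otimes> D f"
  by (simp add: D_mult D_x1 s_x1 R.l_minus R.a_assoc R.l_neg)

lemma D_right_linear: "\<lbrakk>f \<in> carrier R; a \<in> carrier invariants\<rbrakk> \<Longrightarrow> D (f \<otimes> a) = D f \<otimes> a"
  by (simp add: D_mult)

text \<open>\<open>D\<close> is only twisted linear on the left; the twist of the transposition bimodule cancels this one.\<close>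

lemma D_left_twisted_linear:
  "\<lbrakk>a \<in> carrier invariants; f \<in> carrier R\<rbrakk> \<Longrightarrow> D (s a \<otimes> f) = a \<otimes> D f"
  by (simp add: D_mult D_s s_s)

end

section \<open>Restriction is left adjoint to twisted induction\<close>

locale demazure_module = demazure_ring R s D x1 x2 + N: graded_left_module "demazure_ring.invariants R D" N
  for R :: "'a graded_ring" (structure) and s D x1 x2 and N :: "('a, 'n) graded_module"
begin

abbreviation "up_N \<equiv> tensor invariants (regular_bimodule R) N"
abbreviation "up_pure \<equiv> pure_tensor invariants (regular_bimodule R) N"
abbreviation "min_N \<equiv> tensor R (transposition_bimodule R s) up_N"
abbreviation "min_pure \<equiv> pure_tensor R (transposition_bimodule R s) up_N"

sublocale U: tensor_product R invariants "regular_bimodule R" N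
  by (intro tensor_product.intro up.graded_bimod_axioms N.graded_left_module_axioms)

sublocale V: tensor_product R R "transposition_bimodule R s" up_N
  by (intro tensor_product.intro minus.graded_bimod_axioms U.tensor_graded_left_module)

text \<open>The element of the induced module with coordinates \<open>\<alpha>\<close> and \<open>\<beta>\<close> in the basis \<open>1, x2\<close>.\<close>

definition coords :: "'n \<Rightarrow> 'n \<Rightarrow> (('a \<times> 'n) \<Rightarrow>\<^sub>0 int) set" where
  "coords \<alpha> \<beta> = up_pure \<one> \<alpha> \<oplus>\<^bsub>up_N\<^esub> up_pure x2 \<beta>"

lemma coords_closed [simp]: "\<lbrakk>\<alpha> \<in> carrier N; \<beta> \<in> carrier N\<rbrakk> \<Longrightarrow> coords \<alpha> \<beta> \<in> carrier up_N"
  by (simp add: coords_def)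

lemma coords_add:
  "\<lbrakk>\<alpha> \<in> carrier N; \<beta> \<in> carrier N; \<alpha>' \<in> carrier N; \<beta>' \<in> carrier N\<rbrakk>
    \<Longrightarrow> coords \<alpha> \<beta> \<oplus>\<^bsub>up_N\<^esub> coords \<alpha>' \<beta>' = coords (\<alpha> \<oplus>\<^bsub>N\<^esub> \<alpha>') (\<beta> \<oplus>\<^bsub>N\<^esub> \<beta>')"
  by (simp add: coords_def U.pure_add_right U.T.a_ac)

lemma pure_coords:
  assumes "r \<in> carrier R" "n \<in> carrier N"
  shows "up_pure r n = coords (D (x1 \<otimes> r) \<odot>\<^bsub>N\<^esub> n) (D r \<odot>\<^bsub>N\<^esub> n)"
proof -
  have "up_pure r n = up_pure (D (x1 \<otimes> r)) n \<oplus>\<^bsub>up_N\<^esub> up_pure (x2 \<otimes> D r) n"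
    using assms U.pure_add_left[of "D (x1 \<otimes> r)" "x2 \<otimes> D r" n] demazure_basis[of r] by simp
  then show ?thesis
    using U.pure_act[of \<one> "D (x1 \<otimes> r)" n] U.pure_act[of x2 "D r" n] assms
    by (simp add: coords_def D_D)
qed

lemma coords_surj:
  assumes "X \<in> carrier up_N" obtains \<alpha> \<beta> where "\<alpha> \<in> carrier N" "\<beta> \<in> carrier N" "X = coords \<alpha> \<beta>"
proof -
  have "\<exists>\<alpha>\<in>carrier N. \<exists>\<beta>\<in>carrier N. X = coords \<alpha> \<beta>" using assms
  proof (induction rule: U.tensor_induct)
    case (pure b m)
    then have "b \<in> carrier R" by simp
    with pure show ?case
      using pure_coords[of b m] N.act_closed[of "D (x1 \<otimes> b)" m] N.act_closed[of "D b" m]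
      by (auto simp: D_D)
  next
    case (add X Y)
    then show ?case using coords_add N.M.a_closed by metis
  qed
  then show thesis using that by blast
qed

lemma smult_min_pure:
  assumes "f \<in> carrier R" "X \<in> carrier up_N"
  shows "f \<odot>\<^bsub>min_N\<^esub> min_pure \<one> X = min_pure \<one> (s f \<odot>\<^bsub>up_N\<^esub> X)"
  using V.smult_pure[of f \<one> X] V.pure_act[of \<one> "s f" X] assms by simp

lemma min_pure_surj:
  assumes "Y \<in> carrier min_N" obtains X where "X \<in> carrier up_N" "Y = min_pure \<one> X"
proof -
  have "\<exists>X\<in>carrier up_N. Y = min_pure \<one> X" using assms
  proof (induction rule: V.tensor_induct)
    case (pure r X)
    then show ?case using V.pure_act[of \<one> r X] U.T.act_closed[of r X] by auto
  next
    case (add X Y)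
    then show ?case using V.pure_add_right[of \<one>] U.T.a_closed by fastforce
  qed
  then show thesis using that by blast
qed

text \<open>The counit without the factor \<open>u\<close>. It is only semilinear: it turns \<open>s(a)\<close> into \<open>a\<close>.\<close>

definition demazure_map :: "(('a \<times> 'n) \<Rightarrow>\<^sub>0 int) set \<Rightarrow> 'n" where
  "demazure_map = tensor_lift invariants (regular_bimodule R) N N (\<lambda>r n. D r \<odot>\<^bsub>N\<^esub> n)"

definition counit where
  "counit = tensor_lift R (transposition_bimodule R s) up_N N (\<lambda>r X. demazure_map (r \<odot>\<^bsub>up_N\<^esub> X))"

lemma demazure_balanced: "balanced invariants (regular_bimodule R) N N (\<lambda>r n. D r \<odot>\<^bsub>N\<^esub> n)"
  unfolding balanced_def using N.act_closed N.act_l_distr N.act_r_distr N.act_assoc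
  by (simp add: D_D D_add D_right_linear)

sublocale dm: abelian_group_hom up_N N demazure_map
  unfolding demazure_map_def
  by (rule U.tensor_lift_hom[OF N.M.abelian_group_axioms demazure_balanced])

lemma demazure_map_pure: "\<lbrakk>r \<in> carrier R; n \<in> carrier N\<rbrakk> \<Longrightarrow> demazure_map (up_pure r n) = D r \<odot>\<^bsub>N\<^esub> n"
  unfolding demazure_map_def
  using U.tensor_lift_pure[OF N.M.abelian_group_axioms demazure_balanced] by simp

text \<open>The counit reads off the second coordinate. By the next lemma it also detects the first one, after
  multiplication by \<open>- x1 = s(x2)\<close>.\<close>

lemma demazure_map_coords:
  "\<lbrakk>\<alpha> \<in> carrier N; \<beta> \<in> carrier N\<rbrakk> \<Longrightarrow> demazure_map (coords \<alpha> \<beta>) = \<beta>"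
  using N.act_one[of \<beta>] N.act_zero_left[of \<alpha>]
  by (simp add: coords_def demazure_map_pure D_one D_x2)

lemma demazure_map_x1_coords:
  assumes "\<alpha> \<in> carrier N" "\<beta> \<in> carrier N"
  shows "demazure_map ((\<ominus> x1) \<odot>\<^bsub>up_N\<^esub> coords \<alpha> \<beta>) = \<ominus>\<^bsub>N\<^esub> \<alpha>"
proof -
  have "D (x1 \<otimes> x2) = \<zero>" by (simp add: D_mult D_x1 D_x2 s_x1 R.r_neg)
  then have "demazure_map (x1 \<odot>\<^bsub>up_N\<^esub> coords \<alpha> \<beta>) = \<alpha>"
    using assms N.act_one[of \<alpha>] N.act_zero_left[of \<beta>]
    by (simp add: coords_def U.T.act_r_distr U.smult_pure demazure_map_pure D_x1)
  then show ?thesis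
    using assms by (simp add: U.T.act_neg_left U.T.act_closed)
qed

lemma demazure_map_linear:
  assumes "a \<in> carrier invariants" "X \<in> carrier up_N"
  shows "demazure_map (s a \<odot>\<^bsub>up_N\<^esub> X) = a \<odot>\<^bsub>N\<^esub> demazure_map X"
  using assms(2)
proof (induction rule: U.tensor_induct)
  case (pure b m)
  then show ?case
    using assms(1) D_left_twisted_linear[of a b] N.act_assoc[of a "D b" m]
    by (simp add: U.smult_pure demazure_map_pure D_D)
next
  case (add X Y)
  then show ?case
    using assms(1) N.act_r_distr[of a "demazure_map X" "demazure_map Y"]
    by (simp add: U.T.act_r_distr U.T.act_closed)
qed

lemma demazure_map_grade: "X \<in> mgrade up_N n \<Longrightarrow> demazure_map X \<in> mgrade N (n - 2)"
proof (induction rule: U.tensor_grade_induct)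
  case (pure b m i j)
  then show ?case
    using N.mgrade_act[of "D b" "i - 2" m j] D_grade[of b i]
    by (auto simp: demazure_map_pure R.gr.grade_carrier N.gr.grade_carrier D_D algebra_simps)
next
  case (add X Y)
  then show ?case by (simp add: U.T.gr.grade_carrier N.gr.grade_add)
qed

lemma counit_balanced:
  "balanced R (transposition_bimodule R s) up_N N (\<lambda>r X. demazure_map (r \<odot>\<^bsub>up_N\<^esub> X))"
  unfolding balanced_def
  by (simp add: U.T.act_closed U.T.act_l_distr U.T.act_r_distr U.T.act_assoc)

sublocale counit: abelian_group_hom min_N N counit
  unfolding counit_def by (rule V.tensor_lift_hom[OF N.M.abelian_group_axioms counit_balanced])

lemma counit_pure: "\<lbrakk>r \<in> carrier R; X \<in> carrier up_N\<rbrakk>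
    \<Longrightarrow> counit (min_pure r X) = demazure_map (r \<odot>\<^bsub>up_N\<^esub> X)"
  unfolding counit_def
  using V.tensor_lift_pure[OF N.M.abelian_group_axioms counit_balanced] by simp

lemma counit_linear:
  assumes a: "a \<in> carrier invariants" and Y: "Y \<in> carrier min_N"
  shows "counit (a \<odot>\<^bsub>min_N\<^esub> Y) = a \<odot>\<^bsub>N\<^esub> counit Y"
proof -
  obtain X where X: "X \<in> carrier up_N" "Y = min_pure \<one> X" using min_pure_surj[OF Y] .
  have "a \<in> carrier R" using a by simp
  then show ?thesis
    using X demazure_map_linear[OF a X(1)]
    by (simp add: smult_min_pure counit_pure U.T.act_one U.T.act_closed)
qed

lemma counit_grade: "Y \<in> mgrade min_N n \<Longrightarrow> counit Y \<in> mgrade N (n - 2)"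
proof (induction rule: V.tensor_grade_induct)
  case (pure r X i j)
  then show ?case
    using demazure_map_grade[OF U.T.mgrade_act[of r i X j]]
    by (simp add: counit_pure R.gr.grade_carrier U.T.gr.grade_carrier)
next
  case (add X Y)
  then show ?case by (simp add: V.T.gr.grade_carrier N.gr.grade_add)
qed

end

context demazure_module
begin

lemma coords_act:
  assumes "r \<in> carrier R" "\<alpha> \<in> carrier N" "\<beta> \<in> carrier N"
  shows "r \<odot>\<^bsub>up_N\<^esub> coords \<alpha> \<beta> =
    coords (D (x1 \<otimes> r) \<odot>\<^bsub>N\<^esub> \<alpha> \<oplus>\<^bsub>N\<^esub> D (x1 \<otimes> (r \<otimes> x2)) \<odot>\<^bsub>N\<^esub> \<beta>)
      (D r \<odot>\<^bsub>N\<^esub> \<alpha> \<oplus>\<^bsub>N\<^esub> D (r \<otimes> x2) \<odot>\<^bsub>N\<^esub> \<beta>)"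
proof -
  have act: "D g \<odot>\<^bsub>N\<^esub> n \<in> carrier N" if "g \<in> carrier R" "n \<in> carrier N" for g n
    using N.act_closed[of "D g" n] that by (simp add: D_D)
  have "r \<odot>\<^bsub>up_N\<^esub> coords \<alpha> \<beta> = up_pure r \<alpha> \<oplus>\<^bsub>up_N\<^esub> up_pure (r \<otimes> x2) \<beta>"
    unfolding coords_def using assms by (simp add: U.T.act_r_distr U.smult_pure)
  then show ?thesis using assms by (simp add: pure_coords coords_add act)
qed

abbreviation "target \<equiv> min_N\<lparr>mgrade := \<lambda>i. mgrade min_N (i + 2)\<rparr>"

definition transpose :: "('a, 'm) graded_module \<Rightarrow> ('m \<Rightarrow> 'n) \<Rightarrow> 'm \<Rightarrow> _" where
  "transpose M h = (\<lambda>m\<in>carrier M. min_pure \<one> (coords (\<ominus>\<^bsub>N\<^esub> h (x2 \<odot>\<^bsub>M\<^esub> m)) (h m)))"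

text \<open>In coordinates, \<open>s(c)\<close> acts with coefficients \<open>D(x1 s(c))\<close>, \<open>D(x1 s(c) x2)\<close>, \<open>D(s(c))\<close> and
  \<open>D(s(c) x2)\<close>. The Leibniz rule rewrites those containing a final \<open>x2\<close> as \<open>a x2 + u\<close>, where \<open>a\<close> is the
  coefficient without it. Then \<open>S\<close>-linearity of \<open>h\<close> cancels all terms with \<open>a\<close>, and what is left are
  the coordinates of the transpose at \<open>c m\<close>.\<close>

lemma transpose_act:
  assumes M: "M \<in> gmod R" and h: "h \<in> gmod_hom invariants M N"
    and c: "c \<in> carrier R" and m: "m \<in> carrier M"
  shows "transpose M h (c \<odot>\<^bsub>M\<^esub> m) = c \<odot>\<^bsub>min_N\<^esub> transpose M h m"
proof -
  interpret M: graded_left_module R M using M by (simp add: gmod_def)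
  interpret h: abelian_group_hom M N h
    by (rule gmod_hom_additive[OF h]) unfold_locales
  \<comment> \<open>The cancellation behind both coordinates: \<open>- a h(x2 m)\<close> removes the term \<open>a x2\<close> from \<open>(a x2 + u) h(m)\<close>.\<close>
  have key: "a \<odot>\<^bsub>N\<^esub> (\<ominus>\<^bsub>N\<^esub> h (x2 \<odot>\<^bsub>M\<^esub> m)) \<oplus>\<^bsub>N\<^esub> (a \<otimes> x2 \<oplus> u) \<odot>\<^bsub>N\<^esub> h m = h (u \<odot>\<^bsub>M\<^esub> m)"
    if a: "a \<in> carrier invariants" and u: "u \<in> carrier R" and au: "a \<otimes> x2 \<oplus> u \<in> carrier invariants"
    for a u
  proof -
    have aR: "a \<in> carrier R" using a by simp
    have "(a \<otimes> x2 \<oplus> u) \<odot>\<^bsub>N\<^esub> h m = h ((a \<otimes> x2 \<oplus> u) \<odot>\<^bsub>M\<^esub> m)"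
      using gmod_homD(3)[OF h au m] by simp
    also have "\<dots> = h (a \<odot>\<^bsub>M\<^esub> (x2 \<odot>\<^bsub>M\<^esub> m)) \<oplus>\<^bsub>N\<^esub> h (u \<odot>\<^bsub>M\<^esub> m)"
      using aR u m by (simp add: M.act_l_distr M.act_assoc M.act_closed)
    also have "h (a \<odot>\<^bsub>M\<^esub> (x2 \<odot>\<^bsub>M\<^esub> m)) = a \<odot>\<^bsub>N\<^esub> h (x2 \<odot>\<^bsub>M\<^esub> m)"
      using gmod_homD(3)[OF h a] m by (simp add: M.act_closed)
    finally show ?thesis
      using a u m aR N.act_closed[of a "h (x2 \<odot>\<^bsub>M\<^esub> m)"]
      by (simp only: N.act_neg_right M.act_closed h.hom_closed x2_closed N.M.a_assoc[symmetric]
          N.M.a_inv_closed N.M.l_neg N.M.l_zero)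
  qed
  let ?r = "s c"
  have r: "?r \<in> carrier R" using c by simp
  have 1: "D ?r \<otimes> x2 \<oplus> c = D (?r \<otimes> x2)"
    using c by (simp add: D_mult D_x2 s_s)
  have 2: "D (x1 \<otimes> ?r) \<otimes> x2 \<oplus> (\<ominus> x2) \<otimes> c = D (x1 \<otimes> (?r \<otimes> x2))"
    using c r D_mult[of "x1 \<otimes> ?r" x2] by (simp add: R.m_assoc D_x2 s_s s_x1)
  have "c \<odot>\<^bsub>min_N\<^esub> transpose M h m =
      min_pure \<one> (?r \<odot>\<^bsub>up_N\<^esub> coords (\<ominus>\<^bsub>N\<^esub> h (x2 \<odot>\<^bsub>M\<^esub> m)) (h m))"
    using m c by (simp add: transpose_def smult_min_pure M.act_closed)
  also have "?r \<odot>\<^bsub>up_N\<^esub> coords (\<ominus>\<^bsub>N\<^esub> h (x2 \<odot>\<^bsub>M\<^esub> m)) (h m) =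
      coords (h ((\<ominus> x2 \<otimes> c) \<odot>\<^bsub>M\<^esub> m)) (h (c \<odot>\<^bsub>M\<^esub> m))"
  proof -
    have "D ?r \<in> carrier invariants" "D ?r \<otimes> x2 \<oplus> c \<in> carrier invariants"
      using r c by (simp_all add: 1 D_D del: D.hom_add)
    note b = key[OF this(1) c this(2)]
    have "D (x1 \<otimes> ?r) \<in> carrier invariants"
      "D (x1 \<otimes> ?r) \<otimes> x2 \<oplus> (\<ominus> x2) \<otimes> c \<in> carrier invariants"
      using r c unfolding 2 by (simp_all add: D_D)
    note a = key[OF this(1) _ this(2)]
    show ?thesis
      using a b r c m unfolding 1 2 by (subst coords_act) (simp_all add: M.act_closed)
  qed
  also have "h ((\<ominus> x2 \<otimes> c) \<odot>\<^bsub>M\<^esub> m) = \<ominus>\<^bsub>N\<^esub> h (x2 \<odot>\<^bsub>M\<^esub> (c \<odot>\<^bsub>M\<^esub> m))"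
    using c m by (simp add: M.act_assoc M.act_neg_left M.act_closed R.l_minus)
  finally show ?thesis using c m by (simp add: transpose_def M.act_closed)
qed

lemma transpose_gmod_hom:
  assumes M: "M \<in> gmod R" and h: "h \<in> gmod_hom invariants M N"
  shows "transpose M h \<in> gmod_hom R M target"
proof -
  interpret M: graded_left_module R M using M by (simp add: gmod_def)
  interpret h: abelian_group_hom M N h
    by (rule gmod_hom_additive[OF h]) unfold_locales
  have ab: "abelian_group target" by (rule abelian_group_cong[OF V.T.abelian_group_axioms]) simp_all
  let ?f = "\<lambda>m. min_pure \<one> (coords (\<ominus>\<^bsub>N\<^esub> h (x2 \<odot>\<^bsub>M\<^esub> m)) (h m))"
  have "restrict ?f (carrier M) \<in> gmod_hom R M target"
  proof (rule gmod_homI)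
    show "graded_left_module R M" by unfold_locales
    show "abelian_group_hom M target ?f"
    proof (rule abelian_group_hom_additiveI[OF M.M.abelian_group_axioms ab])
      fix m n assume m: "m \<in> carrier M" and n: "n \<in> carrier M"
      show "?f m \<in> carrier target" using m by (simp add: M.act_closed)
      have "coords (\<ominus>\<^bsub>N\<^esub> h (x2 \<odot>\<^bsub>M\<^esub> (m \<oplus>\<^bsub>M\<^esub> n))) (h (m \<oplus>\<^bsub>M\<^esub> n)) =
          coords (\<ominus>\<^bsub>N\<^esub> h (x2 \<odot>\<^bsub>M\<^esub> m)) (h m) \<oplus>\<^bsub>up_N\<^esub> coords (\<ominus>\<^bsub>N\<^esub> h (x2 \<odot>\<^bsub>M\<^esub> n)) (h n)"
        using m n by (simp add: coords_add M.act_r_distr M.act_closed N.M.minus_add)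
      then show "?f (m \<oplus>\<^bsub>M\<^esub> n) = ?f m \<oplus>\<^bsub>target\<^esub> ?f n"
        using m n by (simp add: V.pure_add_right M.act_closed)
    qed
    show "c \<odot>\<^bsub>M\<^esub> m \<in> carrier M" if "c \<in> carrier R" "m \<in> carrier M" for c m
      using that by (rule M.act_closed)
    show "?f (c \<odot>\<^bsub>M\<^esub> m) = c \<odot>\<^bsub>target\<^esub> ?f m" if "c \<in> carrier R" "m \<in> carrier M" for c m
      using transpose_act[OF M h that] that by (simp add: transpose_def M.act_closed)
    show "?f m \<in> mgrade target i" if m: "m \<in> mgrade M i" for m i
    proof -
      have 1: "h m \<in> mgrade N i" by (rule gmod_homD(4)[OF h m])
      have 2: "\<ominus>\<^bsub>N\<^esub> h (x2 \<odot>\<^bsub>M\<^esub> m) \<in> mgrade N (2 + i)"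
        by (intro N.gr.grade_neg gmod_homD(4)[OF h] M.mgrade_act x2_grade m)
      have "coords (\<ominus>\<^bsub>N\<^esub> h (x2 \<odot>\<^bsub>M\<^esub> m)) (h m) \<in> mgrade up_N (2 + i)"
        unfolding coords_def
        using U.pure_grade[of \<one> 0, OF _ 2] U.pure_grade[of x2 2, OF _ 1]
        by (simp add: R.rgrade_one x2_grade U.T.gr.grade_add)
      then show ?thesis
        using V.pure_grade[of \<one> 0 _ "2 + i"] by (simp add: R.rgrade_one add.commute)
    qed
  qed
  then show ?thesis by (simp add: transpose_def)
qed

lemma counit_gmod_hom:
  assumes M: "M \<in> gmod R" and g: "g \<in> gmod_hom R M target"
  shows "(\<lambda>m\<in>carrier M. counit (g m)) \<in> gmod_hom invariants M N"
proof -
  interpret M: graded_left_module R M using M by (simp add: gmod_def)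
  have gD: "g m \<in> carrier min_N" if "m \<in> carrier M" for m
    using gmod_homD(1)[OF g that] by simp
  show ?thesis
  proof (rule gmod_homI)
    show "graded_left_module R M" by unfold_locales
    show "abelian_group_hom M N (\<lambda>m. counit (g m))"
      using gmod_homD(2)[OF g]
      by (intro abelian_group_hom_additiveI) (simp_all add: gD M.M.abelian_group_axioms N.M.abelian_group_axioms)
    show "a \<odot>\<^bsub>M\<^esub> m \<in> carrier M" if "a \<in> carrier invariants" "m \<in> carrier M" for a m
      using that by (simp add: M.act_closed)
    show "counit (g (a \<odot>\<^bsub>M\<^esub> m)) = a \<odot>\<^bsub>N\<^esub> counit (g m)"
      if "a \<in> carrier invariants" "m \<in> carrier M" for a m
      using counit_linear[OF that(1) gD[OF that(2)]] gmod_homD(3)[OF g, of a m] that by simp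
    show "counit (g m) \<in> mgrade N i" if "m \<in> mgrade M i" for m i
      using counit_grade[of "g m" "i + 2"] gmod_homD(4)[OF g that] by simp
  qed
qed

lemma counit_transpose:
  assumes M: "M \<in> gmod R" and h: "h \<in> gmod_hom invariants M N"
  shows "(\<lambda>m\<in>carrier M. counit (transpose M h m)) = h"
proof (rule gmod_hom_eqI[OF counit_gmod_hom[OF M transpose_gmod_hom[OF M h]] h])
  interpret M: graded_left_module R M using M by (simp add: gmod_def)
  fix m assume m: "m \<in> carrier M"
  have "h m \<in> carrier N" "h (x2 \<odot>\<^bsub>M\<^esub> m) \<in> carrier N"
    using gmod_homD(1)[OF h] m by (simp_all add: M.act_closed)
  then show "(\<lambda>m\<in>carrier M. counit (transpose M h m)) m = h m"
    using m by (simp add: transpose_def counit_pure U.T.act_one demazure_map_coords)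
qed

text \<open>Both coordinates of \<open>g m\<close> are recovered by the counit: the second one from \<open>g m\<close>, the first one, up
  to sign, from \<open>g (x2 m)\<close>.\<close>

lemma transpose_counit:
  assumes M: "M \<in> gmod R" and g: "g \<in> gmod_hom R M target"
  shows "transpose M (\<lambda>m\<in>carrier M. counit (g m)) = g"
proof (rule gmod_hom_eqI[OF transpose_gmod_hom[OF M counit_gmod_hom[OF M g]] g])
  interpret M: graded_left_module R M using M by (simp add: gmod_def)
  fix m assume m: "m \<in> carrier M"
  have "g m \<in> carrier min_N" using gmod_homD(1)[OF g m] by simp
  then obtain X where X: "X \<in> carrier up_N" "g m = min_pure \<one> X" using min_pure_surj by blast
  then obtain \<alpha> \<beta> where \<alpha>\<beta>: "\<alpha> \<in> carrier N" "\<beta> \<in> carrier N" "X = coords \<alpha> \<beta>"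
    using coords_surj by blast
  have "g (x2 \<odot>\<^bsub>M\<^esub> m) = min_pure \<one> ((\<ominus> x1) \<odot>\<^bsub>up_N\<^esub> X)"
    using gmod_homD(3)[OF g x2_closed m] X by (simp add: smult_min_pure s_x2)
  then have "counit (g (x2 \<odot>\<^bsub>M\<^esub> m)) = \<ominus>\<^bsub>N\<^esub> \<alpha>"
    using X \<alpha>\<beta> by (simp add: counit_pure U.T.act_one U.T.act_closed demazure_map_x1_coords)
  moreover have "counit (g m) = \<beta>"
    using X \<alpha>\<beta> by (simp add: counit_pure U.T.act_one demazure_map_coords)
  ultimately show "transpose M (\<lambda>m\<in>carrier M. counit (g m)) m = g m"
    using m X \<alpha>\<beta> by (simp add: transpose_def M.act_closed)
qed

lemma transpose_bij:
  assumes M: "M \<in> gmod R"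
  shows "bij_betw (transpose M) (gmod_hom invariants M N) (gmod_hom R M target)"
  by (rule bij_betwI[where g = "\<lambda>g. \<lambda>m\<in>carrier M. counit (g m)"])
    (use transpose_gmod_hom[OF M] counit_gmod_hom[OF M] counit_transpose[OF M] transpose_counit[OF M]
      in auto)

end

context demazure_ring
begin

text \<open>Named for the role that it turns out to have, as right adjoint of restriction.\<close>

abbreviation coinduction :: "('a, 'n, 'a, _) gfunctor" where
  "coinduction \<equiv> shift_functor 2 \<circ>\<^sub>F tensor_functor R (transposition_bimodule R s)
     \<circ>\<^sub>F tensor_functor invariants (regular_bimodule R)"

lemma demazure_moduleI: "N \<in> gmod invariants \<Longrightarrow> demazure_module R s D x1 x2 N"
  by (simp add: demazure_module_def demazure_ring_axioms gmod_def)

lemma coinduction_is_functor: "is_functor invariants R coinduction"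
  by (rule is_functor_fcomp[OF is_functor_fcomp[OF up.tensor_functor_is_functor
          minus.tensor_functor_is_functor] shift_functor_is_functor])

lemma transpose_natural:
  assumes M: "M \<in> gmod R" and M': "M' \<in> gmod R"
    and N: "N \<in> gmod invariants" and N': "N' \<in> gmod invariants"
    and f: "f \<in> gmod_hom R M' M" and g: "g \<in> gmod_hom invariants N N'"
    and h: "h \<in> gmod_hom invariants M N"
  shows "demazure_module.transpose R s D x2 N' M' (compose (carrier M') g (compose (carrier M') h f)) =
    compose (carrier M') (fmap coinduction N N' g)
      (compose (carrier M') (demazure_module.transpose R s D x2 N M h) f)"
proof (rule extensionalityI)
  interpret N: demazure_module R s D x1 x2 N by (rule demazure_moduleI[OF N])
  interpret N': demazure_module R s D x1 x2 N' by (rule demazure_moduleI[OF N'])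
  interpret M: graded_left_module R M using M by (simp add: gmod_def)
  interpret M': graded_left_module R M' using M' by (simp add: gmod_def)
  interpret g: abelian_group_hom N N' g
    by (rule gmod_hom_additive[OF g]) unfold_locales
  let ?up = "fmap (tensor_functor invariants (regular_bimodule R)) N N' g"
  let ?min = "fmap (tensor_functor R (transposition_bimodule R s)) N.up_N N'.up_N ?up"
  have up: "?up \<in> gmod_hom R N.up_N N'.up_N" by (rule up.fmap_tensor[OF N N' g])
  have upN: "N.up_N \<in> gmod R" "N'.up_N \<in> gmod R"
    using N.U.tensor_graded_left_module N'.U.tensor_graded_left_module by (simp_all add: gmod_def)
  have fmap: "fmap coinduction N N' g = ?min"
    by (simp add: fcomp_def shift_functor_def tensor_functor_def)
  have up_coords: "?up (N.coords \<alpha> \<beta>) = N'.coords (g \<alpha>) (g \<beta>)"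
    if "\<alpha> \<in> carrier N" "\<beta> \<in> carrier N" for \<alpha> \<beta>
    using that unfolding N.coords_def N'.coords_def
    by (simp add: gmod_homD(2)[OF up] up.fmap_tensor_pure[OF N N' g])
  show "N'.transpose M' (compose (carrier M') g (compose (carrier M') h f)) \<in> extensional (carrier M')"
    by (simp add: N'.transpose_def)
  show "compose (carrier M') (fmap coinduction N N' g)
      (compose (carrier M') (N.transpose M h) f) \<in> extensional (carrier M')"
    by (simp add: compose_def)
  fix m assume m: "m \<in> carrier M'"
  have fm: "f m \<in> carrier M" by (rule gmod_homD(1)[OF f m])
  have x2m: "x2 \<odot>\<^bsub>M'\<^esub> m \<in> carrier M'" "x2 \<odot>\<^bsub>M\<^esub> f m \<in> carrier M"
    using m fm by (simp_all add: M.act_closed M'.act_closed)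
  have hN: "h (f m) \<in> carrier N" "h (x2 \<odot>\<^bsub>M\<^esub> f m) \<in> carrier N"
    using gmod_homD(1)[OF h] fm x2m by blast+
  have "?min (N.min_pure \<one> X) = N'.min_pure \<one> (?up X)" if "X \<in> carrier N.up_N" for X
    using minus.fmap_tensor_pure[OF upN up, of \<one> X] that by simp
  then show "N'.transpose M' (compose (carrier M') g (compose (carrier M') h f)) m =
    compose (carrier M') (fmap coinduction N N' g) (compose (carrier M') (N.transpose M h) f) m"
    unfolding fmap using m fm x2m hN
    by (simp add: N.transpose_def N'.transpose_def compose_eq gmod_homD(3)[OF f x2_closed m] up_coords)
qed

theorem restriction_coinduction_adjoint:
  "adjoint_pair R invariants (F_down :: ('a, 'm, 'a, 'm) gfunctor)
     (coinduction :: ('a, 'n, 'a, _) gfunctor)"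
proof -
  have fobj: "fobj coinduction N =
      (tensor R (transposition_bimodule R s) (tensor invariants (regular_bimodule R) N))
        \<lparr>mgrade := \<lambda>i. mgrade (tensor R (transposition_bimodule R s)
           (tensor invariants (regular_bimodule R) N)) (i + 2)\<rparr>" for N :: "('a, 'n) graded_module"
    by (simp add: fcomp_def shift_functor_def tensor_functor_def)
  have bij: "bij_betw (demazure_module.transpose R s D x2 N M)
      (gmod_hom invariants M N) (gmod_hom R M (fobj coinduction N))"
    if "M \<in> gmod R" "N \<in> gmod invariants"
    for M :: "('a, 'm) graded_module" and N :: "('a, 'n) graded_module"
    unfolding fobj using demazure_module.transpose_bij[OF demazure_moduleI[OF that(2)] that(1)] .
  show ?thesis
    unfolding adjoint_pair_def
    using Sub.restriction_is_functor coinduction_is_functor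
    by (intro conjI exI[of _ "\<lambda>M N. demazure_module.transpose R s D x2 N M"])
      (auto simp: F_down_def bij transpose_natural)
qed

end

section \<open>The free algebra\<close>

locale coefficient_ring = K: cring K for K :: "('k, 'z) ring_scheme" (structure)
begin

abbreviation "A \<equiv> free_alg K"

definition conv :: "(var list \<Rightarrow> 'k) \<Rightarrow> (var list \<Rightarrow> 'k) \<Rightarrow> var list \<Rightarrow> 'k" where
  "conv f g w = (\<Oplus>i\<in>{..length w}. f (take i w) \<otimes> g (drop i w))"

lemma free_alg_simps:
  "f \<in> carrier A \<longleftrightarrow> (\<forall>w. f w \<in> carrier K) \<and> finite {w. f w \<noteq> \<zero>}"
  "f \<otimes>\<^bsub>A\<^esub> g = conv f g" "f \<oplus>\<^bsub>A\<^esub> g = (\<lambda>w. f w \<oplus> g w)"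
  "\<one>\<^bsub>A\<^esub> = (\<lambda>w. if w = [] then \<one> else \<zero>)" "\<zero>\<^bsub>A\<^esub> = (\<lambda>w. \<zero>)"
  by (simp_all add: free_alg_def conv_def[abs_def])

lemma conv_Nil: "\<lbrakk>f [] \<in> carrier K; g [] \<in> carrier K\<rbrakk> \<Longrightarrow> conv f g [] = f [] \<otimes> g []"
  by (simp add: conv_def)

text \<open>Splitting off the first letter gives a recursion for the convolution product along the word. It
  reduces the ring axioms to inductions over words, without exchanging double sums.\<close>

lemma conv_Cons:
  assumes "\<And>w. f w \<in> carrier K" "\<And>w. g w \<in> carrier K"
  shows "conv f g (x # w) = f [] \<otimes> g (x # w) \<oplus> conv (\<lambda>u. f (x # u)) g w"
proof -
  have "conv f g (x # w) = (\<Oplus>i\<in>{..length w}. f (x # take i w) \<otimes> g (drop i w)) \<oplus> f [] \<otimes> g (x # w)"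
    unfolding conv_def using assms by (simp del: K.finsum_Suc add: K.finsum_Suc2)
  also have "\<dots> = f [] \<otimes> g (x # w) \<oplus> conv (\<lambda>u. f (x # u)) g w"
    unfolding conv_def using assms by (intro K.a_comm) auto
  finally show ?thesis .
qed

lemma conv_closed: "\<lbrakk>\<And>w. f w \<in> carrier K; \<And>w. g w \<in> carrier K\<rbrakk> \<Longrightarrow> conv f g w \<in> carrier K"
  unfolding conv_def by (rule K.finsum_closed) auto

lemma conv_add_left:
  "\<lbrakk>\<And>w. f w \<in> carrier K; \<And>w. g w \<in> carrier K; \<And>w. h w \<in> carrier K\<rbrakk>
    \<Longrightarrow> conv (\<lambda>w. f w \<oplus> g w) h w = conv f h w \<oplus> conv g h w"
  unfolding conv_def by (simp add: K.l_distr K.finsum_addf)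

lemma conv_add_right:
  "\<lbrakk>\<And>w. f w \<in> carrier K; \<And>w. g w \<in> carrier K; \<And>w. h w \<in> carrier K\<rbrakk>
    \<Longrightarrow> conv h (\<lambda>w. f w \<oplus> g w) w = conv h f w \<oplus> conv h g w"
  unfolding conv_def by (simp add: K.r_distr K.finsum_addf)

lemma conv_scale_left:
  "\<lbrakk>a \<in> carrier K; \<And>w. f w \<in> carrier K; \<And>w. g w \<in> carrier K\<rbrakk>
    \<Longrightarrow> conv (\<lambda>w. a \<otimes> f w) g w = a \<otimes> conv f g w"
  unfolding conv_def by (simp add: K.m_assoc K.finsum_rdistr)

lemma conv_assoc:
  assumes "\<And>w. f w \<in> carrier K" "\<And>w. g w \<in> carrier K" "\<And>w. h w \<in> carrier K"
  shows "conv (conv f g) h w = conv f (conv g h) w"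
  using assms(1)
proof (induction w arbitrary: f)
  case Nil
  then show ?case using assms by (simp add: conv_Nil conv_closed K.m_assoc)
next
  case (Cons x w)
  have "conv (conv f g) h (x # w) =
      f [] \<otimes> g [] \<otimes> h (x # w) \<oplus> conv (\<lambda>u. f [] \<otimes> g (x # u) \<oplus> conv (\<lambda>u. f (x # u)) g u) h w"
    using Cons.prems assms by (simp add: conv_Cons conv_Nil conv_closed)
  also have "\<dots> = f [] \<otimes> g [] \<otimes> h (x # w) \<oplus>
      (f [] \<otimes> conv (\<lambda>u. g (x # u)) h w \<oplus> conv (\<lambda>u. f (x # u)) (conv g h) w)"
    using Cons.prems assms Cons.IH[of "\<lambda>u. f (x # u)"]
    by (simp add: conv_add_left conv_scale_left conv_closed)
  also have "\<dots> = conv f (conv g h) (x # w)"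
    using Cons.prems assms by (simp add: conv_Cons conv_closed K.r_distr K.m_assoc K.a_assoc)
  finally show ?case .
qed

lemma conv_zero_left: "(\<And>w. f w \<in> carrier K) \<Longrightarrow> conv (\<lambda>w. \<zero>) f w = \<zero>"
  by (simp add: conv_def)

lemma conv_const_left:
  "\<lbrakk>a \<in> carrier K; \<And>w. f w \<in> carrier K\<rbrakk> \<Longrightarrow> conv (free_const K a) f w = a \<otimes> f w"
  by (cases w) (simp_all add: free_const_def conv_Nil conv_Cons conv_zero_left)

lemma conv_const_right:
  "\<lbrakk>a \<in> carrier K; \<And>w. f w \<in> carrier K\<rbrakk> \<Longrightarrow> conv f (free_const K a) w = f w \<otimes> a"
  by (induction w arbitrary: f) (simp_all add: free_const_def conv_Nil conv_Cons)

lemma conv_var: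
  assumes "\<And>w. f w \<in> carrier K"
  shows "conv (free_var K v) f w = (case w of [] \<Rightarrow> \<zero> | x # u \<Rightarrow> if x = v then f u else \<zero>)"
proof (cases w)
  case Nil
  then show ?thesis using assms by (simp add: free_var_def conv_Nil)
next
  case (Cons x u)
  have closed: "free_var K v w \<in> carrier K" for w by (simp add: free_var_def)
  have "conv (free_var K v) f w = conv (\<lambda>u. free_var K v (x # u)) f u"
    using Cons assms conv_Cons[of "free_var K v" f x u, OF closed assms]
    by (simp add: conv_closed closed) (simp add: free_var_def)
  also have "(\<lambda>u. free_var K v (x # u)) = (if x = v then free_const K \<one> else (\<lambda>u. \<zero>))"
    by (auto simp: free_var_def free_const_def)
  finally show ?thesis
    using Cons assms by (simp add: conv_const_left conv_zero_left)
qed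

lemma one_const: "\<one>\<^bsub>A\<^esub> = free_const K \<one>"
  by (simp add: free_alg_simps free_const_def)

lemma conv_support:
  assumes f: "f \<in> carrier A" and g: "g \<in> carrier A"
  shows "finite {w. conv f g w \<noteq> \<zero>}"
proof (rule finite_subset)
  show "finite ((\<lambda>(u, v). u @ v) ` ({w. f w \<noteq> \<zero>} \<times> {w. g w \<noteq> \<zero>}))"
    using f g by (simp add: free_alg_simps)
  show "{w. conv f g w \<noteq> \<zero>} \<subseteq> (\<lambda>(u, v). u @ v) ` ({w. f w \<noteq> \<zero>} \<times> {w. g w \<noteq> \<zero>})"
  proof (rule subsetI, rule ccontr)
    fix w assume w: "w \<in> {w. conv f g w \<noteq> \<zero>}"
      and not: "w \<notin> (\<lambda>(u, v). u @ v) ` ({w. f w \<noteq> \<zero>} \<times> {w. g w \<noteq> \<zero>})"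
    have "f (take i w) \<otimes> g (drop i w) = \<zero>" for i
    proof (rule ccontr)
      assume "f (take i w) \<otimes> g (drop i w) \<noteq> \<zero>"
      then have "f (take i w) \<noteq> \<zero>" "g (drop i w) \<noteq> \<zero>"
        using f g by (auto simp: free_alg_simps)
      then have "(\<lambda>(u, v). u @ v) (take i w, drop i w) \<in>
          (\<lambda>(u, v). u @ v) ` ({w. f w \<noteq> \<zero>} \<times> {w. g w \<noteq> \<zero>})" by blast
      then show False using not by simp
    qed
    then show False using w by (simp add: conv_def)
  qed
qed

lemma free_alg_ring: "ring A"
proof (rule ringI)
  have fin: "finite {w. f w \<oplus> g w \<noteq> \<zero>}" if "finite {w. f w \<noteq> \<zero>}" "finite {w. g w \<noteq> \<zero>}"
    for f g :: "var list \<Rightarrow> 'k"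
    by (rule finite_subset[of _ "{w. f w \<noteq> \<zero>} \<union> {w. g w \<noteq> \<zero>}"]) (use that in auto)
  show "abelian_group A"
  proof (rule abelian_groupI)
    fix f assume f: "f \<in> carrier A"
    have "finite {w. \<ominus> f w \<noteq> \<zero>}"
      by (rule finite_subset[of _ "{w. f w \<noteq> \<zero>}"]) (use f in \<open>auto simp: free_alg_simps\<close>)
    then show "\<exists>g\<in>carrier A. g \<oplus>\<^bsub>A\<^esub> f = \<zero>\<^bsub>A\<^esub>"
      using f by (intro bexI[of _ "\<lambda>w. \<ominus> f w"]) (auto simp: free_alg_simps K.l_neg)
  qed (auto simp: free_alg_simps K.a_ac fin)
  show "monoid A"
  proof (rule monoidI)
    show "f \<otimes>\<^bsub>A\<^esub> g \<in> carrier A" if "f \<in> carrier A" "g \<in> carrier A" for f g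
      using that conv_support[OF that] by (auto simp: free_alg_simps conv_closed)
    show "\<one>\<^bsub>A\<^esub> \<in> carrier A" by (auto simp: free_alg_simps)
    show "f \<otimes>\<^bsub>A\<^esub> g \<otimes>\<^bsub>A\<^esub> h = f \<otimes>\<^bsub>A\<^esub> (g \<otimes>\<^bsub>A\<^esub> h)"
      if "f \<in> carrier A" "g \<in> carrier A" "h \<in> carrier A" for f g h
      using that by (auto simp: free_alg_simps conv_assoc)
    show "\<one>\<^bsub>A\<^esub> \<otimes>\<^bsub>A\<^esub> f = f" "f \<otimes>\<^bsub>A\<^esub> \<one>\<^bsub>A\<^esub> = f" if "f \<in> carrier A" for f
      using that unfolding one_const
      by (auto simp: free_alg_simps conv_const_left conv_const_right)
  qed
qed (auto simp: free_alg_simps conv_add_left conv_add_right)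

sublocale A: ring A by (rule free_alg_ring)

lemma const_closed [simp]: "a \<in> carrier K \<Longrightarrow> free_const K a \<in> carrier A"
  by (auto simp: free_alg_simps free_const_def)

lemma var_closed [simp]: "free_var K v \<in> carrier A"
  by (auto simp: free_alg_simps free_var_def)

lemma restrict_support_closed:
  assumes f: "f \<in> carrier A" and g: "\<And>w. g w = f w \<or> g w = \<zero>"
  shows "g \<in> carrier A"
proof -
  have "g w \<in> carrier K" for w using f g[of w] by (auto simp: free_alg_simps)
  moreover have "{w. g w \<noteq> \<zero>} \<subseteq> {w. f w \<noteq> \<zero>}"
    by (rule Collect_mono) (use g in metis)
  ultimately show ?thesis using f finite_subset by (auto simp: free_alg_simps)
qed

definition single :: "'k \<Rightarrow> var list \<Rightarrow> var list \<Rightarrow> 'k" where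
  "single a w = (\<lambda>u. if u = w then a else \<zero>)"

lemma single_closed: "a \<in> carrier K \<Longrightarrow> single a w \<in> carrier A"
  by (auto simp: free_alg_simps single_def)

lemma free_alg_support_induct [consumes 1, case_names single add]:
  assumes f: "f \<in> carrier A"
    and single: "\<And>a w. a \<in> carrier K \<Longrightarrow> P (single a w)"
    and add: "\<And>f g. \<lbrakk>f \<in> carrier A; g \<in> carrier A; P f; P g\<rbrakk> \<Longrightarrow> P (f \<oplus>\<^bsub>A\<^esub> g)"
  shows "P f"
proof -
  have "P f" if "finite S" "f \<in> carrier A" "{w. f w \<noteq> \<zero>} \<subseteq> S" for S f
    using that
  proof (induction S arbitrary: f)
    case empty
    then have "f = single \<zero> []" by (auto simp: single_def)
    then show ?case using single by simp
  next
    case (insert w S)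
    let ?g = "f(w := \<zero>)"
    have fw: "f w \<in> carrier K" using insert.prems by (simp add: free_alg_simps)
    have g: "?g \<in> carrier A"
      by (rule restrict_support_closed[OF insert.prems(1)]) auto
    have "P ?g" by (rule insert.IH[OF g]) (use insert.prems(2) in auto)
    moreover have "f = ?g \<oplus>\<^bsub>A\<^esub> single (f w) w"
      using insert.prems(1) by (auto simp: free_alg_simps single_def)
    ultimately show ?case
      using add[OF g single_closed[OF fw] _ single[OF fw]] by metis
  qed
  then show ?thesis using f by (auto simp: free_alg_simps)
qed

lemma single_Nil: "a \<in> carrier K \<Longrightarrow> single a [] = free_const K a \<otimes>\<^bsub>A\<^esub> \<one>\<^bsub>A\<^esub>"
proof -
  assume a: "a \<in> carrier K"
  have "single a [] = free_const K a" by (simp add: single_def free_const_def)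
  then show ?thesis using a by simp
qed

lemma single_Cons: "a \<in> carrier K \<Longrightarrow> single a (v # w) = free_var K v \<otimes>\<^bsub>A\<^esub> single a w"
  by (rule ext) (auto simp: free_alg_simps(2) conv_var single_def split: list.split)

text \<open>Monomials arise from the unit by left multiplication with variables, and then with a scalar.\<close>

lemma free_alg_induct [consumes 1, case_names one add const var]:
  assumes f: "f \<in> carrier A"
    and one: "P \<one>\<^bsub>A\<^esub>"
    and add: "\<And>f g. \<lbrakk>f \<in> carrier A; g \<in> carrier A; P f; P g\<rbrakk> \<Longrightarrow> P (f \<oplus>\<^bsub>A\<^esub> g)"
    and const: "\<And>a f. \<lbrakk>a \<in> carrier K; f \<in> carrier A; P f\<rbrakk> \<Longrightarrow> P (free_const K a \<otimes>\<^bsub>A\<^esub> f)"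
    and var: "\<And>v f. \<lbrakk>f \<in> carrier A; P f\<rbrakk> \<Longrightarrow> P (free_var K v \<otimes>\<^bsub>A\<^esub> f)"
  shows "P f"
  using f
proof (induction rule: free_alg_support_induct)
  case (single a w)
  then show ?case
  proof (induction w)
    case Nil
    then show ?case using const[OF _ _ one, of a] by (simp add: single_Nil)
  next
    case (Cons v w)
    then show ?case using var[of "single a w" v] by (simp add: single_Cons single_closed)
  qed
qed (rule add)

text \<open>The homogeneous part of degree \<open>n\<close>; a letter has degree two.\<close>

definition trunc :: "int \<Rightarrow> (var list \<Rightarrow> 'k) \<Rightarrow> var list \<Rightarrow> 'k" where
  "trunc n f = (\<lambda>w. if 2 * int (length w) = n then f w else \<zero>)"

lemma trunc_closed: "f \<in> carrier A \<Longrightarrow> trunc n f \<in> carrier A"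
  by (erule restrict_support_closed) (simp add: trunc_def)

lemma trunc_add: "trunc n (f \<oplus>\<^bsub>A\<^esub> g) = trunc n f \<oplus>\<^bsub>A\<^esub> trunc n g"
  by (rule ext) (simp add: trunc_def free_alg_simps)

lemma trunc_grade: "f \<in> carrier A \<Longrightarrow> trunc n f \<in> free_grade K n"
  using trunc_closed[of f n] by (auto simp: free_grade_def trunc_def)

lemma grade_closed: "f \<in> free_grade K n \<Longrightarrow> f \<in> carrier A"
  by (simp add: free_grade_def)

lemma trunc_of_grade: "f \<in> free_grade K m \<Longrightarrow> trunc n f = (if n = m then f else \<zero>\<^bsub>A\<^esub>)"
proof
  fix w assume "f \<in> free_grade K m"
  then show "trunc n f w = (if n = m then f else \<zero>\<^bsub>A\<^esub>) w"
    by (cases "f w = \<zero>") (auto simp: trunc_def free_grade_def free_alg_simps)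
qed

lemma grade_iff: "f \<in> free_grade K n \<longleftrightarrow> f \<in> carrier A \<and> trunc n f = f"
  using trunc_of_grade[of f n n] trunc_grade[of f n] by (auto simp: free_grade_def)

text \<open>Equality holds term by term: a term is nonzero only if the second factor is evaluated at a word of
  degree \<open>d\<close>, and then the first factor is evaluated at a word of degree \<open>n - d\<close> exactly if the whole
  word has degree \<open>n\<close>.\<close>

lemma trunc_mult_right:
  assumes f: "f \<in> carrier A" and g: "g \<in> free_grade K d"
  shows "trunc n (f \<otimes>\<^bsub>A\<^esub> g) = trunc (n - d) f \<otimes>\<^bsub>A\<^esub> g"
proof
  fix w
  have fg: "f u \<in> carrier K" "g u \<in> carrier K" for u
    using f g by (simp_all add: free_grade_def free_alg_simps)
  have "trunc n (conv f g) w =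
      (\<Oplus>i\<in>{..length w}. if 2 * int (length w) = n then f (take i w) \<otimes> g (drop i w) else \<zero>)"
    by (simp add: trunc_def conv_def)
  also have "\<dots> = conv (trunc (n - d) f) g w"
    unfolding conv_def
  proof (rule K.finsum_cong')
    fix i assume "i \<in> {..length w}"
    then show "(if 2 * int (length w) = n then f (take i w) \<otimes> g (drop i w) else \<zero>) =
        trunc (n - d) f (take i w) \<otimes> g (drop i w)"
      using g fg by (cases "g (drop i w) = \<zero>") (auto simp: free_grade_def trunc_def of_nat_diff)
  qed (use fg in \<open>auto simp: trunc_def\<close>)
  finally show "trunc n (f \<otimes>\<^bsub>A\<^esub> g) w = (trunc (n - d) f \<otimes>\<^bsub>A\<^esub> g) w"
    by (simp add: free_alg_simps)
qed

lemma trunc_mult_left: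
  assumes f: "f \<in> carrier A" and g: "g \<in> free_grade K d"
  shows "trunc n (g \<otimes>\<^bsub>A\<^esub> f) = g \<otimes>\<^bsub>A\<^esub> trunc (n - d) f"
proof
  fix w
  have fg: "f u \<in> carrier K" "g u \<in> carrier K" for u
    using f g by (simp_all add: free_grade_def free_alg_simps)
  have "trunc n (conv g f) w =
      (\<Oplus>i\<in>{..length w}. if 2 * int (length w) = n then g (take i w) \<otimes> f (drop i w) else \<zero>)"
    by (simp add: trunc_def conv_def)
  also have "\<dots> = conv g (trunc (n - d) f) w"
    unfolding conv_def
  proof (rule K.finsum_cong')
    fix i assume "i \<in> {..length w}"
    then show "(if 2 * int (length w) = n then g (take i w) \<otimes> f (drop i w) else \<zero>) =
        g (take i w) \<otimes> trunc (n - d) f (drop i w)"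
      using g fg by (cases "g (take i w) = \<zero>") (auto simp: free_grade_def trunc_def of_nat_diff)
  qed (use fg in \<open>auto simp: trunc_def\<close>)
  finally show "trunc n (g \<otimes>\<^bsub>A\<^esub> f) w = (g \<otimes>\<^bsub>A\<^esub> trunc (n - d) f) w"
    by (simp add: free_alg_simps)
qed

lemma const_grade: "a \<in> carrier K \<Longrightarrow> free_const K a \<in> free_grade K 0"
  by (auto simp: free_grade_def) (auto simp: free_const_def split: if_splits)

lemma var_grade: "free_var K v \<in> free_grade K 2"
  by (auto simp: free_grade_def) (auto simp: free_var_def split: if_splits)

lemma grade_mult:
  "\<lbrakk>f \<in> free_grade K i; g \<in> free_grade K j\<rbrakk> \<Longrightarrow> f \<otimes>\<^bsub>A\<^esub> g \<in> free_grade K (i + j)"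
  using trunc_mult_right[of f g j "i + j"] by (auto simp: grade_iff)

lemma grade_add:
  "\<lbrakk>f \<in> free_grade K i; g \<in> free_grade K i\<rbrakk> \<Longrightarrow> f \<oplus>\<^bsub>A\<^esub> g \<in> free_grade K i"
  by (simp add: grade_iff trunc_add)

lemma trunc_zero: "trunc n \<zero>\<^bsub>A\<^esub> = \<zero>\<^bsub>A\<^esub>"
  by (simp add: trunc_def free_alg_simps)

lemma trunc_hom: "abelian_group_hom A A (trunc n)"
  by (rule abelian_group_hom_additiveI) (simp_all add: A.abelian_group_axioms trunc_closed trunc_add)

section \<open>The odd polynomial ring\<close>

abbreviation "I \<equiv> odd_ideal K"
abbreviation "Rel \<equiv> free_var K V1 \<otimes>\<^bsub>A\<^esub> free_var K V2 \<oplus>\<^bsub>A\<^esub> free_var K V2 \<otimes>\<^bsub>A\<^esub> free_var K V1"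

lemma ideal_I: "ideal I A"
  unfolding odd_ideal_def by (rule A.genideal_ideal) simp

sublocale I: ideal I A by (rule ideal_I)

lemma relation_homogeneous: "Rel \<in> free_grade K 4"
  using grade_add[OF grade_mult[OF var_grade var_grade] grade_mult[OF var_grade var_grade]] by simp

text \<open>The elements all of whose homogeneous parts lie in the ideal form an ideal themselves, because
  multiplication by a scalar or a variable only shifts the parts. This ideal contains the relation,
  which is homogeneous.\<close>

lemma trunc_ideal:
  assumes "f \<in> I" shows "trunc n f \<in> I"
proof -
  let ?J = "{f \<in> carrier A. \<forall>n. trunc n f \<in> I}"
  \<comment> \<open>Both inductions peel letters off the left end of \<open>g\<close>. In \<open>f g\<close> they are absorbed into \<open>f\<close>, which therefore varies.\<close>
  have left: "g \<otimes>\<^bsub>A\<^esub> f \<in> ?J" if "g \<in> carrier A" "f \<in> ?J" for f g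
    using that
  proof (induction g rule: free_alg_induct)
    case (add g h)
    then show ?case by (simp add: A.l_distr trunc_add)
  next
    case (const a g)
    then show ?case
      by (simp add: A.m_assoc trunc_mult_left[OF _ const_grade] I.I_l_closed)
  next
    case (var v g)
    then show ?case
      by (simp add: A.m_assoc trunc_mult_left[OF _ var_grade] I.I_l_closed)
  qed simp
  have right: "f \<otimes>\<^bsub>A\<^esub> g \<in> ?J" if "g \<in> carrier A" "f \<in> ?J" for f g
    using that
  proof (induction g arbitrary: f rule: free_alg_induct)
    case (add g h)
    then show ?case by (simp add: A.r_distr trunc_add)
  next
    case (const a g)
    then have "f \<otimes>\<^bsub>A\<^esub> free_const K a \<in> ?J"
      by (simp add: trunc_mult_right[OF _ const_grade] I.I_r_closed)
    then show ?case using const by (simp flip: A.m_assoc)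
  next
    case (var v g)
    then have "f \<otimes>\<^bsub>A\<^esub> free_var K v \<in> ?J"
      by (simp add: trunc_mult_right[OF _ var_grade] I.I_r_closed)
    then show ?case using var by (simp flip: A.m_assoc)
  qed simp
  have "additive_subgroup ?J A"
  proof (rule A.additive_subgroup_closedI)
    show "\<ominus>\<^bsub>A\<^esub> f \<in> ?J" if "f \<in> ?J" for f
      using that by (simp add: abelian_group_hom.hom_a_inv[OF trunc_hom])
  qed (auto simp: trunc_add trunc_zero)
  then have "ideal ?J A"
    by (intro idealI A.ring_axioms left right additive_subgroup.a_subgroup)
  moreover have "Rel \<in> I" unfolding odd_ideal_def by (rule A.genideal_self') simp
  then have "Rel \<in> ?J" using I.zero_closed by (simp add: trunc_of_grade[OF relation_homogeneous])
  ultimately have "I \<subseteq> ?J"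
    unfolding odd_ideal_def by (intro A.genideal_minimal) auto
  then show ?thesis using assms by auto
qed

abbreviation "R \<equiv> odd_ring K"
abbreviation "cls \<equiv> odd_class K"

lemma odd_ring_simps:
  "carrier R = carrier (A Quot I)" "monoid.mult R = monoid.mult (A Quot I)" "add R = add (A Quot I)"
  "\<one>\<^bsub>R\<^esub> = \<one>\<^bsub>A Quot I\<^esub>" "\<zero>\<^bsub>R\<^esub> = \<zero>\<^bsub>A Quot I\<^esub>" "rgrade R n = cls ` free_grade K n"
  by (simp_all add: odd_ring_def ring.extend_def)

lemma odd_ring_ring: "ring R"
proof -
  interpret Q: ring "A Quot I" by (rule I.quotient_is_ring)
  show ?thesis
  proof (rule ringI)
    show "abelian_group R"
      by (rule abelian_group_cong[OF Q.abelian_group_axioms]) (simp_all add: odd_ring_simps)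
    show "monoid R"
      by (rule monoidI) (simp_all add: odd_ring_simps Q.m_assoc)
  qed (simp_all add: odd_ring_simps Q.l_distr Q.r_distr)
qed

sublocale R: ring R by (rule odd_ring_ring)

lemma cls_hom: "cls \<in> ring_hom A R"
  using I.rcos_ring_hom unfolding odd_class_def ring_hom_def
  by (simp add: odd_ring_simps)

sublocale cls: ring_hom_ring A R cls
  by (rule ring_hom_ringI2[OF A.ring_axioms R.ring_axioms cls_hom])

lemma carrier_odd_ring: "carrier R = cls ` carrier A"
  by (auto simp: odd_ring_simps FactRing_def A_RCOSETS_def' odd_class_def)

lemma cls_ideal: "i \<in> I \<Longrightarrow> cls i = \<zero>\<^bsub>R\<^esub>"
  using I.a_rcos_const[of i] by (simp add: odd_class_def odd_ring_simps FactRing_def)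

definition odd_part :: "int \<Rightarrow> (var list \<Rightarrow> 'k) set \<Rightarrow> (var list \<Rightarrow> 'k) set" where
  "odd_part n X = cls (trunc n (SOME f. f \<in> X))"

lemma odd_part_cls:
  assumes f: "f \<in> carrier A" shows "odd_part n (cls f) = cls (trunc n f)"
proof -
  have "f \<in> cls f" using f I.a_rcos_self by (simp add: odd_class_def)
  then have "(SOME g. g \<in> cls f) \<in> cls f" by (rule someI[of "\<lambda>g. g \<in> cls f"])
  then obtain i where i: "i \<in> I" "(SOME g. g \<in> cls f) = i \<oplus>\<^bsub>A\<^esub> f"
    by (auto simp: odd_class_def a_r_coset_def')
  then show ?thesis
    using f trunc_closed trunc_ideal[OF i(1)] I.a_Hcarr
    by (simp add: odd_part_def trunc_add cls_ideal)
qed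

text \<open>As the ideal is homogeneous, truncation descends to the quotient and provides the projections.\<close>

lemma odd_ring_grading: "is_grading R (rgrade R)"
proof (rule is_gradingI[where p = odd_part])
  show "abelian_group R" by (rule R.abelian_group_axioms)
  show "abelian_group_hom R R (odd_part n)" for n
    by (rule abelian_group_hom_additiveI)
      (auto simp: R.abelian_group_axioms carrier_odd_ring odd_part_cls trunc_closed trunc_add
        simp flip: cls.hom_add)
  show "odd_part i X = (if i = j then X else \<zero>\<^bsub>R\<^esub>)" if "X \<in> rgrade R j" for i j X
    using that by (auto simp: odd_ring_simps(6) odd_part_cls grade_closed trunc_of_grade)
  show "additive_subgroup (rgrade R n) R" for n
  proof (rule R.additive_subgroup_closedI)
    show "rgrade R n \<subseteq> carrier R"
      by (auto simp: odd_ring_simps(6) grade_closed)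
    show "\<zero>\<^bsub>R\<^esub> \<in> rgrade R n"
      using imageI[of "\<zero>\<^bsub>A\<^esub>" "free_grade K n" cls] by (simp add: odd_ring_simps(6) grade_iff trunc_zero)
    show "\<ominus>\<^bsub>R\<^esub> X \<in> rgrade R n" if X: "X \<in> rgrade R n" for X
    proof -
      obtain f where f: "f \<in> free_grade K n" "X = cls f" using X by (auto simp: odd_ring_simps(6))
      then have "\<ominus>\<^bsub>A\<^esub> f \<in> free_grade K n"
        using abelian_group_hom.hom_a_inv[OF trunc_hom, of f n] by (simp add: grade_iff)
      moreover have "\<ominus>\<^bsub>R\<^esub> X = cls (\<ominus>\<^bsub>A\<^esub> f)" using f by (simp add: grade_closed)
      ultimately show ?thesis by (simp add: odd_ring_simps(6))
    qed
    show "X \<oplus>\<^bsub>R\<^esub> Y \<in> rgrade R n" if X: "X \<in> rgrade R n" "Y \<in> rgrade R n" for X Y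
    proof -
      obtain f g where "f \<in> free_grade K n" "X = cls f" "g \<in> free_grade K n" "Y = cls g"
        using X by (auto simp: odd_ring_simps(6))
      then have "X \<oplus>\<^bsub>R\<^esub> Y = cls (f \<oplus>\<^bsub>A\<^esub> g)" "f \<oplus>\<^bsub>A\<^esub> g \<in> free_grade K n"
        by (simp_all add: grade_closed grade_add)
      then show ?thesis by (simp add: odd_ring_simps(6))
    qed
  qed
  fix X Q assume X: "X \<in> carrier R" and homog: "\<And>n Y. Y \<in> rgrade R n \<Longrightarrow> Q Y"
    and Q_add: "\<And>Y Z. \<lbrakk>Y \<in> carrier R; Z \<in> carrier R; Q Y; Q Z\<rbrakk> \<Longrightarrow> Q (Y \<oplus>\<^bsub>R\<^esub> Z)"
  obtain f where f: "f \<in> carrier A" "X = cls f" using X by (auto simp: carrier_odd_ring)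
  have "Q (cls f)" using f(1)
  proof (induction rule: free_alg_support_induct)
    case (single a w)
    have "single a w \<in> free_grade K (2 * int (length w))"
      using single_closed[OF single] by (auto simp: free_grade_def single_def)
    then show ?case using homog[unfolded odd_ring_simps(6), OF imageI] by blast
  qed (simp add: Q_add)
  then show "Q X" using f by simp
qed

lemma odd_graded_ring: "graded_ring R"
proof (intro graded_ring.intro graded_ring_axioms.intro R.ring_axioms odd_ring_grading)
  show "\<one>\<^bsub>R\<^esub> \<in> rgrade R 0"
    using imageI[OF const_grade[of \<one>], of cls] by (simp add: odd_ring_simps(6) flip: one_const)
  show "X \<otimes>\<^bsub>R\<^esub> Y \<in> rgrade R (i + j)" if X: "X \<in> rgrade R i" "Y \<in> rgrade R j" for X Y i j
  proof -
    obtain f g where "f \<in> free_grade K i" "X = cls f" "g \<in> free_grade K j" "Y = cls g"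
      using X by (auto simp: odd_ring_simps(6))
    then have "X \<otimes>\<^bsub>R\<^esub> Y = cls (f \<otimes>\<^bsub>A\<^esub> g)" "f \<otimes>\<^bsub>A\<^esub> g \<in> free_grade K (i + j)"
      by (simp_all add: grade_closed grade_mult)
    then show ?thesis by (simp add: odd_ring_simps(6))
  qed
qed

sublocale R: graded_ring R by (rule odd_graded_ring)

lemma odd_const_grade: "a \<in> carrier K \<Longrightarrow> odd_const K a \<in> rgrade R 0"
  by (auto simp: odd_const_def odd_ring_simps(6) const_grade)

lemma odd_var_grade: "odd_var K v \<in> rgrade R 2"
  by (auto simp: odd_var_def odd_ring_simps(6) var_grade)

lemma odd_const_closed [simp]: "a \<in> carrier K \<Longrightarrow> odd_const K a \<in> carrier R"
  by (simp add: odd_const_def)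

lemma odd_var_closed [simp]: "odd_var K v \<in> carrier R"
  by (simp add: odd_var_def)

lemma odd_ring_induct [consumes 1, case_names one add const var]:
  assumes f: "f \<in> carrier R"
    and one: "P \<one>\<^bsub>R\<^esub>"
    and add: "\<And>f g. \<lbrakk>f \<in> carrier R; g \<in> carrier R; P f; P g\<rbrakk> \<Longrightarrow> P (f \<oplus>\<^bsub>R\<^esub> g)"
    and const: "\<And>a f. \<lbrakk>a \<in> carrier K; f \<in> carrier R; P f\<rbrakk> \<Longrightarrow> P (odd_const K a \<otimes>\<^bsub>R\<^esub> f)"
    and var: "\<And>v f. \<lbrakk>f \<in> carrier R; P f\<rbrakk> \<Longrightarrow> P (odd_var K v \<otimes>\<^bsub>R\<^esub> f)"
  shows "P f"
proof -
  obtain g where g: "g \<in> carrier A" "f = cls g" using f by (auto simp: carrier_odd_ring)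
  have "P (cls g)" using g(1)
    by (induction rule: free_alg_induct)
      (simp_all add: one add const[unfolded odd_const_def] var[unfolded odd_var_def])
  then show ?thesis using g by simp
qed

end

section \<open>The odd Demazure operator on odd polynomials\<close>

definition other :: "var \<Rightarrow> var" where
  "other v = (case v of V1 \<Rightarrow> V2 | V2 \<Rightarrow> V1)"

locale odd_demazure = coefficient_ring K for K :: "('k, 'z) ring_scheme" +
  fixes s D :: "(var list \<Rightarrow> 'k) set \<Rightarrow> (var list \<Rightarrow> 'k) set"
  assumes swap: "is_odd_swap K s" and demazure: "is_odd_demazure K s D"
begin

abbreviation "x \<equiv> odd_var K"
abbreviation "part \<equiv> homog_part R (rgrade R)"

lemma other_other: "other (other v) = v"
  by (cases v) (simp_all add: other_def)

lemma s_ring_hom: "s \<in> ring_hom R R"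
  using swap by (simp add: is_odd_swap_def ring_iso_def)

sublocale s: ring_hom_ring R R s
  by (rule ring_hom_ringI2[OF R.ring_axioms R.ring_axioms s_ring_hom])

lemma s_const: "a \<in> carrier K \<Longrightarrow> s (odd_const K a) = odd_const K a"
  using swap by (simp add: is_odd_swap_def)

lemma s_var: "s (x v) = \<ominus>\<^bsub>R\<^esub> x (other v)"
  using swap by (cases v) (simp_all add: is_odd_swap_def other_def)

lemma D_closed: "f \<in> carrier R \<Longrightarrow> D f \<in> carrier R"
  and D_add: "\<lbrakk>f \<in> carrier R; g \<in> carrier R\<rbrakk> \<Longrightarrow> D (f \<oplus>\<^bsub>R\<^esub> g) = D f \<oplus>\<^bsub>R\<^esub> D g"
  and D_const: "\<lbrakk>a \<in> carrier K; f \<in> carrier R\<rbrakk>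
    \<Longrightarrow> D (odd_const K a \<otimes>\<^bsub>R\<^esub> f) = odd_const K a \<otimes>\<^bsub>R\<^esub> D f"
  and D_one: "D \<one>\<^bsub>R\<^esub> = \<zero>\<^bsub>R\<^esub>"
  and D_mult: "\<lbrakk>f \<in> carrier R; g \<in> carrier R\<rbrakk>
    \<Longrightarrow> D (f \<otimes>\<^bsub>R\<^esub> g) = D f \<otimes>\<^bsub>R\<^esub> g \<oplus>\<^bsub>R\<^esub> s f \<otimes>\<^bsub>R\<^esub> D g"
  using demazure by (auto simp: is_odd_demazure_def Let_def)

lemma D_var: "D (x v) = \<one>\<^bsub>R\<^esub>"
  using demazure by (cases v) (simp_all add: is_odd_demazure_def Let_def)

sublocale D: abelian_group_hom R R D
  by (rule abelian_group_hom_additiveI) (simp_all add: D_closed D_add R.abelian_group_axioms)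

lemma D_var_mult:
  "f \<in> carrier R \<Longrightarrow> D (x v \<otimes>\<^bsub>R\<^esub> f) = f \<oplus>\<^bsub>R\<^esub> (\<ominus>\<^bsub>R\<^esub> x (other v)) \<otimes>\<^bsub>R\<^esub> D f"
  by (simp add: D_mult D_var s_var)

lemma s_s: "f \<in> carrier R \<Longrightarrow> s (s f) = f"
proof (induction rule: odd_ring_induct)
  case (var v f)
  then show ?case by (simp add: s_var other_other R.l_minus R.r_minus)
qed (simp_all add: s_const)

text \<open>The sign comes from the variables: \<open>s\<close> sends each to minus the other one, while \<open>D\<close> is \<open>1\<close> on both.\<close>

lemma D_s: "f \<in> carrier R \<Longrightarrow> D (s f) = \<ominus>\<^bsub>R\<^esub> s (D f)"
proof (induction rule: odd_ring_induct)
  case (add f g)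
  then show ?case by (simp add: R.minus_add)
next
  case (const a f)
  then show ?case by (simp add: s_const D_const R.r_minus)
next
  case (var v f)
  have "D (s (x v \<otimes>\<^bsub>R\<^esub> f)) = \<ominus>\<^bsub>R\<^esub> D (x (other v) \<otimes>\<^bsub>R\<^esub> s f)"
    using var by (simp add: s_var R.l_minus)
  also have "\<dots> = \<ominus>\<^bsub>R\<^esub> s (D (x v \<otimes>\<^bsub>R\<^esub> f))"
    using var by (simp add: D_var_mult other_other s_var R.l_minus R.r_minus)
  finally show ?case .
qed (simp add: D_one)

lemma D_D: "f \<in> carrier R \<Longrightarrow> D (D f) = \<zero>\<^bsub>R\<^esub>"
proof (induction rule: odd_ring_induct)
  case (const a f)
  then show ?case by (simp add: D_const)
next
  case (var v f)
  then show ?case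
    by (simp add: D_var_mult R.l_minus R.r_neg)
qed (simp_all add: D_one)

lemma part_const: "\<lbrakk>a \<in> carrier K; f \<in> carrier R\<rbrakk>
    \<Longrightarrow> part i (odd_const K a \<otimes>\<^bsub>R\<^esub> f) = odd_const K a \<otimes>\<^bsub>R\<^esub> part i f"
  using R.homog_part_mult_left[OF odd_const_grade, of a f i] by simp

lemma part_var: "f \<in> carrier R \<Longrightarrow> part i (x v \<otimes>\<^bsub>R\<^esub> f) = x v \<otimes>\<^bsub>R\<^esub> part (i - 2) f"
  by (rule R.homog_part_mult_left[OF odd_var_grade])

lemma part_neg: "f \<in> carrier R \<Longrightarrow> part i (\<ominus>\<^bsub>R\<^esub> f) = \<ominus>\<^bsub>R\<^esub> part i f"
  by (rule abelian_group_hom.hom_a_inv[OF R.gr.homog_part_hom])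

lemma part_one: "part i \<one>\<^bsub>R\<^esub> = (if i = 0 then \<one>\<^bsub>R\<^esub> else \<zero>\<^bsub>R\<^esub>)"
  by (rule R.gr.homog_part_homog[OF R.rgrade_one])

lemma s_part: "f \<in> carrier R \<Longrightarrow> s (part i f) = part i (s f)"
proof (induction arbitrary: i rule: odd_ring_induct)
  case one
  then show ?case by (simp add: part_one)
next
  case (add f g)
  then show ?case by (simp add: R.gr.homog_part_add)
next
  case (const a f)
  then show ?case by (simp add: part_const s_const)
next
  case (var v f)
  then show ?case by (simp add: part_var s_var part_neg R.l_minus)
qed

text \<open>In \<open>D(x f) = f - x' D(f)\<close> both terms have degree two less than \<open>x f\<close>.\<close>

lemma D_part: "f \<in> carrier R \<Longrightarrow> D (part i f) = part (i - 2) (D f)"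
proof (induction arbitrary: i rule: odd_ring_induct)
  case one
  then show ?case by (simp add: part_one D_one R.gr.homog_part_zero)
next
  case (add f g)
  then show ?case by (simp add: R.gr.homog_part_add)
next
  case (const a f)
  then show ?case by (simp add: part_const D_const)
next
  case (var v f)
  then show ?case
    by (simp add: part_var D_var_mult part_neg R.l_minus R.gr.homog_part_add)
qed

lemma s_grade: "f \<in> rgrade R i \<Longrightarrow> s f \<in> rgrade R i"
  using s_part[of f i] R.gr.homog_part_homog[of f i i] R.gr.grade_carrier[of f i]
    R.gr.homog_part_grade[of "s f" i] by simp

lemma D_grade: "f \<in> rgrade R i \<Longrightarrow> D f \<in> rgrade R (i - 2)"
  using D_part[of f i] R.gr.homog_part_homog[of f i i] R.gr.grade_carrier[of f i]
    R.gr.homog_part_grade[of "D f" "i - 2"] by simp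

sublocale dem: demazure_ring R s D "x V1" "x V2"
  by (unfold_locales)
    (simp_all add: s_ring_hom s_s s_grade D_closed D_add D_mult D_one D_D D_s D_grade
      odd_var_grade s_var other_def D_var)

lemma invariants_eq: "odd_invariants K D = dem.invariants"
  by (simp add: odd_invariants_def dem.invariants_def Let_def)

end

section \<open>The two adjunctions\<close>

theorem proposition2p1:
  fixes K :: "('k, 'z) ring_scheme"
    and s D :: "(var list \<Rightarrow> 'k) set \<Rightarrow> (var list \<Rightarrow> 'k) set"
  assumes "cring K"
    and "is_odd_swap K s"
    and "is_odd_demazure K s D"
  shows "adjoint_pair (odd_invariants K D) (odd_ring K)
           (F_up K D :: (_, 'm, _, _) gfunctor)
           (F_down :: (_, 'n, _, _) gfunctor)
       \<and> adjoint_pair (odd_ring K) (odd_invariants K D)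
           (F_down :: (_, 'm, _, _) gfunctor)
           (shift_functor 2 \<circ>\<^sub>F F_minus K s \<circ>\<^sub>F F_up K D :: (_, 'n, _, _) gfunctor)"
proof -
  interpret K: cring K by fact
  interpret odd_demazure K s D
    by unfold_locales fact+
  show ?thesis
    unfolding F_up_def F_minus_def invariants_eq
    using dem.Sub.induction_restriction_adjoint dem.restriction_coinduction_adjoint by blast
qed

end
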